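(* Let $m=m(x,\xi)$ be a continuous function on $\mathbb{R}^n\times\mathbb{R}$ satisfying $\Vert m\Vert_{l.u.,h^s}<\infty$, and let $m(x,H)$ be the spectral pseudo-multiplier with symbol $\{m(x,\ell)\}_{x\in\mathbb{R}^n,\ell\in2\mathbb{N}_0+n}$. Let $\delta(p)=n\left|\frac1p-\frac12\right|-\frac12$ and $\frac1p+\frac1{p'}=1$. Under any one of the following conditions (i) $n\ge2$, $1\le p\le\frac{2n}{n+2}$ and $s>\frac{n+1}{2}+\delta(p)$; (ii) $n\ge2$, $\frac{2n}{n+2}<p\le2$ and $s>\frac{3n}{2}$; (iii) $n=1$, $\frac43<p\le2$ and $s>2-\frac1p$; (iv) $n=1$, $p=\frac43$ and $s>\frac32$; (v) $n=1$, $1<p<\frac43$ and $s>1+\frac1{3p}$; the operator $m(x,H)$ extends to a bounded operator from $L^p(\mathbb{R}^n)$ into $L^{p'}(\mathbb{R}^n)$.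
   Context: $H=-\Delta+|x|^2$ is the harmonic oscillator on $\mathbb{R}^n$, with eigenvalues $2|\nu|+n$, $\nu\in\mathbb{N}_0^n$, $|\nu|=\nu_1+\cdots+\nu_n$, and eigenfunctions the Hermite functions $\phi_\nu(x)=\prod_{j=1}^n\phi_{\nu_j}(x_j)$, where $\phi_k(t)=(2^kk!\sqrt\pi)^{-1/2}H_k(t)e^{-t^2/2}$, $H_k(t)=(-1)^ke^{t^2}\frac{d^k}{dt^k}e^{-t^2}$. $P_j$ denotes the orthogonal projection of $L^2(\mathbb{R}^n)$ onto the span of $\{\phi_\nu:|\nu|=j\}$, i.e. the eigenspace of $H$ with eigenvalue $2j+n$. Let $2\mathbb{N}_0+n=\{2j+n:j\in\mathbb{N}_0\}$. The spectral pseudo-multiplier is $$m(x,H)f(x)=\sum_{j=0}^\infty m(x,2j+n)P_jf(x),\qquad f\in C_0^\infty(\mathbb{R}^n).$$ The Hörmander condition of order $s>0$ uses $$\Vert m\Vert_{l.u.,h^s}=\sup_{x\in\mathbb{R}^n,\,k>0}2^{k(s-\frac n2)}\left(\int_{-\infty}^\infty\langle t\rangle^{2s}\,|\mathscr{F}[m(x,\cdot)\psi(2^{-k}|\cdot|)](t)|^2\,dt\right)^{1/2},$$ where $\mathscr{F}$ is the one-dimensional Fourier transform, $\mathscr{F}g(t)=\int_{\mathbb{R}}e^{-2\pi it\xi}g(\xi)\,d\xi$, $\langle t\rangle=(1+t^2)^{1/2}$, and $\psi\in\mathscr{D}(0,\infty)$ is a fixed function supported in $[\frac12,4]$ with $\psi\equiv1$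 on $[1,2]$. *)

theory Defs
  imports "HOL-Analysis.Analysis" "HOL-Probability.Essential_Supremum"
begin

section \<open>Test functions\<close>

primrec Ck :: "nat \<Rightarrow> ('a::euclidean_space \<Rightarrow> complex) \<Rightarrow> bool" where
  "Ck 0 f \<longleftrightarrow> continuous_on UNIV f"
| "Ck (Suc k) f \<longleftrightarrow> (\<forall>x. f differentiable (at x)) \<and>
     (\<forall>e\<in>Basis. Ck k (\<lambda>x. frechet_derivative f (at x) e))"

definition smooth :: "('a::euclidean_space \<Rightarrow> complex) \<Rightarrow> bool" where
  "smooth f \<longleftrightarrow> (\<forall>k. Ck k f)"

definition supp :: "('a::euclidean_space \<Rightarrow> complex) \<Rightarrow> 'a set" where
  "supp f = closure {x. f x \<noteq> 0}"

definition test_function :: "('a::euclidean_space \<Rightarrow> complex) \<Rightarrow> bool" where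
  "test_function f \<longleftrightarrow> smooth f \<and> compact (supp f)"


section \<open>Lebesgue spaces\<close>

text \<open>Powers of extended nonnegative numbers; only exponents \<open>r > 0\<close> are used, so that
  the power of infinity is infinity.\<close>

definition epowr :: "ennreal \<Rightarrow> real \<Rightarrow> ennreal" where
  "epowr a r = (if a = \<infinity> then \<infinity> else ennreal (enn2real a powr r))"

text \<open>The exponent ranges over \<open>[1, \<infinity>]\<close>.\<close>

definition Lp_norm :: "ennreal \<Rightarrow> ('a::euclidean_space \<Rightarrow> complex) \<Rightarrow> ennreal" where
  "Lp_norm p f =
     (if p = \<infinity> then esssup lebesgue (\<lambda>x. ennreal (norm (f x)))
      else epowr (\<integral>\<^sup>+ x. ennreal (norm (f x) powr enn2real p) \<partial>lebesgue) (1 / enn2real p))"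

definition Lp :: "ennreal \<Rightarrow> ('a::euclidean_space \<Rightarrow> complex) set" where
  "Lp p = {f \<in> borel_measurable lebesgue. Lp_norm p f < \<infinity>}"

text \<open>An operator \<open>A\<close>, given on test functions, extends to a bounded linear operator from
  \<open>L\<^sup>p\<close> into \<open>L\<^sup>q\<close>. Elements of these spaces are represented by functions, hence
  the identities hold almost everywhere; linearity together with boundedness forces \<open>T\<close> to
  respect equality almost everywhere.\<close>

definition extends_to_bounded_operator ::
    "ennreal \<Rightarrow> ennreal \<Rightarrow> (('a::euclidean_space \<Rightarrow> complex) \<Rightarrow> 'a \<Rightarrow> complex) \<Rightarrow> bool" where
  "extends_to_bounded_operator p q A \<longleftrightarrow>
     (\<exists>T. (\<forall>f\<in>Lp p. T f \<in> Lp q)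
        \<and> (\<forall>f\<in>Lp p. \<forall>g\<in>Lp p. AE x in lebesgue. T (\<lambda>y. f y + g y) x = T f x + T g x)
        \<and> (\<forall>c. \<forall>f\<in>Lp p. AE x in lebesgue. T (\<lambda>y. c * f y) x = c * T f x)
        \<and> (\<exists>C\<ge>0::real. \<forall>f\<in>Lp p. Lp_norm q (T f) \<le> ennreal C * Lp_norm p f)
        \<and> (\<forall>f. test_function f \<longrightarrow> (AE x in lebesgue. T f x = A f x)))"


section \<open>Hermite functions and spectral projections of the harmonic oscillator\<close>

definition hermite_poly :: "nat \<Rightarrow> real \<Rightarrow> real" where
  "hermite_poly k t = (-1) ^ k * exp (t\<^sup>2) * (deriv ^^ k) (\<lambda>u. exp (- u\<^sup>2)) t"

definition hermite_fun :: "nat \<Rightarrow> real \<Rightarrow> real" where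
  "hermite_fun k t =
     (2 ^ k * fact k * sqrt pi) powr (- 1 / 2) * hermite_poly k t * exp (- t\<^sup>2 / 2)"

definition hermite_funs :: "nat ^ 'n \<Rightarrow> real ^ 'n \<Rightarrow> complex" where
  "hermite_funs \<nu> x = complex_of_real (\<Prod>j\<in>UNIV. hermite_fun (\<nu> $ j) (x $ j))"

definition multi_indices :: "nat \<Rightarrow> (nat ^ 'n) set" where
  "multi_indices j = {\<nu>. (\<Sum>i\<in>UNIV. \<nu> $ i) = j}"

text \<open>The complex linear span of the Hermite functions of order \<open>j\<close>; there are only
  finitely many of them.\<close>

definition hermite_span :: "nat \<Rightarrow> (real ^ 'n \<Rightarrow> complex) set" where
  "hermite_span j = {g. \<exists>c. g = (\<lambda>x. \<Sum>\<nu>\<in>multi_indices j. c \<nu> * hermite_funs \<nu> x)}"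

definition L2_inner :: "('a::euclidean_space \<Rightarrow> complex) \<Rightarrow> ('a \<Rightarrow> complex) \<Rightarrow> complex" where
  "L2_inner f g = (LINT x|lebesgue. f x * cnj (g x))"

text \<open>The orthogonal projection of \<open>f \<in> L\<^sup>2\<close> onto a subspace \<open>E\<close>. It is well defined as
  a function, not only as a class modulo null sets, for finite-dimensional \<open>E\<close> consisting of
  continuous functions, such as \<open>hermite_span j\<close>.\<close>

definition orth_proj ::
    "('a::euclidean_space \<Rightarrow> complex) set \<Rightarrow> ('a \<Rightarrow> complex) \<Rightarrow> 'a \<Rightarrow> complex" where
  "orth_proj E f = (THE g. g \<in> E \<and> (\<forall>h\<in>E. L2_inner (\<lambda>x. f x - g x) h = 0))"

definition hermite_proj :: "nat \<Rightarrow> (real ^ 'n \<Rightarrow> complex) \<Rightarrow> real ^ 'n \<Rightarrow> complex" where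
  "hermite_proj j = orth_proj (hermite_span j)"


section \<open>Spectral pseudo-multipliers and the Hoermander condition\<close>

definition pseudo_multiplier_term ::
    "(real ^ 'n \<Rightarrow> real \<Rightarrow> complex) \<Rightarrow> (real ^ 'n \<Rightarrow> complex) \<Rightarrow> real ^ 'n \<Rightarrow> nat \<Rightarrow> complex" where
  "pseudo_multiplier_term m f x j = m x (real (2 * j + CARD('n))) * hermite_proj j f x"

definition pseudo_multiplier ::
    "(real ^ 'n \<Rightarrow> real \<Rightarrow> complex) \<Rightarrow> (real ^ 'n \<Rightarrow> complex) \<Rightarrow> real ^ 'n \<Rightarrow> complex" where
  "pseudo_multiplier m f x = (\<Sum>j. pseudo_multiplier_term m f x j)"

definition fourier :: "(real \<Rightarrow> complex) \<Rightarrow> real \<Rightarrow> complex" where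
  "fourier g t = (LINT \<xi>|lebesgue. exp (- 2 * of_real pi * \<i> * of_real t * of_real \<xi>) * g \<xi>)"

definition japanese_bracket :: "real \<Rightarrow> real" where
  "japanese_bracket t = sqrt (1 + t\<^sup>2)"

text \<open>The scale parameter \<open>k\<close> ranges over all positive real numbers. With integers \<open>k \<ge> 1\<close>
  only, the cut-offs \<open>\<psi> (2 powr - k * \<bar>\<xi>\<bar>)\<close> would all vanish at \<open>\<xi> = 1\<close>, the lowest
  eigenvalue in dimension one.\<close>

definition hoermander_norm ::
    "(real \<Rightarrow> complex) \<Rightarrow> real \<Rightarrow> (real ^ 'n \<Rightarrow> real \<Rightarrow> complex) \<Rightarrow> ennreal" where
  "hoermander_norm \<psi> s m =
     (SUP x. SUP k\<in>{0::real<..}.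
        ennreal (2 powr (k * (s - real CARD('n) / 2))) *
        epowr (\<integral>\<^sup>+ t. ennreal (japanese_bracket t powr (2 * s) *
                 (cmod (fourier (\<lambda>\<xi>. m x \<xi> * \<psi> (2 powr (- k) * \<bar>\<xi>\<bar>)) t))\<^sup>2) \<partial>lebesgue)
              (1 / 2))"

definition delta :: "nat \<Rightarrow> real \<Rightarrow> real" where
  "delta n p = real n * \<bar>1 / p - 1 / 2\<bar> - 1 / 2"

end

theory Submission
  imports Defs "HOL-Complex_Analysis.Complex_Analysis" "HOL-Probability.Probability"
begin

text \<open>The Hoermander condition forces \<open>m(x, \<xi>)\<close> to decay like \<open>\<xi>\<close> to the power \<open>n/2 - s\<close>, uniformly
  in \<open>x\<close>. By duality the norm of \<open>P\<^sub>j\<close> from \<open>L\<^sup>p\<close> to its dual is the square of the norm of \<open>P\<^sub>j\<close>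
  from \<open>L\<^sup>2\<close> to the dual of \<open>L\<^sup>p\<close>, so it suffices that the products of these norms with the symbol
  are summable in \<open>j\<close>. For \<open>n \<ge> 2\<close> eigenfunctions are estimated by Mehler's formula: the
  coefficients of a power series with nonnegative coefficients are controlled by its size on the
  circle of radius \<open>1 - 1/(j + 2)\<close>, and this yields a weak-type bound, hence Lebesgue bounds up to
  an arbitrarily small loss. For \<open>n = 1\<close> Mehler's formula gives the exact fourth moment of a Hermite
  function, the Hermite equation turns it into a sup bound, and one interpolates.\<close>

section \<open>Hermite functions\<close>

text \<open>The series is summed absolutely, so everything reduces to one inequality of exponents,
  \<open>\<kappa> - e > 1\<close>, where \<open>\<kappa> = s - n/2\<close> is the decay of the
  symbol and \<open>(j + 2)^e\<close> bounds the norm of the j-th projection. All conditions on s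
  being strict, an arbitrarily small loss in e is harmless. For \<open>|r| < 1\<close> the kernel is
  bounded by \<open>|1 - r^2|^(-n/2)\<close>, whose integrals over circles do not stay bounded as
  the radius tends to 1 once n >= 2; the cure is a geometric mean with a second, nonsingular bound.
  This works both for the kernel on the diagonal and for the energies of an indicator function with
  a phase, and the latter give the weak-type bound. For n = 1 the same method shows no decay in j,
  while the conditions demand it: squared norms must decrease almost like \<open>j^(-1/4)\<close>
  for q near 4, the exponent dual to p = 4/3. The fourth moment is computable because a product of
  two diagonal Mehler kernels is a Gaussian in x. The passage from there to the sup norm costs a
  power of the eigenvalue that reflects the width of the region around the turning point, where a
  Hermite function does not oscillate.\<close>

primrec hermp :: "nat \<Rightarrow> real poly" where
  "hermp 0 = 1"
| "hermp (Suc k) = [:0, 2:] * hermp k - pderiv (hermp k)"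

lemma deriv_iter_gauss:
  "(deriv ^^ k) (\<lambda>u::real. exp (- u\<^sup>2)) = (\<lambda>t. (-1) ^ k * (poly (hermp k) t * exp (- t\<^sup>2)))"
proof (induction k)
  case (Suc k)
  have "deriv (\<lambda>t. (-1) ^ k * (poly (hermp k) t * exp (- t\<^sup>2))) t
      = (-1) ^ Suc k * (poly (hermp (Suc k)) t * exp (- t\<^sup>2))" for t :: real
    by (rule DERIV_imp_deriv) (auto intro!: derivative_eq_intros simp: algebra_simps)
  then show ?case by (simp add: Suc fun_eq_iff)
qed simp

lemma hermite_poly_eq: "hermite_poly k t = poly (hermp k) t"
proof -
  have "((-1::real) ^ k * (-1) ^ k) = 1" by (simp flip: power_mult_distrib)
  moreover have "exp (t\<^sup>2) * exp (- t\<^sup>2) = 1" by (simp add: exp_minus)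
  ultimately have "((-1) ^ k * (-1) ^ k) * (exp (t\<^sup>2) * exp (- t\<^sup>2)) * poly (hermp k) t = poly (hermp k) t"
    by simp
  then show ?thesis
    unfolding hermite_poly_def deriv_iter_gauss by (simp add: algebra_simps)
qed

text \<open>Differentiating the defining recursion and using the induction hypothesis twice, once
  under the second derivative, lets the terms recombine into \<open>hermp (Suc k)\<close>. This
  lowering relation is what turns the recursion with a derivative into the three-term
  recurrence.\<close>

lemma pderiv_hermp_Suc: "pderiv (hermp (Suc k)) = smult (2 * real (Suc k)) (hermp k)"
proof (induction k)
  case 0
  then show ?case by (simp add: pderiv_pCons)
next
  case (Suc k)
  have "poly (pderiv (hermp (Suc (Suc k)))) t = poly (smult (2 * real (Suc (Suc k))) (hermp (Suc k))) t" for t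
  proof -
    have 1: "pderiv (hermp (Suc (Suc k))) = smult 2 (hermp (Suc k)) + [:0, 2:] * pderiv (hermp (Suc k))
        - pderiv (pderiv (hermp (Suc k)))"
      by (subst hermp.simps(2)) (simp only: pderiv_diff pderiv_mult, simp del: hermp.simps add: pderiv_pCons algebra_simps)
    have 2: "pderiv (pderiv (hermp (Suc k))) = smult (2 * real (Suc k)) (pderiv (hermp k))"
      by (simp only: Suc pderiv_smult)
    have 3: "poly (hermp (Suc k)) t = 2 * t * poly (hermp k) t - poly (pderiv (hermp k)) t" by simp
    show ?thesis
      unfolding 1 2 unfolding Suc
      by (simp del: hermp.simps add: 3 algebra_simps)
  qed
  then have "poly (pderiv (hermp (Suc (Suc k)))) = poly (smult (2 * real (Suc (Suc k))) (hermp (Suc k)))"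
    by (rule ext)
  then show ?case by (simp only: poly_eq_poly_eq_iff)
qed

lemma hermp_rec:
  "poly (hermp (Suc (Suc k))) t = 2 * t * poly (hermp (Suc k)) t - 2 * real (Suc k) * poly (hermp k) t"
  by (subst hermp.simps(2)) (simp only: poly_diff poly_mult pderiv_hermp_Suc poly_smult, simp)

text \<open>For k = 0 the truncated index k - 1 is harmless because of the factor k, so that later
  formulas need no case distinction.\<close>

lemma DERIV_hermp: "(poly (hermp k) has_real_derivative 2 * real k * poly (hermp (k - 1)) t) (at t)"
proof (cases k)
  case (Suc j)
  show ?thesis unfolding Suc using poly_DERIV[of "hermp (Suc j)" t]
    by (simp only: pderiv_hermp_Suc poly_smult diff_Suc_1)
next
  case 0
  moreover have "poly (1 :: real poly) = (\<lambda>_. 1)" by auto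
  ultimately show ?thesis by simp
qed

lemma poly_pderiv_hermp: "poly (pderiv (hermp k)) t = 2 * real k * poly (hermp (k - 1)) t"
  by (rule DERIV_unique[OF poly_DERIV DERIV_hermp])

section \<open>Normalised Hermite functions and the Hermite equation\<close>

definition hc :: "nat \<Rightarrow> real" where "hc k = (2 ^ k * fact k * sqrt pi) powr (- 1 / 2)"

lemma hc_sq: "hc k ^ 2 = 1 / (2 ^ k * fact k * sqrt pi)"
proof -
  have "hc k ^ 2 = (2 ^ k * fact k * sqrt pi) powr (-1)"
    by (simp add: hc_def power2_eq_square flip: powr_add)
  then show ?thesis by (simp add: powr_minus_divide)
qed

lemma hermite_fun_eq: "hermite_fun k t = hc k * poly (hermp k) t * exp (- t\<^sup>2 / 2)"
  by (simp add: hermite_fun_def hermite_poly_eq hc_def)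

definition hermite_fun' :: "nat \<Rightarrow> real \<Rightarrow> real" where
  "hermite_fun' k t = hc k * (2 * real k * poly (hermp (k - 1)) t - t * poly (hermp k) t) * exp (- t\<^sup>2 / 2)"

lemma DERIV_hermite_fun: "(hermite_fun k has_real_derivative hermite_fun' k t) (at t)"
proof -
  have "((\<lambda>t. hc k * poly (hermp k) t * exp (- t\<^sup>2 / 2)) has_real_derivative hermite_fun' k t) (at t)"
    unfolding hermite_fun'_def
    by (auto intro!: derivative_eq_intros simp: poly_pderiv_hermp[unfolded One_nat_def] algebra_simps)
  then show ?thesis by (simp add: hermite_fun_eq[abs_def])
qed

text \<open>The eigenvalue equation of the oscillator in one variable. The twice lowered polynomial
  in the second derivative is eliminated by the three-term recurrence.\<close>

lemma DERIV_hermite_fun':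
  "(hermite_fun' k has_real_derivative (t\<^sup>2 - real (2 * k + 1)) * hermite_fun k t) (at t)"
proof -
  \<comment> \<open>The factor \<open>k (k - 1)\<close> removes the truncated indices for k = 0 and
    k = 1; from k = 2 on this is \<open>hermp_rec\<close>.\<close>
  have key: "2 * real k * (2 * real (k - 1) * poly (hermp (k - 1 - 1)) t)
      = 2 * t * (2 * real k * poly (hermp (k - 1)) t) - 2 * real k * poly (hermp k) t"
  proof (cases k)
    case (Suc j)
    show ?thesis
    proof (cases j)
      case (Suc i)
      show ?thesis using hermp_rec[of i t] by (simp only: \<open>k = Suc j\<close> Suc diff_Suc_1) (simp add: algebra_simps)
    qed (simp add: Suc)
  qed simp
  have "((\<lambda>t. hc k * (2 * real k * poly (hermp (k - 1)) t - t * poly (hermp k) t) * exp (- t\<^sup>2 / 2))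
      has_real_derivative hc k * ((2 * real k * (2 * real (k - 1) * poly (hermp (k - 1 - 1)) t)
         - (poly (hermp k) t + t * (2 * real k * poly (hermp (k - 1)) t)))
         - t * (2 * real k * poly (hermp (k - 1)) t - t * poly (hermp k) t)) * exp (- t\<^sup>2 / 2)) (at t)"
    by (auto intro!: derivative_eq_intros simp: poly_pderiv_hermp[unfolded One_nat_def] algebra_simps)
  also have "hc k * ((2 * real k * (2 * real (k - 1) * poly (hermp (k - 1 - 1)) t)
         - (poly (hermp k) t + t * (2 * real k * poly (hermp (k - 1)) t)))
         - t * (2 * real k * poly (hermp (k - 1)) t - t * poly (hermp k) t)) * exp (- t\<^sup>2 / 2)
      = (t\<^sup>2 - real (2 * k + 1)) * hermite_fun k t"
    unfolding key hermite_fun_eq by (simp add: algebra_simps power2_eq_square)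
  finally show ?thesis by (simp add: hermite_fun'_def[abs_def])
qed

lemma continuous_on_hermite_fun: "continuous_on A (hermite_fun k)"
  by (meson DERIV_hermite_fun DERIV_isCont continuous_at_imp_continuous_on)

lemma measurable_hermite_fun[measurable]: "hermite_fun k \<in> borel_measurable borel"
  by (intro borel_measurable_continuous_onI continuous_on_hermite_fun)

subsection \<open>Gaussian decay and orthonormality\<close>

text \<open>A single term of the exponential series dominates the power. All monomials are thereby
  absorbed into one function, from which both the limits at infinity and boundedness follow.\<close>

lemma monom_gauss_bound: "\<bar>t ^ i * exp (- t\<^sup>2 / 2)\<bar> \<le> fact i * exp (\<bar>t\<bar> - t\<^sup>2 / 2)" for t :: real
proof -
  have "\<bar>t\<bar> ^ i / fact i \<le> exp \<bar>t\<bar>"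
  proof -
    have "(\<Sum>j\<in>{i}. \<bar>t\<bar> ^ j /\<^sub>R fact j) \<le> exp \<bar>t\<bar>"
      unfolding exp_def by (rule sum_le_suminf) (use summable_exp_generic[of "\<bar>t\<bar>"] in auto)
    then show ?thesis by (simp add: field_simps)
  qed
  then have "\<bar>t\<bar> ^ i \<le> fact i * exp \<bar>t\<bar>" by (simp add: field_simps)
  then have "\<bar>t\<bar> ^ i * exp (- t\<^sup>2 / 2) \<le> fact i * exp \<bar>t\<bar> * exp (- t\<^sup>2 / 2)" by simp
  then show ?thesis by (simp add: abs_mult power_abs mult.assoc flip: exp_add)
qed

lemma poly_gauss_tendsto:
  "((\<lambda>t. poly p t * exp (- t\<^sup>2 / 2)) \<longlongrightarrow> 0) at_top"
  "((\<lambda>t. poly p t * exp (- t\<^sup>2 / 2)) \<longlongrightarrow> 0) at_bot" for p :: "real poly"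
proof -
  have m: "((\<lambda>t. t ^ i * exp (- t\<^sup>2 / 2)) \<longlongrightarrow> 0) F"
    if "((\<lambda>t. exp (\<bar>t\<bar> - t\<^sup>2 / 2)) \<longlongrightarrow> 0) F" for i and F :: "real filter"
    by (rule Lim_null_comparison[OF always_eventually tendsto_mult_right_zero[OF that, of "fact i"]])
       (use monom_gauss_bound[of _ i] in auto)
  have p: "((\<lambda>t. poly p t * exp (- t\<^sup>2 / 2)) \<longlongrightarrow> 0) F"
    if "((\<lambda>t. exp (\<bar>t\<bar> - t\<^sup>2 / 2)) \<longlongrightarrow> 0) F" for F :: "real filter"
    unfolding poly_altdef sum_distrib_right mult.assoc
    by (intro tendsto_null_sum tendsto_mult_right_zero m that)
  have a: "((\<lambda>t. exp (\<bar>t\<bar> - t\<^sup>2 / 2)) \<longlongrightarrow> (0::real)) at_top" by real_asymp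
  then show "((\<lambda>t. poly p t * exp (- t\<^sup>2 / 2)) \<longlongrightarrow> 0) at_top" by (rule p)
  have "((\<lambda>t. exp (\<bar>t\<bar> - t\<^sup>2 / 2)) \<longlongrightarrow> (0::real)) at_bot"
    using a by (simp add: filterlim_at_bot_mirror)
  then show "((\<lambda>t. poly p t * exp (- t\<^sup>2 / 2)) \<longlongrightarrow> 0) at_bot" by (rule p)
qed

lemma integrable_poly_gauss:
  "integrable lborel (\<lambda>t. poly p t * exp (- t\<^sup>2 / 2))" for p :: "real poly"
proof -
  have "integrable lborel (\<lambda>t::real. t ^ i * exp (- t\<^sup>2 / 2))" for i
    using integrable_mult_right[OF integrable_std_normal_moment[of i], of "sqrt (2 * pi)"]
    by (simp add: std_normal_density_def algebra_simps)
  then show ?thesis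
    unfolding poly_altdef sum_distrib_right mult.assoc by (intro Bochner_Integration.integrable_sum integrable_mult_right)
qed

lemma bounded_poly_gauss: "\<exists>B. \<forall>t. \<bar>poly p t * exp (- t\<^sup>2 / 2)\<bar> \<le> B" for p :: "real poly"
proof -
  have m: "\<bar>t ^ i * exp (- t\<^sup>2 / 2)\<bar> \<le> fact i * exp (1 / 2)" for i and t :: real
  proof -
    have "\<bar>t\<bar> - t\<^sup>2 / 2 \<le> 1 / 2"
      using zero_le_power2[of "\<bar>t\<bar> - 1"] by (simp add: power2_diff)
    then show ?thesis
      using monom_gauss_bound[of t i] by (smt (verit) exp_le_cancel_iff fact_ge_zero mult_left_mono)
  qed
  show ?thesis
  proof (intro exI allI)
    fix t :: real
    show "\<bar>poly p t * exp (- t\<^sup>2 / 2)\<bar> \<le> (\<Sum>i\<le>degree p. \<bar>coeff p i\<bar> * (fact i * exp (1 / 2)))"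
      unfolding poly_altdef sum_distrib_right mult.assoc
      by (rule order_trans[OF sum_abs sum_mono]) (simp only: abs_mult[of "coeff p _"], intro mult_left_mono m abs_ge_zero)
  qed
qed

text \<open>The weight \<open>exp (- t^2)\<close> belongs to products of two Hermite functions and
  is dominated by the weight of one.\<close>

lemma poly_gauss2:
  fixes p :: "real poly"
  shows "integrable lborel (\<lambda>t. poly p t * exp (- t\<^sup>2))"
    "((\<lambda>t. poly p t * exp (- t\<^sup>2)) \<longlongrightarrow> 0) at_top"
    "((\<lambda>t. poly p t * exp (- t\<^sup>2)) \<longlongrightarrow> 0) at_bot"
proof -
  have b: "norm (poly p t * exp (- t\<^sup>2)) \<le> norm (poly p t * exp (- t\<^sup>2 / 2))" for t
    by (simp add: abs_mult mult_left_mono)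
  show "integrable lborel (\<lambda>t. poly p t * exp (- t\<^sup>2))"
    by (rule Bochner_Integration.integrable_bound[OF integrable_poly_gauss[of p]])
       (use b in \<open>auto intro!: borel_measurable_continuous_onI continuous_intros\<close>)
  show "((\<lambda>t. poly p t * exp (- t\<^sup>2)) \<longlongrightarrow> 0) at_top"
    by (rule Lim_null_comparison[OF always_eventually tendsto_norm_zero[OF poly_gauss_tendsto(1)[of p]]]) (use b in blast)
  show "((\<lambda>t. poly p t * exp (- t\<^sup>2)) \<longlongrightarrow> 0) at_bot"
    by (rule Lim_null_comparison[OF always_eventually tendsto_norm_zero[OF poly_gauss_tendsto(2)[of p]]]) (use b in blast)
qed

lemma lborel_integral_deriv_eq_0:
  fixes F f :: "real \<Rightarrow> real"
  assumes "\<And>t. (F has_real_derivative f t) (at t)" "continuous_on UNIV f" "integrable lborel f"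
    and "(F \<longlongrightarrow> 0) at_top" "(F \<longlongrightarrow> 0) at_bot"
  shows "integral\<^sup>L lborel f = 0"
proof -
  have "(LBINT t=-\<infinity>..\<infinity>. f t) = 0 - 0"
  proof (rule interval_integral_FTC_integrable)
    show "(F has_vector_derivative f x) (at x)" for x
      using assms(1) by (simp add: has_real_derivative_iff_has_vector_derivative)
    show "isCont f x" for x using assms(2) by (simp add: continuous_on_eq_continuous_at)
    show "set_integrable lborel (einterval (- \<infinity>) \<infinity>) f"
      using assms(3) by (simp add: set_integrable_def)
    show "((F \<circ> real_of_ereal) \<longlongrightarrow> 0) (at_right (- \<infinity>))" "((F \<circ> real_of_ereal) \<longlongrightarrow> 0) (at_left \<infinity>)"
      using assms(4,5) by (simp_all add: ereal_tendsto_simps)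
  qed simp
  then show ?thesis
    by (simp add: interval_lebesgue_integral_def set_lebesgue_integral_def)
qed

text \<open>Integration by parts: \<open>hermp (Suc k) * exp (- t^2)\<close> is minus the derivative
  of \<open>hermp k * exp (- t^2)\<close>, so one index is lowered at the cost of differentiating
  the other polynomial, which lowers that index as well.\<close>

lemma hermp_inner_Suc:
  "(LINT t|lborel. poly (hermp (Suc k)) t * poly (hermp j) t * exp (- t\<^sup>2))
   = 2 * real j * (LINT t|lborel. poly (hermp k) t * poly (hermp (j - 1)) t * exp (- t\<^sup>2))"
proof -
  let ?I = "\<lambda>k j t. poly (hermp k) t * poly (hermp j) t * exp (- t\<^sup>2)"
  have int: "integrable lborel (?I k j)" for k j using poly_gauss2(1)[of "hermp k * hermp j"] by simp
  have "(LINT t|lborel. 2 * real j * ?I k (j - 1) t - ?I (Suc k) j t) = 0"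
  proof (rule lborel_integral_deriv_eq_0[where F = "?I k j"])
    fix t
    show "(?I k j has_real_derivative 2 * real j * ?I k (j - 1) t - ?I (Suc k) j t) (at t)"
      by (rule derivative_eq_intros DERIV_hermp poly_DERIV refl)+ (simp add: algebra_simps)
  qed (use int poly_gauss2(2,3)[of "hermp k * hermp j"] in \<open>auto intro!: continuous_intros simp del: hermp.simps\<close>)
  then show ?thesis using int by (simp del: hermp.simps)
qed

lemma hermp_inner:
  "(LINT t|lborel. poly (hermp k) t * poly (hermp j) t * exp (- t\<^sup>2)) = (if k = j then 2 ^ k * fact k * sqrt pi else 0)"
proof (induction k arbitrary: j)
  case 0
  show ?case
  proof (cases j)
    case 0
    \<comment> \<open>The Gaussian integral is read off from the normalisation of the normal
      density, rescaled by \<open>sqrt 2\<close>.\<close>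
    have "(LINT t|lborel. std_normal_density (t * sqrt 2) * sqrt 2 :: real) = 1"
      using lborel_integral_real_affine[of "sqrt 2" std_normal_density 0]
      by (simp add: mult.commute)
    moreover have "std_normal_density (t * sqrt 2) * sqrt 2 = (1 / sqrt pi) * exp (- t\<^sup>2)" for t
      by (simp add: std_normal_density_def power_mult_distrib real_sqrt_mult)
    ultimately have "(LINT t|lborel. (1 / sqrt pi) * exp (- t\<^sup>2) :: real) = 1" by (simp only:)
    then have "(1 / sqrt pi) * (LINT t|lborel. exp (- t\<^sup>2) :: real) = 1"
      by (simp only: integral_mult_right_zero)
    then have "sqrt pi * ((1 / sqrt pi) * (LINT t|lborel. exp (- t\<^sup>2) :: real)) = sqrt pi * 1" by (simp only:)
    then have "(LINT t|lborel. exp (- t\<^sup>2) :: real) = sqrt pi" by simp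
    then show ?thesis using 0 by simp
  next
    case (Suc i)
    show ?thesis using hermp_inner_Suc[of i 0] Suc by (simp del: hermp.simps(2) add: mult.commute)
  qed
next
  case (Suc k)
  show ?case
  proof (cases j)
    case 0
    then show ?thesis using hermp_inner_Suc[of k j] by (simp del: hermp.simps)
  next
    case (Suc i)
    then show ?thesis using hermp_inner_Suc[of k j] Suc.IH[of i] by (simp del: hermp.simps add: algebra_simps)
  qed
qed

lemma hermite_fun_mult_eq:
  "hermite_fun k t * hermite_fun j t = (hc k * hc j) * (poly (hermp k) t * poly (hermp j) t * exp (- t\<^sup>2))"
proof -
  have "exp (- t\<^sup>2 / 2) * exp (- t\<^sup>2 / 2) = exp (- t\<^sup>2)" by (simp flip: exp_add)
  then show ?thesis by (simp only: hermite_fun_eq ac_simps)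
qed

lemma integrable_hermite_fun_mult: "integrable lborel (\<lambda>t. hermite_fun k t * hermite_fun j t)"
  unfolding hermite_fun_mult_eq using poly_gauss2(1)[of "hermp k * hermp j"] by simp

lemma hermite_fun_orthonormal:
  "(LINT t|lborel. hermite_fun k t * hermite_fun j t) = (if k = j then 1 else 0)"
proof -
  have "hc k * hc k = 1 / (2 ^ k * fact k * sqrt pi)" using hc_sq[of k] by (simp add: power2_eq_square)
  then show ?thesis by (auto simp add: hermite_fun_mult_eq hermp_inner)
qed

lemma bounded_hermite_fun: "\<exists>B. \<forall>t. \<bar>hermite_fun k t\<bar> \<le> B"
proof -
  obtain B where B: "\<And>t. \<bar>poly (smult (hc k) (hermp k)) t * exp (- t\<^sup>2 / 2)\<bar> \<le> B"
    using bounded_poly_gauss by blast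
  show ?thesis using B by (intro exI[of _ B]) (simp add: hermite_fun_eq)
qed

lemma hermite_fun_tendsto: "(hermite_fun k \<longlongrightarrow> 0) at_top"
  using poly_gauss_tendsto(1)[of "smult (hc k) (hermp k)"] by (simp add: hermite_fun_eq[abs_def])

section \<open>Mehler's formula\<close>

text \<open>Closed form of the power series in r with coefficients
  \<open>mehler_coeff x y k\<close>. The principal branch of the power is holomorphic in the unit
  disc because \<open>Re (1 - r^2) > 0\<close> there.\<close>

definition mehler_gen :: "real \<Rightarrow> real \<Rightarrow> complex \<Rightarrow> complex" where
  "mehler_gen x y r = (1 - r\<^sup>2) powr (- 1 / 2) *
     exp ((of_real (2 * x * y) * r - of_real (x\<^sup>2 + y\<^sup>2) * r\<^sup>2) / (1 - r\<^sup>2))"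

definition mehler_coeff :: "real \<Rightarrow> real \<Rightarrow> nat \<Rightarrow> real" where
  "mehler_coeff x y k = poly (hermp k) x * poly (hermp k) y / (2 ^ k * fact k)"

lemma mehler_coeff_simps:
  "mehler_coeff x y 0 = 1"
  "mehler_coeff x y (Suc 0) = 2 * x * y"
  "2 * mehler_coeff x y (Suc (Suc 0)) = 2 * x * y * mehler_coeff x y (Suc 0)
     + (1 - 2 * (x\<^sup>2 + y\<^sup>2)) * mehler_coeff x y 0"
  "3 * mehler_coeff x y (Suc (Suc (Suc 0))) = 2 * x * y * mehler_coeff x y (Suc (Suc 0))
     + (3 - 2 * (x\<^sup>2 + y\<^sup>2)) * mehler_coeff x y (Suc 0) + 2 * x * y * mehler_coeff x y 0"
  unfolding mehler_coeff_def hermp_rec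
  by (simp_all add: fact_numeral eval_nat_numeral pderiv_pCons field_simps)

text \<open>This is the equation \<open>(1 - r^2)^2 M' = (r (1 - r^2) + 2xy (1 + r^2) - 2 (x^2 +
  y^2) r) M\<close> read off in coefficients. Both factors of a coefficient satisfy a three-term
  recurrence, so everything can be expressed through the indices k and k + 1, where a polynomial
  identity remains.\<close>

lemma mehler_coeff_rec:
  "(real k + 4) * mehler_coeff x y (k + 4)
   = 2 * x * y * (mehler_coeff x y (k + 3) + mehler_coeff x y (k + 1))
     + (2 * real k + 5 - 2 * (x\<^sup>2 + y\<^sup>2)) * mehler_coeff x y (k + 2)
     - (real k + 1) * mehler_coeff x y k"
proof -
  define c where "c = 1 / (2 ^ (k + 4) * fact (k + 4) :: real)"
  define K where "K = real k"
  define a where "a j = poly (hermp j) x" for j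
  define b where "b j = poly (hermp j) y" for j
  have a: "a (k + 2) = 2 * x * a (k + 1) - 2 * (K + 1) * a k"
    "a (k + 3) = 2 * x * a (k + 2) - 2 * (K + 2) * a (k + 1)"
    "a (k + 4) = 2 * x * a (k + 3) - 2 * (K + 3) * a (k + 2)"
    using hermp_rec[of k x] hermp_rec[of "k + 1" x] hermp_rec[of "k + 2" x]
    by (simp_all del: hermp.simps add: a_def K_def eval_nat_numeral algebra_simps)
  have b: "b (k + 2) = 2 * y * b (k + 1) - 2 * (K + 1) * b k"
    "b (k + 3) = 2 * y * b (k + 2) - 2 * (K + 2) * b (k + 1)"
    "b (k + 4) = 2 * y * b (k + 3) - 2 * (K + 3) * b (k + 2)"
    using hermp_rec[of k y] hermp_rec[of "k + 1" y] hermp_rec[of "k + 2" y]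
    by (simp_all del: hermp.simps add: b_def K_def eval_nat_numeral algebra_simps)
  have fact4: "fact (k + 4) = (K + 4) * (K + 3) * (K + 2) * (K + 1) * fact k"
    "fact (k + 3) = (K + 3) * (K + 2) * (K + 1) * fact k"
    "fact (k + 2) = (K + 2) * (K + 1) * fact k"
    "fact (k + 1) = (K + 1) * fact k"
    by (simp_all add: K_def eval_nat_numeral algebra_simps)
  have K: "K \<ge> 0" by (simp add: K_def)
  \<comment> \<open>All five coefficients are written over the denominator of the last one.\<close>
  have m: "mehler_coeff x y (k + 4) = c * a (k + 4) * b (k + 4)"
    "mehler_coeff x y (k + 3) = c * (2 * (K + 4)) * a (k + 3) * b (k + 3)"
    "mehler_coeff x y (k + 2) = c * (4 * (K + 4) * (K + 3)) * a (k + 2) * b (k + 2)"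
    "mehler_coeff x y (k + 1) = c * (8 * (K + 4) * (K + 3) * (K + 2)) * a (k + 1) * b (k + 1)"
    "mehler_coeff x y k = c * (16 * (K + 4) * (K + 3) * (K + 2) * (K + 1)) * a k * b k"
    unfolding mehler_coeff_def c_def fact4 a_def[symmetric] b_def[symmetric] using K
    by (simp_all add: power_add divide_simps)
  show ?thesis
    unfolding m unfolding a b K_def[symmetric]
    by algebra
qed

lemma one_minus_sq_Re_pos: "Re (1 - r\<^sup>2) > 0" if "norm r < 1"
proof -
  have "Re (r\<^sup>2) \<le> norm (r\<^sup>2)" by (rule complex_Re_le_cmod)
  also have "norm (r\<^sup>2) < 1" using that by (simp add: norm_power power_less_one_iff)
  finally show ?thesis by simp
qed

lemma mehler_gen_deriv:
  assumes "norm r < 1"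
  shows "(mehler_gen x y has_field_derivative
    (r * (1 - r\<^sup>2) + of_real (2 * x * y) * (1 + r\<^sup>2) - of_real (2 * (x\<^sup>2 + y\<^sup>2)) * r) * mehler_gen x y r / (1 - r\<^sup>2)\<^sup>2) (at r)"
proof -
  have pos: "Re (1 - r\<^sup>2) > 0" by (rule one_minus_sq_Re_pos[OF assms])
  then have nz: "1 - r\<^sup>2 \<noteq> 0" by auto
  have npos: "1 - r\<^sup>2 \<notin> \<real>\<^sub>\<le>\<^sub>0" using pos by (auto simp: complex_nonpos_Reals_iff)
  define P where "P = complex_of_real (2 * x * y)"
  define S where "S = complex_of_real (x\<^sup>2 + y\<^sup>2)"
  define E where "E r = exp ((P * r - S * r\<^sup>2) / (1 - r\<^sup>2))" for r
  have d1: "((\<lambda>r. (1 - r\<^sup>2) powr (- 1 / 2)) has_field_derivative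
      (1 - r\<^sup>2) powr (- 1 / 2) * (r / (1 - r\<^sup>2))) (at r)"
  proof -
    have "((\<lambda>r. (1 - r\<^sup>2) powr (- 1 / 2)) has_field_derivative
        (- 1 / 2 * (1 - r\<^sup>2) powr (- 1 / 2 - 1)) * (- (2 * r))) (at r)"
      by (rule DERIV_chain2[where f = "\<lambda>z. z powr (- 1 / 2)" and g = "\<lambda>r. 1 - r\<^sup>2", OF has_field_derivative_powr[OF npos]]) (auto intro!: derivative_eq_intros)
    moreover have "(1 - r\<^sup>2) powr (- 1 / 2 - 1) = (1 - r\<^sup>2) powr (- 1 / 2) / (1 - r\<^sup>2)"
      using nz by (subst powr_diff) (simp add: powr_to_1)
    ultimately show ?thesis by (simp add: field_simps)
  qed
  have d2: "(E has_field_derivative E r * (((P - 2 * S * r) * (1 - r\<^sup>2) + (P * r - S * r\<^sup>2) * (2 * r)) / (1 - r\<^sup>2)\<^sup>2)) (at r)"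
    unfolding E_def using nz
    by (auto intro!: derivative_eq_intros simp: power2_eq_square)
  have eq: "mehler_gen x y r = (1 - r\<^sup>2) powr (- 1 / 2) * E r" for r
    by (simp add: mehler_gen_def E_def P_def S_def)
  have "(mehler_gen x y has_field_derivative
      ((1 - r\<^sup>2) powr (- 1 / 2) * (r / (1 - r\<^sup>2))) * E r +
      (E r * (((P - 2 * S * r) * (1 - r\<^sup>2) + (P * r - S * r\<^sup>2) * (2 * r)) / (1 - r\<^sup>2)\<^sup>2)) * (1 - r\<^sup>2) powr (- 1 / 2)) (at r)"
    unfolding eq[abs_def] by (rule DERIV_mult[OF d1 d2])
  also have "((1 - r\<^sup>2) powr (- 1 / 2) * (r / (1 - r\<^sup>2))) * E r +
      (E r * (((P - 2 * S * r) * (1 - r\<^sup>2) + (P * r - S * r\<^sup>2) * (2 * r)) / (1 - r\<^sup>2)\<^sup>2)) * (1 - r\<^sup>2) powr (- 1 / 2)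
      = (r * (1 - r\<^sup>2) + of_real (2 * x * y) * (1 + r\<^sup>2) - of_real (2 * (x\<^sup>2 + y\<^sup>2)) * r) * mehler_gen x y r / (1 - r\<^sup>2)\<^sup>2"
  proof -
    define w where "w = 1 - r\<^sup>2"
    define z where "z = w powr (- 1 / 2)"
    have S2: "of_real (2 * (x\<^sup>2 + y\<^sup>2)) = 2 * S" by (simp add: S_def)
    have wnz: "w \<noteq> 0" using nz by (simp add: w_def)
    have "z * (r / w) * E r + (E r * (((P - 2 * S * r) * w + (P * r - S * r\<^sup>2) * (2 * r)) / w\<^sup>2)) * z
      = (z * r * w * E r + E r * ((P - 2 * S * r) * w + (P * r - S * r\<^sup>2) * (2 * r)) * z) / w\<^sup>2"
      using wnz by (simp add: field_simps power2_eq_square)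
    also have "z * r * w * E r + E r * ((P - 2 * S * r) * w + (P * r - S * r\<^sup>2) * (2 * r)) * z
       = (r * w + P * (1 + r\<^sup>2) - 2 * S * r) * (z * E r)"
      using w_def by algebra
    finally show ?thesis unfolding eq S2 P_def[symmetric] w_def[symmetric] z_def[symmetric] .
  qed
  finally show ?thesis .
qed

lemma mehler_gen_holomorphic: "mehler_gen x y holomorphic_on ball 0 1"
  unfolding holomorphic_on_def field_differentiable_def
  by (metis mehler_gen_deriv has_field_derivative_at_within mem_ball_0)

text \<open>Closed form and coefficients solve the same linear equation of first order, which is
  regular at 0, and agree at 0. Comparing formal power series identifies the Taylor coefficients of
  the closed form; its holomorphy in the disc then gives convergence for all
  \<open>norm r < 1\<close>.\<close>

lemma mehler_gen_sums:
  assumes "norm r < 1"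
  shows "(\<lambda>k. of_real (mehler_coeff x y k) * r ^ k) sums mehler_gen x y r"
proof -
  define E where "E = fps_expansion (mehler_gen x y) 0"
  have exp: "mehler_gen x y has_fps_expansion E"
    unfolding E_def by (rule has_fps_expansion_fps_expansion[OF _ _ mehler_gen_holomorphic]) auto
  have exp': "deriv (mehler_gen x y) has_fps_expansion fps_deriv E"
    by (rule has_fps_expansion_deriv[OF exp])
  define P where "P = complex_of_real (2 * x * y)"
  define S where "S = complex_of_real (2 * (x\<^sup>2 + y\<^sup>2))"
  have l: "(\<lambda>r. (1 - 2 * r ^ 2 + r ^ 4) * deriv (mehler_gen x y) r) has_fps_expansion
      (1 - 2 * fps_X ^ 2 + fps_X ^ 4) * fps_deriv E"
    by (intro fps_expansion_intros exp')
  have r: "(\<lambda>r. (r - r ^ 3 + P * (1 + r ^ 2) - S * r) * mehler_gen x y r) has_fps_expansion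
      (fps_X - fps_X ^ 3 + fps_const P * (1 + fps_X ^ 2) - fps_const S * fps_X) * E"
    by (intro fps_expansion_intros exp)
  have ev: "eventually (\<lambda>r. (1 - 2 * r ^ 2 + r ^ 4) * deriv (mehler_gen x y) r
      = (r - r ^ 3 + P * (1 + r ^ 2) - S * r) * mehler_gen x y r) (nhds 0)"
  proof -
    have "eventually (\<lambda>r::complex. r \<in> ball 0 1) (nhds 0)" by (intro eventually_nhds_in_open) auto
    then show ?thesis
    proof eventually_elim
      case (elim r)
      then have n: "norm r < 1" by simp
      then have nz: "1 - r\<^sup>2 \<noteq> 0" using one_minus_sq_Re_pos by force
      have "(1 - r\<^sup>2)\<^sup>2 * deriv (mehler_gen x y) r
         = (r * (1 - r\<^sup>2) + P * (1 + r\<^sup>2) - S * r) * mehler_gen x y r"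
        using DERIV_imp_deriv[OF mehler_gen_deriv[OF n, of x y]] nz by (simp add: P_def S_def)
      moreover have "(1 - r\<^sup>2)\<^sup>2 = 1 - 2 * r ^ 2 + r ^ 4" "r * (1 - r\<^sup>2) = r - r ^ 3" by algebra+
      ultimately show ?case by simp
    qed
  qed
  have eq: "(1 - 2 * fps_X ^ 2 + fps_X ^ 4) * fps_deriv E
     = (fps_X - fps_X ^ 3 + fps_const P * (1 + fps_X ^ 2) - fps_const S * fps_X) * E"
    using l r has_fps_expansion_cong[OF ev refl] fps_expansion_unique_complex by blast
  define D where "D = fps_deriv E"
  have D: "fps_nth D n = of_nat (Suc n) * fps_nth E (Suc n)" for n by (simp add: D_def)
  have eq2: "D - 2 * (fps_X ^ 2 * D) + fps_X ^ 4 * D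
     = fps_X * E - fps_X ^ 3 * E + fps_const P * E + fps_const P * (fps_X ^ 2 * E) - fps_const S * (fps_X * E)"
    using eq unfolding D_def[symmetric] by (simp add: algebra_simps)
  have co: "fps_nth D n - 2 * (if n < 2 then 0 else fps_nth D (n - 2)) + (if n < 4 then 0 else fps_nth D (n - 4))
    = (if n = 0 then 0 else fps_nth E (n - 1)) - (if n < 3 then 0 else fps_nth E (n - 3)) + P * fps_nth E n
      + P * (if n < 2 then 0 else fps_nth E (n - 2)) - S * (if n = 0 then 0 else fps_nth E (n - 1))" for n
    using arg_cong[OF eq2, of "\<lambda>f. fps_nth f n"]
    by (simp add: fps_X_power_mult_nth fps_numeral_fps_const)
  have E0: "fps_nth E 0 = 1"
    by (simp add: E_def fps_expansion_def mehler_gen_def)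
  have coeffs: "fps_nth E n = of_real (mehler_coeff x y n)" for n
  proof (induction n rule: less_induct)
    case (less n)
    \<comment> \<open>The recurrence reaches back four indices, so the first four coefficients are
      treated separately.\<close>
    consider "n = 0" | "n = Suc 0" | "n = Suc (Suc 0)" | "n = Suc (Suc (Suc 0))" | m where "n = m + 4"
    proof -
      have "n < 4 \<or> (\<exists>m. n = m + 4)" by presburger
      then show ?thesis using that by (auto simp: less_Suc_eq numeral_eq_Suc)
    qed
    then show ?case
    proof cases
      case 1
      then show ?thesis by (simp add: E0 mehler_coeff_simps)
    next
      case 2
      then show ?thesis using co[of 0] by (simp add: D E0 mehler_coeff_simps P_def)
    next
      case 3
      have "2 * fps_nth E n = of_real (2 * mehler_coeff x y n)"
        unfolding 3 mehler_coeff_simps(3)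
        using co[of "Suc 0"] less[of 0] less[of "Suc 0"]
        by (simp add: D P_def S_def 3 algebra_simps)
      then show ?thesis by simp
    next
      case 4
      have "3 * fps_nth E n = of_real (3 * mehler_coeff x y n)"
        unfolding 4 mehler_coeff_simps(4)
        using co[of "Suc (Suc 0)"] less[of 0] less[of "Suc 0"] less[of "Suc (Suc 0)"]
        by (simp add: D P_def S_def 4 algebra_simps)
      then show ?thesis by simp
    next
      case (5 m)
      have n: "m + 3 - 2 = m + 1" "m + 3 - 1 = m + 2" "Suc (m + 3) = m + 4" "Suc (m + 1) = m + 2" by auto
      have "(of_nat m + 4) * fps_nth E n = of_real ((real m + 4) * mehler_coeff x y n)"
      \<comment> \<open>The summand from \<open>fps_X ^ 4 * D\<close> has index m - 1 in D and is
        absent for m = 0.\<close>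
      proof (cases m)
        case 0
        show ?thesis
          unfolding 5 mehler_coeff_rec
          using co[of "m + 3"] less[of m] less[of "m + 1"] less[of "m + 2"] less[of "m + 3"]
          by (simp add: D P_def S_def 5 n 0 algebra_simps numeral_eq_Suc)
      next
        case (Suc i)
        have n': "m + 3 - 4 = i" "Suc i = m" using Suc by auto
        have if0: "(if m = 0 then 0 else of_nat m * fps_nth E m) = of_nat m * fps_nth E m" by simp
        show ?thesis
          unfolding 5 mehler_coeff_rec
          using co[of "m + 3"] less[of m] less[of "m + 1"] less[of "m + 2"] less[of "m + 3"]
          unfolding D n n'
          by (simp add: P_def S_def 5 n if0 algebra_simps)
      qed
      moreover have "of_nat m + 4 \<noteq> (0 :: complex)" using of_nat_neq_0[of "m + 3", where 'a=complex] by (simp add: algebra_simps)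
      ultimately show ?thesis by simp
    qed
  qed
  have "(\<lambda>n. (deriv ^^ n) (mehler_gen x y) 0 / fact n * (r - 0) ^ n) sums mehler_gen x y r"
    by (rule holomorphic_power_series[OF mehler_gen_holomorphic]) (use assms in auto)
  moreover have "(deriv ^^ n) (mehler_gen x y) 0 / fact n = of_real (mehler_coeff x y n)" for n
    using coeffs[of n] by (simp add: E_def fps_expansion_def)
  ultimately show ?thesis by simp
qed

definition mehler_kernel :: "complex \<Rightarrow> real \<Rightarrow> real \<Rightarrow> complex" where
  "mehler_kernel r x y = of_real (exp (- (x\<^sup>2 + y\<^sup>2) / 2) / sqrt pi) * mehler_gen x y r"

lemma mehler_sums:
  assumes "norm r < 1"
  shows "(\<lambda>k. of_real (hermite_fun k x * hermite_fun k y) * r ^ k) sums mehler_kernel r x y"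
proof -
  have "hermite_fun k x * hermite_fun k y = exp (- (x\<^sup>2 + y\<^sup>2) / 2) / sqrt pi * mehler_coeff x y k" for k
  proof -
    have "hermite_fun k x * hermite_fun k y
        = (hc k)\<^sup>2 * (exp (- x\<^sup>2 / 2) * exp (- y\<^sup>2 / 2)) * (poly (hermp k) x * poly (hermp k) y)"
      by (simp add: hermite_fun_eq power2_eq_square)
    also have "exp (- x\<^sup>2 / 2) * exp (- y\<^sup>2 / 2) = exp (- (x\<^sup>2 + y\<^sup>2) / 2)"
      by (simp add: add_divide_distrib flip: exp_add)
    finally show ?thesis by (simp add: hc_sq mehler_coeff_def)
  qed
  then show ?thesis
    using sums_mult[OF mehler_gen_sums[OF assms, of x y], of "of_real (exp (- (x\<^sup>2 + y\<^sup>2) / 2) / sqrt pi)"]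
    by (simp add: mehler_kernel_def mult.assoc)
qed

text \<open>Together with the Gaussian factor the exponent is minus a quarter of
  \<open>(1+r)/(1-r) (x-y)^2 + (1-r)/(1+r) (x+y)^2\<close>. The Cayley transform maps the disc into
  the right half-plane, so the exponential has modulus at most one and only the prefactor survives,
  uniformly in x and y.\<close>

lemma norm_mehler_kernel:
  assumes "norm r < 1"
  shows "norm (mehler_kernel r x y) \<le> norm (1 - r\<^sup>2) powr (- 1 / 2) / sqrt pi"
proof -
  have nz: "1 - r\<^sup>2 \<noteq> 0" using one_minus_sq_Re_pos[OF assms] by force
  then have nz1: "1 - r \<noteq> 0" "1 + r \<noteq> 0"
    by (auto simp: power2_eq_square) (metis add_eq_0_iff minus_mult_minus mult_1)
  define A where "A = (of_real (2 * x * y) * r - of_real (x\<^sup>2 + y\<^sup>2) * r\<^sup>2) / (1 - r\<^sup>2)"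
  have id: "A - of_real ((x\<^sup>2 + y\<^sup>2) / 2)
      = - (((1 + r) / (1 - r)) * of_real ((x - y)\<^sup>2) + ((1 - r) / (1 + r)) * of_real ((x + y)\<^sup>2)) / 4"
  proof -
    have e: "1 - r\<^sup>2 = (1 - r) * (1 + r)" by algebra
    have gen: "- (a\<^sup>2 * u + b\<^sup>2 * v) / 2 / (2 * (b * a)) = - ((a / b) * u + (b / a) * v) / 4"
      if "a \<noteq> 0" "b \<noteq> 0" for a b u v :: complex
      using that by (simp add: field_simps power2_eq_square)
    define X where "X = complex_of_real x"
    define Y where "Y = complex_of_real y"
    have "(2 * X * Y * r - (X\<^sup>2 + Y\<^sup>2) * r\<^sup>2) / ((1 - r) * (1 + r)) - (X\<^sup>2 + Y\<^sup>2) / 2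
      = (2 * (2 * X * Y * r - (X\<^sup>2 + Y\<^sup>2) * r\<^sup>2) - (X\<^sup>2 + Y\<^sup>2) * ((1 - r) * (1 + r))) / (2 * ((1 - r) * (1 + r)))"
      using nz1 by (subst diff_frac_eq) (auto simp: mult.commute)
    also have "(2 * (2 * X * Y * r - (X\<^sup>2 + Y\<^sup>2) * r\<^sup>2) - (X\<^sup>2 + Y\<^sup>2) * ((1 - r) * (1 + r)))
       = - ((1 + r)\<^sup>2 * (X - Y)\<^sup>2 + (1 - r)\<^sup>2 * (X + Y)\<^sup>2) / 2" by (simp add: field_simps) algebra
    also have "- ((1 + r)\<^sup>2 * (X - Y)\<^sup>2 + (1 - r)\<^sup>2 * (X + Y)\<^sup>2) / 2 / (2 * ((1 - r) * (1 + r)))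
       = - (((1 + r) / (1 - r)) * (X - Y)\<^sup>2 + ((1 - r) / (1 + r)) * (X + Y)\<^sup>2) / 4"
      by (rule gen) (use nz1 in auto)
    finally show ?thesis unfolding A_def e X_def Y_def by simp
  qed
  have Re_div: "Re ((1 + w) / (1 - w)) \<ge> 0" if "norm w < 1" for w :: complex
  proof -
    have "(Re w)\<^sup>2 + (Im w)\<^sup>2 < 1" using that by (simp add: cmod_def)
    then have "Re ((1 + w) * cnj (1 - w)) \<ge> 0" by (simp add: power2_eq_square algebra_simps)
    then show ?thesis by (simp add: Re_complex_div_ge_0)
  qed
  have "Re (A - of_real ((x\<^sup>2 + y\<^sup>2) / 2)) \<le> 0"
  proof -
    define z where "z = (1 + r) / (1 - r)"
    define w where "w = (1 - r) / (1 + r)"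
    have "Re z \<ge> 0" "Re w \<ge> 0"
      using Re_div[OF assms] Re_div[of "- r"] assms by (simp_all add: z_def w_def)
    then have "Re z * (x - y)\<^sup>2 + Re w * (x + y)\<^sup>2 \<ge> 0" by simp
    then show ?thesis
      unfolding id z_def[symmetric] w_def[symmetric] by (simp del: of_real_power of_real_add of_real_diff)
  qed
  then have le: "exp (Re A - (x\<^sup>2 + y\<^sup>2) / 2) \<le> 1" by simp
  have mg: "mehler_gen x y r = (1 - r\<^sup>2) powr (- 1 / 2) * exp A" by (simp only: mehler_gen_def A_def)
  have "norm (mehler_kernel r x y) = (exp (- (x\<^sup>2 + y\<^sup>2) / 2) * exp (Re A)) * (norm ((1 - r\<^sup>2) powr (- 1 / 2)) / sqrt pi)"
    by (simp add: mehler_kernel_def mg norm_mult norm_divide)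
  also have "exp (- (x\<^sup>2 + y\<^sup>2) / 2) * exp (Re A) = exp (Re A - (x\<^sup>2 + y\<^sup>2) / 2)"
    by (simp add: add_divide_distrib diff_divide_distrib flip: exp_add)
  also have "norm ((1 - r\<^sup>2) powr (- 1 / 2)) = norm (1 - r\<^sup>2) powr (- 1 / 2)"
    using nz by (simp add: powr_def)
  finally show ?thesis using mult_right_mono[OF le, of "norm (1 - r\<^sup>2) powr (- 1 / 2) / sqrt pi"] by simp
qed

section \<open>Hermite functions in several variables\<close>

text \<open>Lebesgue measure on \<open>real^'n\<close> is a product indexed by basis vectors rather
  than by coordinates; \<open>ix\<close> inverts the map from i to \<open>axis i 1\<close> and
  translates between the two.\<close>

lemma integral_prod_components:
  fixes f :: "'n::finite \<Rightarrow> real \<Rightarrow> real"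
  assumes "\<And>i. integrable lborel (f i)"
  shows "integrable lborel (\<lambda>x::real^'n. \<Prod>i\<in>UNIV. f i (x $ i))" (is ?A)
    and "(LINT x|lborel. (\<Prod>i\<in>UNIV. f i ((x::real^'n) $ i))) = (\<Prod>i\<in>UNIV. integral\<^sup>L lborel (f i))" (is ?B)
proof -
  interpret product_sigma_finite "\<lambda>_::real^'n. lborel :: real measure" ..
  define ix where "ix b = (SOME i. b = axis i (1::real))" for b :: "real^'n"
  have ix: "ix (axis i 1) = i" for i unfolding ix_def by (rule some_equality) (auto simp: axis_eq_axis)
  have bij: "bij_betw (\<lambda>i. axis i (1::real)) (UNIV::'n set) Basis"
    by (auto simp: bij_betw_def inj_on_def axis_eq_axis Basis_vec_def)
  have ixB: "f (ix b) \<in> borel_measurable borel" for b using assms by auto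
  have prod_eq: "(\<Prod>i\<in>UNIV. h i (axis i 1)) = (\<Prod>b\<in>Basis. h (ix b) b)" for h :: "'n \<Rightarrow> real^'n \<Rightarrow> real"
    using prod.reindex_bij_betw[OF bij, of "\<lambda>b. h (ix b) b"] by (simp add: ix)
  have eq: "(\<Prod>i\<in>UNIV. f i (x $ i)) = (\<Prod>b\<in>Basis. f (ix b) (x \<bullet> b))" for x :: "real^'n"
    using prod_eq[of "\<lambda>i b. f i (x \<bullet> b)"] by (simp add: inner_axis)
  have m[measurable]: "(\<lambda>x::real^'n. \<Prod>b\<in>Basis. f (ix b) (x \<bullet> b)) \<in> borel_measurable borel"
    using ixB by measurable
  have i1: "integrable (\<Pi>\<^sub>M b\<in>Basis. lborel) (\<lambda>F. \<Prod>b\<in>Basis. f (ix b) (F b))"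
    by (intro product_integrable_prod assms) auto
  have i2: "(LINT F|(\<Pi>\<^sub>M b\<in>Basis. lborel). (\<Prod>b\<in>Basis. f (ix b) (F b))) = (\<Prod>b\<in>Basis. integral\<^sup>L lborel (f (ix b)))"
    by (intro product_integral_prod assms) auto
  show ?A unfolding eq
    by (subst lborel_eq, subst integrable_distr_eq) (use i1 m in \<open>auto cong: prod.cong\<close>)
  have "(LINT x|lborel. (\<Prod>i\<in>UNIV. f i ((x::real^'n) $ i))) = (\<Prod>b\<in>(Basis :: (real^'n) set). integral\<^sup>L lborel (f (ix b)))"
    unfolding eq i2[symmetric]
    by (subst lborel_eq, subst integral_distr) (use m in \<open>auto cong: prod.cong\<close>)
  also have "\<dots> = (\<Prod>i\<in>UNIV. integral\<^sup>L lborel (f i))"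
    using prod_eq[of "\<lambda>i _. integral\<^sup>L lborel (f i)"] by simp
  finally show ?B .
qed

definition hermite_vec :: "nat^'n \<Rightarrow> real^'n \<Rightarrow> real" where
  "hermite_vec \<nu> x = (\<Prod>i\<in>UNIV. hermite_fun (\<nu> $ i) (x $ i))"

lemma hermite_funs_eq: "hermite_funs \<nu> = (\<lambda>x. of_real (hermite_vec \<nu> x))"
  by (simp add: hermite_funs_def[abs_def] hermite_vec_def)

lemma continuous_on_hermite_vec: "continuous_on UNIV (hermite_vec \<nu>)"
  unfolding hermite_vec_def[abs_def]
  by (intro continuous_on_prod continuous_on_compose2[OF continuous_on_hermite_fun[of UNIV]] continuous_intros) auto

lemma measurable_hermite_vec[measurable]: "hermite_vec \<nu> \<in> borel_measurable borel"
  by (intro borel_measurable_continuous_onI continuous_on_hermite_vec)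

lemma integrable_hermite_vec_mult: "integrable lborel (\<lambda>x. hermite_vec \<nu> x * hermite_vec \<mu> x)"
  unfolding hermite_vec_def prod.distrib[symmetric]
  by (intro integral_prod_components integrable_hermite_fun_mult)

lemma hermite_vec_orthonormal:
  "(LINT x|lborel. hermite_vec \<nu> x * hermite_vec \<mu> x) = (if \<nu> = \<mu> then 1 else 0)"
proof -
  have "(LINT x|lborel. hermite_vec \<nu> x * hermite_vec \<mu> x) = (\<Prod>i\<in>UNIV. if \<nu> $ i = \<mu> $ i then 1 else 0)"
    unfolding hermite_vec_def prod.distrib[symmetric]
    by (subst integral_prod_components(2)[OF integrable_hermite_fun_mult]) (simp add: hermite_fun_orthonormal)
  also have "\<dots> = (if \<nu> = \<mu> then 1 else 0)"
    by (auto simp: vec_eq_iff)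
  finally show ?thesis .
qed

lemma bounded_hermite_vec: "\<exists>B. \<forall>x. \<bar>hermite_vec \<nu> x\<bar> \<le> B"
proof -
  have "\<exists>B. \<forall>i t. \<bar>hermite_fun (\<nu> $ i) t\<bar> \<le> B i" by (intro choice allI bounded_hermite_fun)
  then obtain B where B: "\<And>i t. \<bar>hermite_fun (\<nu> $ i) t\<bar> \<le> B i" by blast
  have "\<bar>hermite_vec \<nu> x\<bar> \<le> (\<Prod>i\<in>UNIV. B i)" for x
    unfolding hermite_vec_def abs_prod by (intro prod_mono) (use B in auto)
  then show ?thesis by blast
qed

lemma finite_multi_indices[simp]: "finite (multi_indices j :: (nat^'n) set)"
proof (rule finite_subset)
  show "(multi_indices j :: (nat^'n) set) \<subseteq> vec_lambda ` (PiE UNIV (\<lambda>_. {..j}))"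
  proof
    fix \<nu> :: "nat^'n" assume "\<nu> \<in> multi_indices j"
    then have "\<nu> $ i \<le> j" for i
      using member_le_sum[of i UNIV "\<lambda>i. \<nu> $ i"] by (simp add: multi_indices_def)
    then show "\<nu> \<in> vec_lambda ` (PiE UNIV (\<lambda>_. {..j}))"
      by (intro image_eqI[of _ _ "\<lambda>i. \<nu> $ i"]) auto
  qed
qed (intro finite_imageI finite_PiE, auto)

lemma multi_indices_disjoint: "\<nu> \<in> multi_indices i \<Longrightarrow> \<nu> \<in> multi_indices j \<Longrightarrow> i = j"
  by (simp add: multi_indices_def)

subsection \<open>The kernel of the spectral projection\<close>

definition proj_kernel :: "nat \<Rightarrow> real^'n \<Rightarrow> real^'n \<Rightarrow> real" where
  "proj_kernel j x y = (\<Sum>\<nu>\<in>multi_indices j. hermite_vec \<nu> x * hermite_vec \<nu> y)"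

text \<open>Requiring zero outside I makes a multi-index on \<open>insert a I\<close> the same as
  its value at a together with a multi-index on I, which is what an induction over the coordinates
  needs.\<close>

definition comp_set :: "'i set \<Rightarrow> nat \<Rightarrow> ('i \<Rightarrow> nat) set" where
  "comp_set I j = {\<nu>. (\<forall>i. i \<notin> I \<longrightarrow> \<nu> i = 0) \<and> sum \<nu> I = j}"

lemma finite_comp_set:
  assumes "finite I"
  shows "finite (comp_set I j)"
proof -
  have "finite {\<nu>. \<forall>i. (i \<in> I \<longrightarrow> \<nu> i \<in> {..j}) \<and> (i \<notin> I \<longrightarrow> \<nu> i = 0)}"
    using assms by (rule finite_set_of_finite_funs) simp
  moreover have "comp_set I j \<subseteq> {\<nu>. \<forall>i. (i \<in> I \<longrightarrow> \<nu> i \<in> {..j}) \<and> (i \<notin> I \<longrightarrow> \<nu> i = 0)}"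
    using assms by (auto simp: comp_set_def intro: member_le_sum)
  ultimately show ?thesis by (rule finite_subset[rotated])
qed

lemma comp_set_insert:
  fixes f :: "'i \<Rightarrow> nat \<Rightarrow> complex"
  assumes "finite I" "a \<notin> I"
  shows "(\<Sum>\<nu>\<in>comp_set (insert a I) j. \<Prod>i\<in>insert a I. f i (\<nu> i))
       = (\<Sum>k\<le>j. f a k * (\<Sum>\<nu>\<in>comp_set I (j - k). \<Prod>i\<in>I. f i (\<nu> i)))"
proof -
  have "(\<Sum>k\<le>j. f a k * (\<Sum>\<nu>\<in>comp_set I (j - k). \<Prod>i\<in>I. f i (\<nu> i)))
      = (\<Sum>(k, \<nu>)\<in>Sigma {..j} (\<lambda>k. comp_set I (j - k)). f a k * (\<Prod>i\<in>I. f i (\<nu> i)))"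
    using assms by (simp add: sum.Sigma finite_comp_set sum_distrib_left)
  also have "\<dots> = (\<Sum>\<nu>\<in>comp_set (insert a I) j. \<Prod>i\<in>insert a I. f i (\<nu> i))"
  proof (rule sum.reindex_bij_witness[of _ "\<lambda>\<nu>. (\<nu> a, \<nu>(a := 0))" "\<lambda>(k, \<nu>). \<nu>(a := k)"], goal_cases)
    case (1 p)
    then show ?case using assms by (auto simp: comp_set_def fun_eq_iff)
  next
    case (2 p)
    have "(\<Sum>i\<in>I. if i = a then k else \<nu> i) = sum \<nu> I" for k and \<nu> :: "'i \<Rightarrow> nat"
      using assms by (intro sum.cong) auto
    then show ?case using assms 2 by (auto simp: comp_set_def)
  next
    case (4 \<nu>)
    have "(\<Sum>i\<in>I. if i = a then k else \<nu> i) = sum \<nu> I" for k and \<nu> :: "'i \<Rightarrow> nat"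
      using assms by (intro sum.cong) auto
    then show ?case using assms 4 by (auto simp: comp_set_def)
  next
    case (5 p)
    have "(\<Prod>i\<in>I. f i (if i = a then k else \<nu> i)) = (\<Prod>i\<in>I. f i (\<nu> i))" for k \<nu>
      using assms by (intro prod.cong) auto
    then show ?case using assms by (auto split: prod.splits)
  qed auto
  finally show ?thesis by simp
qed

text \<open>One Cauchy product for each coordinate. Absolute convergence is carried through the
  induction because the next product relies on it.\<close>

lemma multi_cauchy_product:
  fixes f :: "'i \<Rightarrow> nat \<Rightarrow> complex"
  assumes "finite I" "\<And>i. i \<in> I \<Longrightarrow> summable (\<lambda>k. norm (f i k))"
  shows "summable (\<lambda>j. norm (\<Sum>\<nu>\<in>comp_set I j. \<Prod>i\<in>I. f i (\<nu> i)))
     \<and> (\<lambda>j. \<Sum>\<nu>\<in>comp_set I j. \<Prod>i\<in>I. f i (\<nu> i)) sums (\<Prod>i\<in>I. suminf (f i))"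
  using assms
proof (induction I)
  case empty
  have 1: "(\<Sum>\<nu>\<in>comp_set {} j. \<Prod>i\<in>{}. f i (\<nu> i)) = (if j = 0 then 1 else 0)" for j
  proof -
    have "comp_set ({}::'i set) j = (if j = 0 then {\<lambda>_. 0} else {})"
      by (auto simp: comp_set_def fun_eq_iff)
    then show ?thesis by simp
  qed
  have 2: "norm (if j = 0 then 1 else 0 :: complex) = (if j = 0 then 1 else 0)" for j :: nat by simp
  show ?case unfolding 1 2 using sums_single[of 0 "\<lambda>_. 1::complex"] sums_single[of 0 "\<lambda>_. 1::real"]
    by (auto simp: sums_iff)
next
  case (insert a I)
  let ?c = "\<lambda>I j. \<Sum>\<nu>\<in>comp_set I j. \<Prod>i\<in>I. f i (\<nu> i)"
  have s1: "summable (\<lambda>j. norm (?c I j))" "?c I sums (\<Prod>i\<in>I. suminf (f i))"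
    using insert by auto
  have s2: "summable (\<lambda>k. norm (f a k))" using insert by auto
  have eq: "?c (insert a I) j = (\<Sum>k\<le>j. f a k * ?c I (j - k))" for j
    by (rule comp_set_insert) (use insert in auto)
  have n: "summable (\<lambda>j. norm (?c (insert a I) j))"
  proof (rule summable_comparison_test')
    show "summable (\<lambda>j. \<Sum>k\<le>j. norm (f a k) * norm (?c I (j - k)))"
      using summable_Cauchy_product[of "\<lambda>k. norm (f a k)" "\<lambda>k. norm (?c I k)"] s1 s2 by simp
    show "norm (norm (?c (insert a I) j)) \<le> (\<Sum>k\<le>j. norm (f a k) * norm (?c I (j - k)))" for j
      unfolding eq real_norm_def abs_norm_cancel by (rule order_trans[OF norm_sum]) (simp add: norm_mult)
  qed
  have "?c (insert a I) sums (suminf (f a) * suminf (?c I))"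
    unfolding eq by (rule Cauchy_product_sums[OF s2 s1(1)])
  then show ?case using n s1(2) insert by (simp add: sums_iff)
qed

text \<open>In the product of the one-variable Mehler series a multi-index contributes to the power
  of r given by the sum of its entries. Collecting by that power gives the projection
  kernels.\<close>

lemma proj_kernel_sums:
  fixes x y :: "real^'n"
  assumes "norm r < 1"
  shows "(\<lambda>j. of_real (proj_kernel j x y) * r ^ j) sums (\<Prod>i\<in>UNIV. mehler_kernel r (x $ i) (y $ i))"
proof -
  define f where "f i k = complex_of_real (hermite_fun k (x $ i) * hermite_fun k (y $ i)) * r ^ k" for i k
  have summ: "summable (\<lambda>k. norm (f i k))" for i
  proof -
    have "summable (\<lambda>k. of_real (hermite_fun k (x $ i) * hermite_fun k (y $ i)) * of_real s ^ k :: complex)"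
      if "\<bar>s\<bar> < 1" for s
      using mehler_sums[of "of_real s" "x $ i" "y $ i"] that by (auto simp: sums_iff)
    \<comment> \<open>Convergence at a radius strictly between \<open>norm r\<close> and 1 implies
      absolute convergence at r.\<close>
    from this[of "(1 + norm r) / 2"] have *: "summable (\<lambda>k. of_real (hermite_fun k (x $ i) * hermite_fun k (y $ i)) * complex_of_real ((1 + norm r) / 2) ^ k)"
      using assms by (simp del: of_real_divide)
    show ?thesis unfolding f_def
      by (rule powser_insidea[OF *]) (use assms in \<open>simp del: of_real_divide\<close>)
  qed
  have su: "suminf (f i) = mehler_kernel r (x $ i) (y $ i)" for i
  proof -
    have "f i = (\<lambda>k. complex_of_real (hermite_fun k (x $ i) * hermite_fun k (y $ i)) * r ^ k)"
      by (simp add: f_def fun_eq_iff)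
    then show ?thesis using mehler_sums[OF assms, of "x $ i" "y $ i"] by (simp only: sums_iff)
  qed
  have eq: "(\<Sum>\<nu>\<in>comp_set UNIV j. \<Prod>i\<in>UNIV. f i (\<nu> i)) = of_real (proj_kernel j x y) * r ^ j" for j
  proof -
    have "(\<Sum>\<nu>\<in>comp_set UNIV j. \<Prod>i\<in>UNIV. f i (\<nu> i)) = (\<Sum>\<nu>\<in>multi_indices j. \<Prod>i\<in>UNIV. f i (\<nu> $ i))"
      by (rule sum.reindex_bij_witness[of _ vec_nth vec_lambda]) (auto simp: comp_set_def multi_indices_def)
    also have "(\<Prod>i\<in>UNIV. f i (\<nu> $ i)) = of_real (hermite_vec \<nu> x * hermite_vec \<nu> y) * r ^ j"
      if "\<nu> \<in> multi_indices j" for \<nu>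
      using that by (simp add: f_def prod.distrib hermite_vec_def multi_indices_def flip: power_sum)
    then have "(\<Sum>\<nu>\<in>multi_indices j. \<Prod>i\<in>UNIV. f i (\<nu> $ i)) = of_real (proj_kernel j x y) * r ^ j"
      by (simp add: proj_kernel_def sum_distrib_right)
    finally show ?thesis .
  qed
  show ?thesis
    using multi_cauchy_product[of UNIV f, OF finite summ] unfolding eq su by simp
qed

lemma norm_prod_mehler_kernel:
  fixes x y :: "real^'n"
  assumes "norm r < 1"
  shows "norm (\<Prod>i\<in>UNIV. mehler_kernel r (x $ i) (y $ i)) \<le> norm (1 - r\<^sup>2) powr (- real CARD('n) / 2)"
proof -
  have nz: "norm (1 - r\<^sup>2) > 0" using one_minus_sq_Re_pos[OF assms] by force
  have "norm (mehler_kernel r (x $ i) (y $ i)) \<le> norm (1 - r\<^sup>2) powr (- 1 / 2)" for i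
  proof -
    have "1 \<le> sqrt pi" using pi_ge_two by simp
    then have "norm (1 - r\<^sup>2) powr (- 1 / 2) / sqrt pi \<le> norm (1 - r\<^sup>2) powr (- 1 / 2)"
      using mult_left_mono[of 1 "sqrt pi" "norm (1 - r\<^sup>2) powr (- 1 / 2)"] by (simp add: divide_le_eq)
    then show ?thesis using norm_mehler_kernel[OF assms] order_trans by blast
  qed
  then have "norm (\<Prod>i\<in>UNIV. mehler_kernel r (x $ i) (y $ i)) \<le> (\<Prod>i\<in>(UNIV::'n set). norm (1 - r\<^sup>2) powr (- 1 / 2))"
    unfolding prod_norm[symmetric] by (intro prod_mono) auto
  also have "\<dots> = norm (1 - r\<^sup>2) powr (- real CARD('n) / 2)"
    using nz by (simp add: powr_power)
  finally show ?thesis .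
qed

section \<open>Coefficients of a power series from its size on a circle\<close>

lemma integral_cis:
  "(LINT \<theta>|lborel. indicator {0..2 * pi} \<theta> *\<^sub>R cis (of_int l * \<theta>)) = (if l = 0 then 2 * pi else 0)"
proof (cases "l = 0")
  case True
  have "(LINT \<theta>|lborel. indicator {0..2 * pi} \<theta> *\<^sub>R (1::complex)) = of_real (2 * pi) - of_real 0"
    by (rule integral_FTC_atLeastAtMost[where F = of_real])
       (auto intro!: derivative_eq_intros simp: has_vector_derivative_of_real)
  then show ?thesis using True by simp
next
  case False
  have "(LINT \<theta>|lborel. indicator {0..2 * pi} \<theta> *\<^sub>R cis (of_int l * \<theta>))
     = cis (of_int l * (2 * pi)) / (\<i> * of_int l) - cis (of_int l * 0) / (\<i> * of_int l)"
  proof (rule integral_FTC_atLeastAtMost)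
    fix \<theta> :: real
    have "((\<lambda>z. exp (\<i> * of_int l * z) / (\<i> * of_int l)) has_field_derivative exp (\<i> * of_int l * of_real \<theta>)) (at (of_real \<theta>))"
      using False by (auto intro!: derivative_eq_intros)
    then have "((\<lambda>\<theta>. exp (\<i> * of_int l * of_real \<theta>) / (\<i> * of_int l)) has_vector_derivative exp (\<i> * of_int l * of_real \<theta>)) (at \<theta>)"
      by (rule has_vector_derivative_real_field)
    then show "((\<lambda>\<theta>. cis (of_int l * \<theta>) / (\<i> * of_int l)) has_vector_derivative cis (of_int l * \<theta>)) (at \<theta> within {0..2 * pi})"
      by (auto simp: cis_conv_exp mult.assoc intro: has_vector_derivative_at_within)
  qed (auto intro!: continuous_intros)
  also have "cis (of_int l * (2 * pi)) = 1"
    using cis_multiple_2pi[of "of_int l"] by (simp add: algebra_simps)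
  finally show ?thesis using False by simp
qed

text \<open>Integration against \<open>cis (- j \<theta>)\<close> isolates the j-th term. The bound
  by H is only asked almost everywhere, since the majorants used later are singular at the zeros of
  the sine.\<close>

lemma coeff_le_circle_integral:
  fixes a :: "nat \<Rightarrow> real" and H :: "real \<Rightarrow> real"
  assumes \<rho>: "\<rho> \<ge> 0" and summ: "summable (\<lambda>i. \<bar>a i\<bar> * \<rho> ^ i)"
    and H: "integrable lborel (\<lambda>\<theta>. indicator {0..2 * pi} \<theta> * H \<theta>)"
    and le: "AE \<theta> in lborel. \<theta> \<in> {0..2 * pi} \<longrightarrow> norm (\<Sum>i. of_real (a i) * (of_real \<rho> * cis \<theta>) ^ i) \<le> H \<theta>"
  shows "2 * pi * (a j * \<rho> ^ j) \<le> (LINT \<theta>|lborel. indicator {0..2 * pi} \<theta> * H \<theta>)"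
proof -
  let ?I = "\<lambda>\<theta>::real. indicator {0..2 * pi} \<theta> :: real"
  define f where "f i \<theta> = ?I \<theta> *\<^sub>R (of_real (a i) * (of_real \<rho> * cis \<theta>) ^ i * cis (- real j * \<theta>))" for i \<theta>
  have f_eq: "f i \<theta> = of_real (a i * \<rho> ^ i) * (?I \<theta> *\<^sub>R cis (of_int (int i - int j) * \<theta>))" for i \<theta>
    by (simp add: f_def power_mult_distrib Complex.DeMoivre cis_mult scaleR_conv_of_real algebra_simps)
  have int_f: "integrable lborel (f i)" for i
    unfolding f_eq[abs_def]
    by (intro integrable_mult_right borel_integrable_compact) (auto intro!: continuous_intros)
  have nf: "norm (f i \<theta>) = \<bar>a i\<bar> * \<rho> ^ i * ?I \<theta>" for i \<theta>
    using \<rho> by (simp add: f_def norm_mult norm_power abs_mult)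
  have int_nf: "(LINT \<theta>|lborel. norm (f i \<theta>)) = \<bar>a i\<bar> * \<rho> ^ i * (2 * pi)" for i
    unfolding nf by simp
  have "(LINT \<theta>|lborel. (\<Sum>i. f i \<theta>)) = (\<Sum>i. integral\<^sup>L lborel (f i))"
  proof (rule integral_suminf)
    show "AE \<theta> in lborel. summable (\<lambda>i. norm (f i \<theta>))"
      unfolding nf by (intro AE_I2 summable_mult2 summ)
    show "summable (\<lambda>i. LINT \<theta>|lborel. norm (f i \<theta>))"
      unfolding int_nf by (intro summable_mult2 summ)
  qed (rule int_f)
  also have "integral\<^sup>L lborel (f i) = (if i = j then of_real (2 * pi * (a j * \<rho> ^ j)) else 0)" for i
    unfolding f_eq[abs_def] integral_mult_right_zero integral_cis by simp
  then have "(\<Sum>i. integral\<^sup>L lborel (f i)) = of_real (2 * pi * (a j * \<rho> ^ j))"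
    using sums_single[of j "\<lambda>i. complex_of_real (2 * pi * (a j * \<rho> ^ j))"] by (simp add: sums_iff)
  finally have eq: "(LINT \<theta>|lborel. (\<Sum>i. f i \<theta>)) = of_real (2 * pi * (a j * \<rho> ^ j))" .
  have [measurable]: "(\<lambda>\<theta>. \<Sum>i. f i \<theta>) \<in> borel_measurable borel"
    using int_f by measurable
  have fs: "norm (\<Sum>i. f i \<theta>) = ?I \<theta> * norm (\<Sum>i. of_real (a i) * (of_real \<rho> * cis \<theta>) ^ i)" for \<theta>
  proof -
    have "summable (\<lambda>i. of_real (a i) * (of_real \<rho> * cis \<theta>) ^ i :: complex)"
      by (rule summable_norm_cancel) (use summ \<rho> in \<open>simp add: norm_mult norm_power\<close>)
    then have "(\<lambda>i. f i \<theta>) sums (?I \<theta> *\<^sub>R ((\<Sum>i. of_real (a i) * (of_real \<rho> * cis \<theta>) ^ i) * cis (- real j * \<theta>)))"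
      unfolding f_def by (intro sums_scaleR_right sums_mult2 summable_sums)
    then have "(\<Sum>i. f i \<theta>) = ?I \<theta> *\<^sub>R ((\<Sum>i. of_real (a i) * (of_real \<rho> * cis \<theta>) ^ i) * cis (- real j * \<theta>))"
      by (simp only: sums_iff)
    then show ?thesis by (simp add: norm_mult)
  qed
  have AEle: "AE \<theta> in lborel. norm (\<Sum>i. f i \<theta>) \<le> ?I \<theta> * H \<theta>"
    using le unfolding fs by eventually_elim (auto simp: indicator_def)
  have "2 * pi * (a j * \<rho> ^ j) \<le> norm (LINT \<theta>|lborel. (\<Sum>i. f i \<theta>))"
    unfolding eq norm_of_real by simp
  also have "\<dots> \<le> (LINT \<theta>|lborel. norm (\<Sum>i. f i \<theta>))" by (rule integral_norm_bound)
  also have "\<dots> \<le> (LINT \<theta>|lborel. ?I \<theta> * H \<theta>)"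
  proof (rule integral_mono_AE[OF _ H AEle])
    show "integrable lborel (\<lambda>\<theta>. norm (\<Sum>i. f i \<theta>))"
      by (rule Bochner_Integration.integrable_bound[OF H]) (use AEle in \<open>auto elim!: eventually_mono\<close>)
  qed
  finally show ?thesis .
qed

text \<open>With y = x/2 <= pi/4 one has \<open>sin x = 2 sin y cos y\<close>,
  \<open>sin y >= y cos y\<close> and \<open>(cos y)^2 >= 1/2\<close>.\<close>

lemma sin_ge_half: "x / 2 \<le> sin x" if "0 \<le> x" "x \<le> pi / 2" for x :: real
proof -
  define y where "y = x / 2"
  have y: "0 \<le> y" "y \<le> pi / 4" using that by (auto simp: y_def)
  have "sin 0 - 0 * cos 0 \<le> sin y - y * cos y"
  proof (rule DERIV_nonneg_imp_nondecreasing[OF y(1)])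
    fix z assume z: "0 \<le> z" "z \<le> y"
    have "((\<lambda>z. sin z - z * cos z) has_real_derivative z * sin z) (at z)"
      by (auto intro!: derivative_eq_intros)
    moreover have "0 \<le> z * sin z" using z y by (intro mult_nonneg_nonneg sin_ge_zero) auto
    ultimately show "\<exists>D. ((\<lambda>z. sin z - z * cos z) has_real_derivative D) (at z) \<and> 0 \<le> D" by blast
  qed
  then have 1: "y * cos y \<le> sin y" by simp
  have "cos (pi / 4) \<le> cos y" using y by (intro cos_monotone_0_pi_le) auto
  then have c: "sqrt 2 / 2 \<le> cos y" by (simp add: cos_45)
  have c0: "0 \<le> cos y" by (rule order_trans[OF _ c]) simp
  have "(sqrt 2 / 2) * (sqrt 2 / 2) \<le> cos y * cos y" using c c0 by (intro mult_mono) auto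
  then have cc: "1 / 2 \<le> cos y * cos y" by simp
  have "x / 2 = 2 * y * (1 / 2)" by (simp add: y_def)
  also have "\<dots> \<le> 2 * y * (cos y * cos y)" using y cc by (intro mult_left_mono) auto
  also have "\<dots> = 2 * (y * cos y) * cos y" by simp
  also have "\<dots> \<le> 2 * sin y * cos y"
  proof (intro mult_right_mono mult_left_mono 1)
    show "0 \<le> cos y" by (rule c0)
  qed simp
  also have "\<dots> = sin x" by (simp add: y_def sin_double[symmetric])
  finally show ?thesis .
qed

lemma integrable_abs_powr:
  assumes "0 \<le> \<beta>" "\<beta> < 1" "R \<ge> 0"
  shows "integrable lborel (\<lambda>x::real. indicator {- R..R} x * \<bar>x\<bar> powr (- \<beta>))"
proof -
  have "(\<lambda>x. x powr (- \<beta>)) integrable_on {0..R}"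
    using assms by (intro integrable_on_powr_from_0) auto
  then have "(\<lambda>x. x powr (- \<beta>)) absolutely_integrable_on {0..R}"
    by (rule nonnegative_absolutely_integrable_1) simp
  then have 1: "integrable lborel (\<lambda>x. indicator {0..R} x * x powr (- \<beta>))"
    unfolding set_integrable_def by (subst (asm) integrable_completion) auto
  then have 2: "integrable lborel (\<lambda>x. indicator {0..R} (0 + (-1) * x) * (0 + (-1) * x) powr (- \<beta>))"
    by (rule lborel_integrable_real_affine) simp
  show ?thesis
    by (rule Bochner_Integration.integrable_bound[OF Bochner_Integration.integrable_add[OF 1 2]])
       (auto simp: indicator_def abs_if)
qed

text \<open>Around each of the zeros 0, pi and 2 pi the modulus of the sine is at least half the
  distance to that zero, so three translates of \<open>|x| powr (- \<beta>)\<close> dominate. The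
  window [-7, 7] contains the distances that occur, as 2 pi <= 7.\<close>

lemma integrable_sin_powr:
  assumes "0 \<le> \<beta>" "\<beta> < 1"
  shows "integrable lborel (\<lambda>\<theta>. indicator {0..2 * pi} \<theta> * \<bar>sin \<theta>\<bar> powr (- \<beta>))"
proof -
  let ?u = "\<lambda>x::real. indicator {- 7..7} x * \<bar>x\<bar> powr (- \<beta>)"
  have u: "integrable lborel ?u" using assms by (intro integrable_abs_powr) auto
  have uc: "integrable lborel (\<lambda>\<theta>. ?u (- c + 1 * \<theta>))" for c
    by (rule lborel_integrable_real_affine[OF u]) simp
  have "integrable lborel (\<lambda>\<theta>. 2 powr \<beta> * (?u (- 0 + 1 * \<theta>) + ?u (- pi + 1 * \<theta>) + ?u (- (2 * pi) + 1 * \<theta>)))"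
    by (intro integrable_mult_right Bochner_Integration.integrable_add uc)
  then show ?thesis
  proof (rule Bochner_Integration.integrable_bound)
    show "AE \<theta> in lborel. norm (indicator {0..2 * pi} \<theta> * \<bar>sin \<theta>\<bar> powr (- \<beta>))
      \<le> norm (2 powr \<beta> * (?u (- 0 + 1 * \<theta>) + ?u (- pi + 1 * \<theta>) + ?u (- (2 * pi) + 1 * \<theta>)))"
    proof (rule AE_I2)
      fix \<theta> :: real
      show "norm (indicator {0..2 * pi} \<theta> * \<bar>sin \<theta>\<bar> powr (- \<beta>))
        \<le> norm (2 powr \<beta> * (?u (- 0 + 1 * \<theta>) + ?u (- pi + 1 * \<theta>) + ?u (- (2 * pi) + 1 * \<theta>)))"
      proof (cases "\<theta> \<in> {0..2 * pi} \<and> sin \<theta> \<noteq> 0")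
        case False
        then show ?thesis by (auto simp: indicator_def)
      next
        case True
        then have t: "0 \<le> \<theta>" "\<theta> \<le> 2 * pi" by auto
        have pi7: "2 * pi \<le> 7" using pi_approx by simp
        have key: "\<bar>sin \<theta>\<bar> powr (- \<beta>) \<le> 2 powr \<beta> * \<bar>d\<bar> powr (- \<beta>)" if d: "\<bar>d\<bar> / 2 \<le> \<bar>sin \<theta>\<bar>" "d \<noteq> 0" for d
        proof -
          have "\<bar>sin \<theta>\<bar> powr (- \<beta>) \<le> (\<bar>d\<bar> / 2) powr (- \<beta>)"
            using d assms by (intro powr_mono2') auto
          also have "\<dots> = 2 powr \<beta> * \<bar>d\<bar> powr (- \<beta>)" by (simp add: powr_divide powr_minus field_simps)
          finally show ?thesis .
        qed
        have nn: "?u x \<ge> 0" for x by simp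
        consider "\<theta> \<le> pi / 2" | "pi / 2 \<le> \<theta>" "\<theta> \<le> pi" | "pi \<le> \<theta>" "\<theta> \<le> 3 * pi / 2" | "3 * pi / 2 \<le> \<theta>"
          by linarith
        then have "\<bar>sin \<theta>\<bar> powr (- \<beta>) \<le> 2 powr \<beta> * ?u (- 0 + 1 * \<theta>) \<or>
          \<bar>sin \<theta>\<bar> powr (- \<beta>) \<le> 2 powr \<beta> * ?u (- pi + 1 * \<theta>) \<or>
          \<bar>sin \<theta>\<bar> powr (- \<beta>) \<le> 2 powr \<beta> * ?u (- (2 * pi) + 1 * \<theta>)"
        proof cases
          case 1
          have "\<theta> / 2 \<le> sin \<theta>" using sin_ge_half[of \<theta>] t 1 by simp
          then have "\<bar>sin \<theta>\<bar> powr (- \<beta>) \<le> 2 powr \<beta> * \<bar>\<theta>\<bar> powr (- \<beta>)"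
            using t True by (intro key) (auto simp: abs_if)
          then show ?thesis using t pi7 by (simp add: indicator_def)
        next
          case 2
          have "(pi - \<theta>) / 2 \<le> sin (pi - \<theta>)" using sin_ge_half[of "pi - \<theta>"] 2 by simp
          moreover have "pi - \<theta> \<noteq> 0" using True by auto
          ultimately have "\<bar>sin \<theta>\<bar> powr (- \<beta>) \<le> 2 powr \<beta> * \<bar>pi - \<theta>\<bar> powr (- \<beta>)"
            using 2 by (intro key) (auto simp: abs_if)
          then show ?thesis using 2 pi7 t by (simp add: indicator_def abs_minus_commute)
        next
          case 3
          have "(\<theta> - pi) / 2 \<le> sin (\<theta> - pi)" using sin_ge_half[of "\<theta> - pi"] 3 by simp
          moreover have "\<theta> - pi \<noteq> 0" using True by auto
          ultimately have "\<bar>sin \<theta>\<bar> powr (- \<beta>) \<le> 2 powr \<beta> * \<bar>\<theta> - pi\<bar> powr (- \<beta>)"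
            using 3 by (intro key) (auto simp: abs_if sin_diff)
          then show ?thesis using 3 pi7 t by (simp add: indicator_def abs_minus_commute)
        next
          case 4
          have "(2 * pi - \<theta>) / 2 \<le> sin (2 * pi - \<theta>)" using sin_ge_half[of "2 * pi - \<theta>"] 4 t by simp
          moreover have "2 * pi - \<theta> \<noteq> 0" using True by auto
          moreover have "sin (2 * pi - \<theta>) = - sin \<theta>" by (simp add: sin_diff)
          ultimately have "\<bar>sin \<theta>\<bar> powr (- \<beta>) \<le> 2 powr \<beta> * \<bar>2 * pi - \<theta>\<bar> powr (- \<beta>)"
            using 4 t by (intro key) (auto simp: abs_if)
          then show ?thesis using 4 pi7 t by (simp add: indicator_def abs_minus_commute)
        qed
        then have "\<bar>sin \<theta>\<bar> powr (- \<beta>) \<le> 2 powr \<beta> * (?u (- 0 + 1 * \<theta>) + ?u (- pi + 1 * \<theta>) + ?u (- (2 * pi) + 1 * \<theta>))"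
          using mult_nonneg_nonneg[OF powr_ge_zero[of 2 \<beta>] nn, of "- 0 + 1 * \<theta>"]
            mult_nonneg_nonneg[OF powr_ge_zero[of 2 \<beta>] nn, of "- pi + 1 * \<theta>"]
            mult_nonneg_nonneg[OF powr_ge_zero[of 2 \<beta>] nn, of "- (2 * pi) + 1 * \<theta>"]
          unfolding distrib_left by linarith
        then show ?thesis using True by (simp add: abs_of_nonneg)
      qed
    qed
  qed simp
qed

lemma le_geometric_mean:
  fixes X :: real
  assumes "0 \<le> X" "X \<le> A" "X \<le> B" "0 \<le> t" "t \<le> 1"
  shows "X \<le> A powr (1 - t) * B powr t"
proof (cases "X = 0")
  case False
  then have "X = X powr (1 - t) * X powr t" using assms by (simp flip: powr_add)
  also have "\<dots> \<le> A powr (1 - t) * B powr t"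
    using assms by (intro mult_mono powr_mono2) auto
  finally show ?thesis .
qed simp

text \<open>Everything follows from \<open>|1 - r^2|^2 = (1 - R)^2 + 4 R (sin \<theta>)^2\<close>
  with \<open>R = \<rho>^2\<close>; the condition \<open>\<rho> >= 1/2\<close> is there to make 4 R
  at least one.\<close>

lemma circle_norm_bounds:
  fixes \<rho> \<theta> :: real
  assumes "1 / 2 \<le> \<rho>" "\<rho> < 1"
  defines "r \<equiv> of_real \<rho> * cis \<theta>"
  shows "\<bar>sin \<theta>\<bar> \<le> norm (1 - r\<^sup>2)" "1 - \<rho>\<^sup>2 \<le> norm (1 - r\<^sup>2)" "norm r < 1"
proof -
  define R where "R = \<rho>\<^sup>2"
  have R: "1 / 4 \<le> R" using power_mono[OF assms(1), of 2] by (simp add: R_def power2_eq_square)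
  have r2: "r\<^sup>2 = of_real R * cis (2 * \<theta>)"
    by (simp add: r_def R_def power_mult_distrib Complex.DeMoivre)
  have "norm (1 - r\<^sup>2) ^ 2 = (1 - R * cos (2 * \<theta>))\<^sup>2 + (R * sin (2 * \<theta>))\<^sup>2"
    unfolding r2 cmod_power2 by simp
  also have "\<dots> = 1 - 2 * R * cos (2 * \<theta>) + R\<^sup>2 * ((cos (2 * \<theta>))\<^sup>2 + (sin (2 * \<theta>))\<^sup>2)"
    by algebra
  also have "\<dots> = 1 - 2 * R * (1 - 2 * (sin \<theta>)\<^sup>2) + R\<^sup>2"
    by (simp only: sin_cos_squared_add2 mult_1_right) (simp only: cos_double_sin)
  also have "\<dots> = (1 - R)\<^sup>2 + 4 * R * (sin \<theta>)\<^sup>2"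
    by (simp add: power2_eq_square algebra_simps)
  finally have eq: "norm (1 - r\<^sup>2) ^ 2 = (1 - R)\<^sup>2 + 4 * R * (sin \<theta>)\<^sup>2" .
  have "1 * (sin \<theta>)\<^sup>2 \<le> 4 * R * (sin \<theta>)\<^sup>2" using R by (intro mult_right_mono) auto
  then have "\<bar>sin \<theta>\<bar>\<^sup>2 \<le> norm (1 - r\<^sup>2) ^ 2"
    using eq zero_le_power2[of "1 - R"] unfolding power2_abs by linarith
  then show "\<bar>sin \<theta>\<bar> \<le> norm (1 - r\<^sup>2)" by (rule power2_le_imp_le) simp
  have "(1 - R)\<^sup>2 \<le> norm (1 - r\<^sup>2) ^ 2" using eq R by simp
  then have "1 - R \<le> norm (1 - r\<^sup>2)" by (rule power2_le_imp_le) simp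
  then show "1 - \<rho>\<^sup>2 \<le> norm (1 - r\<^sup>2)" by (simp add: R_def)
  show "norm r < 1" using assms by (simp add: r_def norm_mult)
qed

lemma AE_sin_nonzero: "AE \<theta> in lborel. \<theta> \<in> {0..2 * pi} \<longrightarrow> sin \<theta> \<noteq> (0::real)"
proof -
  have "AE \<theta> in lborel. \<theta> \<noteq> (0::real)" "AE \<theta> in lborel. \<theta> \<noteq> pi" "AE \<theta> in lborel. \<theta> \<noteq> 2 * pi"
    by (rule AE_lborel_singleton)+
  then show ?thesis
  proof eventually_elim
    case (elim \<theta>)
    show ?case
    proof
      assume "\<theta> \<in> {0..2 * pi}"
      then have t: "0 < \<theta>" "\<theta> < 2 * pi" using elim by auto
      show "sin \<theta> \<noteq> 0"
      proof (cases "\<theta> < pi")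
        case True then show ?thesis using sin_gt_zero[of \<theta>] t by simp
      next
        case False
        then have "sin (\<theta> - pi) > 0" using t elim by (intro sin_gt_zero) auto
        then show ?thesis by (simp add: sin_diff)
      qed
    qed
  qed
qed

text \<open>The singular majorant with exponent \<gamma> may fail to be integrable. Its geometric
  mean with the constant A, with weight t on the singular one, has the singularity
  \<open>t * \<gamma> < 1\<close>, is integrable, and costs the factor
  \<open>A powr (1 - t)\<close>.\<close>

lemma coeff_bound_core:
  fixes a :: "nat \<Rightarrow> real"
  assumes \<rho>: "1 / 2 \<le> \<rho>" "\<rho> < 1" and summ: "summable (\<lambda>i. \<bar>a i\<bar> * \<rho> ^ i)"
    and A: "\<And>\<theta>. norm (\<Sum>i. of_real (a i) * (of_real \<rho> * cis \<theta>) ^ i) \<le> A"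
    and B: "\<And>\<theta>. sin \<theta> \<noteq> 0 \<Longrightarrow> norm (\<Sum>i. of_real (a i) * (of_real \<rho> * cis \<theta>) ^ i) \<le> B * \<bar>sin \<theta>\<bar> powr (- \<gamma>)"
    and t: "0 \<le> t" "t \<le> 1" "\<gamma> \<ge> 0" "t * \<gamma> < 1" and AB: "A \<ge> 0" "B \<ge> 0"
  shows "a j * \<rho> ^ j \<le> A powr (1 - t) * B powr t * (LINT \<theta>|lborel. indicator {0..2 * pi} \<theta> * \<bar>sin \<theta>\<bar> powr (- (t * \<gamma>)))"
proof -
  define K where "K = (LINT \<theta>|lborel. indicator {0..2 * pi} \<theta> * \<bar>sin \<theta>\<bar> powr (- (t * \<gamma>)))"
  have K0: "K \<ge> 0" unfolding K_def by simp
  define D where "D = A powr (1 - t) * B powr t"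
  have D0: "D \<ge> 0" by (simp add: D_def)
  have int: "integrable lborel (\<lambda>\<theta>. indicator {0..2 * pi} \<theta> * \<bar>sin \<theta>\<bar> powr (- (t * \<gamma>)))"
    by (rule integrable_sin_powr) (use t in auto)
  have "2 * pi * (a j * \<rho> ^ j) \<le> (LINT \<theta>|lborel. indicator {0..2 * pi} \<theta> * (D * \<bar>sin \<theta>\<bar> powr (- (t * \<gamma>))))"
  proof (rule coeff_le_circle_integral[OF _ summ])
    show "integrable lborel (\<lambda>\<theta>. indicator {0..2 * pi} \<theta> * (D * \<bar>sin \<theta>\<bar> powr (- (t * \<gamma>))))"
      using integrable_mult_right[OF int, of D] by (simp add: algebra_simps)
    show "AE \<theta> in lborel. \<theta> \<in> {0..2 * pi} \<longrightarrow> norm (\<Sum>i. of_real (a i) * (of_real \<rho> * cis \<theta>) ^ i) \<le> D * \<bar>sin \<theta>\<bar> powr (- (t * \<gamma>))"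
      using AE_sin_nonzero
    proof eventually_elim
      case (elim \<theta>)
      show ?case
      proof
        assume "\<theta> \<in> {0..2 * pi}"
        then have "sin \<theta> \<noteq> 0" using elim by simp
        then have "norm (\<Sum>i. of_real (a i) * (of_real \<rho> * cis \<theta>) ^ i) \<le> A powr (1 - t) * (B * \<bar>sin \<theta>\<bar> powr (- \<gamma>)) powr t"
          using A[of \<theta>] B[of \<theta>] t by (intro le_geometric_mean) auto
        also have "\<dots> = D * \<bar>sin \<theta>\<bar> powr (- (t * \<gamma>))"
          using AB by (simp add: D_def powr_mult powr_powr algebra_simps)
        finally show "norm (\<Sum>i. of_real (a i) * (of_real \<rho> * cis \<theta>) ^ i) \<le> D * \<bar>sin \<theta>\<bar> powr (- (t * \<gamma>))" .
      qed
    qed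
  qed (use \<rho> in simp)
  also have "\<dots> = D * K"
  proof -
    have "(\<lambda>\<theta>. indicator {0..2 * pi} \<theta> * (D * \<bar>sin \<theta>\<bar> powr (- (t * \<gamma>)))) = (\<lambda>\<theta>. D * (indicator {0..2 * pi} \<theta> * \<bar>sin \<theta>\<bar> powr (- (t * \<gamma>))))"
      by (simp add: algebra_simps)
    then show ?thesis unfolding K_def by simp
  qed
  finally have 1: "2 * pi * (a j * \<rho> ^ j) \<le> D * K" .
  show ?thesis
  proof (cases "a j * \<rho> ^ j \<ge> 0")
    case True
    have "1 * (a j * \<rho> ^ j) \<le> (2 * pi) * (a j * \<rho> ^ j)"
      using True pi_ge_two by (intro mult_right_mono) auto
    then show ?thesis using 1 by (simp add: D_def K_def)
  next
    case False
    then show ?thesis using mult_nonneg_nonneg[OF D0 K0] unfolding D_def K_def by linarith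
  qed
qed

section \<open>Eigenfunction bounds from Mehler's formula\<close>

definition eigf :: "(nat^'n \<Rightarrow> complex) \<Rightarrow> nat \<Rightarrow> real^'n \<Rightarrow> complex" where
  "eigf c j x = (\<Sum>\<nu>\<in>multi_indices j. c \<nu> * of_real (hermite_vec \<nu> x))"

definition rad :: "nat \<Rightarrow> real" where "rad j = 1 - 1 / (real j + 2)"

text \<open>A distance of order 1/j from the unit circle costs no more than the factor
  \<open>exp 1\<close> when \<open>a j\<close> is recovered from \<open>a j * \<rho> ^ j\<close>.
  The shift by 2 gives radius at least 1/2 already for j = 0, as \<open>circle_norm_bounds\<close>
  requires.\<close>

lemma rad: "1 / 2 \<le> rad j" "rad j < 1" "1 / (real j + 2) \<le> 1 - (rad j)\<^sup>2" "1 \<le> exp 1 * rad j ^ j"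
proof -
  define e where "e = 1 / (real j + 2)"
  have e: "0 < e" "e \<le> 1 / 2" by (auto simp: e_def field_simps)
  then show "1 / 2 \<le> rad j" "rad j < 1" by (auto simp: rad_def e_def[symmetric])
  have "e * e \<le> e * 1" using e by (intro mult_left_mono) auto
  then show "1 / (real j + 2) \<le> 1 - (rad j)\<^sup>2"
    unfolding rad_def e_def[symmetric] by (simp add: power2_eq_square algebra_simps)
  have pos: "rad j > 0" using e by (simp add: rad_def e_def[symmetric])
  have "1 / rad j = 1 + 1 / (real j + 1)" by (simp add: rad_def divide_simps) (simp add: algebra_simps)
  also have "\<dots> \<le> exp (1 / (real j + 1))" by (rule exp_ge_add_one_self)
  finally have "(1 / rad j) ^ j \<le> exp (1 / (real j + 1)) ^ j"
    using pos by (intro power_mono) auto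
  also have "\<dots> = exp (real j / (real j + 1))" by (simp flip: exp_of_nat_mult)
  also have "\<dots> \<le> exp 1" by simp
  finally show "1 \<le> exp 1 * rad j ^ j" using pos by (simp add: power_divide divide_le_eq)
qed

lemma proj_kernel_diag_nonneg: "proj_kernel j x x \<ge> 0"
  unfolding proj_kernel_def by (intro sum_nonneg) (simp add: power2_eq_square[symmetric])

lemma abs_proj_kernel_le:
  fixes x y :: "real^'n"
  shows "\<bar>proj_kernel j x y\<bar> \<le> (proj_kernel j x x + proj_kernel j y y) / 2"
proof -
  have "\<bar>proj_kernel j x y\<bar> \<le> (\<Sum>\<nu>\<in>multi_indices j. \<bar>hermite_vec \<nu> x * hermite_vec \<nu> y\<bar>)"
    unfolding proj_kernel_def by (rule sum_abs)
  also have "\<dots> \<le> (\<Sum>\<nu>\<in>multi_indices j. (hermite_vec \<nu> x * hermite_vec \<nu> x + hermite_vec \<nu> y * hermite_vec \<nu> y) / 2)"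
  proof (rule sum_mono)
    fix \<nu> :: "nat^'n"
    show "\<bar>hermite_vec \<nu> x * hermite_vec \<nu> y\<bar> \<le> (hermite_vec \<nu> x * hermite_vec \<nu> x + hermite_vec \<nu> y * hermite_vec \<nu> y) / 2"
      using sum_squares_bound[of "\<bar>hermite_vec \<nu> x\<bar>" "\<bar>hermite_vec \<nu> y\<bar>"]
      by (simp add: abs_mult power2_eq_square)
  qed
  also have "\<dots> = (proj_kernel j x x + proj_kernel j y y) / 2"
    by (simp add: proj_kernel_def sum.distrib flip: sum_divide_distrib)
  finally show ?thesis .
qed

text \<open>Diagonal values are nonnegative, so at a real nonnegative radius the sum equals the
  modulus of the Mehler product.\<close>

lemma diag_sums:
  fixes x :: "real^'n"
  assumes "0 \<le> \<rho>" "\<rho> < 1"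
  shows "summable (\<lambda>i. proj_kernel i x x * \<rho> ^ i)"
    and "(\<Sum>i. proj_kernel i x x * \<rho> ^ i) \<le> (1 - \<rho>\<^sup>2) powr (- real CARD('n) / 2)"
proof -
  have n: "norm (complex_of_real \<rho>) < 1" using assms by simp
  have s: "(\<lambda>i. complex_of_real (proj_kernel i x x * \<rho> ^ i)) sums (\<Prod>i\<in>UNIV. mehler_kernel (of_real \<rho>) (x $ i) (x $ i))"
    using proj_kernel_sums[OF n, of x x] by simp
  then have "summable (\<lambda>i. complex_of_real (proj_kernel i x x * \<rho> ^ i))" by (rule sums_summable)
  then show summ: "summable (\<lambda>i. proj_kernel i x x * \<rho> ^ i)" by (simp only: summable_of_real_iff)
  have "complex_of_real (\<Sum>i. proj_kernel i x x * \<rho> ^ i) = (\<Prod>i\<in>UNIV. mehler_kernel (of_real \<rho>) (x $ i) (x $ i))"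
    using s summ by (simp only: suminf_of_real sums_iff)
  moreover have "0 \<le> (\<Sum>i. proj_kernel i x x * \<rho> ^ i)"
    by (intro suminf_nonneg summ mult_nonneg_nonneg proj_kernel_diag_nonneg) (use assms in auto)
  ultimately have "(\<Sum>i. proj_kernel i x x * \<rho> ^ i) = norm (\<Prod>i\<in>UNIV. mehler_kernel (of_real \<rho>) (x $ i) (x $ i))"
    by (metis norm_of_real abs_of_nonneg)
  also have "\<dots> \<le> norm (1 - (complex_of_real \<rho>)\<^sup>2) powr (- real CARD('n) / 2)"
    by (rule norm_prod_mehler_kernel[OF n])
  also have "norm (1 - (complex_of_real \<rho>)\<^sup>2) = 1 - \<rho>\<^sup>2"
  proof -
    have "1 - (complex_of_real \<rho>)\<^sup>2 = of_real (1 - \<rho>\<^sup>2)" by simp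
    moreover have "\<rho>\<^sup>2 \<le> 1" using assms by (simp add: power_le_one)
    ultimately show ?thesis by (simp only: norm_of_real)
  qed
  finally show "(\<Sum>i. proj_kernel i x x * \<rho> ^ i) \<le> (1 - \<rho>\<^sup>2) powr (- real CARD('n) / 2)" .
qed

text \<open>\<open>coeff_bound_core\<close> with \<open>A = (1 - \<rho>^2)^(-n/2)\<close>, which is
  at most \<open>(j + 2)^(n/2)\<close>, with B = 1 and \<gamma> = n/2. For n >= 2, letting t n/2
  tend to 1 brings the exponent arbitrarily close to n/2 - 1.\<close>

lemma proj_kernel_diag_bound:
  fixes t :: real
  assumes t: "0 \<le> t" "t \<le> 1" "t * (real CARD('n) / 2) < 1"
  obtains C where "C > 0" "\<And>j (x::real^'n). proj_kernel j x x \<le> C * (real j + 2) powr (real CARD('n) / 2 * (1 - t))"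
proof -
  define n where "n = real CARD('n)"
  have n0: "n \<ge> 0" by (simp add: n_def)
  define K where "K = (LINT \<theta>|lborel. indicator {0..2 * pi} \<theta> * \<bar>sin \<theta>\<bar> powr (- (t * (n / 2))))"
  have K0: "K \<ge> 0" by (simp add: K_def)
  show thesis
  proof (rule that)
    show "exp 1 * (K + 1) > 0" using K0 by simp
    fix j and x :: "real^'n"
    define \<rho> where "\<rho> = rad j"
    note \<rho> = rad[of j, folded \<rho>_def]
    have s1: "1 - \<rho>\<^sup>2 > 0" using \<rho>(3) by (smt (verit) divide_pos_pos of_nat_0_le_iff)
    have sum_eq: "(\<Sum>i. complex_of_real (proj_kernel i x x) * r ^ i) = (\<Prod>i\<in>UNIV. mehler_kernel r (x $ i) (x $ i))"
      if "norm r < 1" for r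
      using proj_kernel_sums[OF that, of x x] by (simp add: sums_iff)
    have "proj_kernel j x x * \<rho> ^ j \<le> ((1 - \<rho>\<^sup>2) powr (- n / 2)) powr (1 - t) * 1 powr t * K"
      unfolding K_def
    proof (rule coeff_bound_core[OF \<rho>(1,2)])
      show "summable (\<lambda>i. \<bar>proj_kernel i x x\<bar> * \<rho> ^ i)"
        using diag_sums(1)[of \<rho> x] \<rho> by (simp add: abs_of_nonneg proj_kernel_diag_nonneg)
      fix \<theta> :: real
      note c = circle_norm_bounds[OF \<rho>(1,2), of \<theta>]
      have le: "norm (\<Sum>i. complex_of_real (proj_kernel i x x) * (of_real \<rho> * cis \<theta>) ^ i)
          \<le> norm (1 - (of_real \<rho> * cis \<theta>)\<^sup>2) powr (- n / 2)"
        unfolding sum_eq[OF c(3)] n_def by (rule norm_prod_mehler_kernel[OF c(3)])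
      also have "\<dots> \<le> (1 - \<rho>\<^sup>2) powr (- n / 2)"
        using c(2) s1 n0 by (intro powr_mono2') auto
      finally show "norm (\<Sum>i. complex_of_real (proj_kernel i x x) * (of_real \<rho> * cis \<theta>) ^ i) \<le> (1 - \<rho>\<^sup>2) powr (- n / 2)" .
      assume "sin \<theta> \<noteq> 0"
      then have "norm (1 - (of_real \<rho> * cis \<theta>)\<^sup>2) powr (- n / 2) \<le> \<bar>sin \<theta>\<bar> powr (- n / 2)"
        using c(1) n0 by (intro powr_mono2') auto
      then show "norm (\<Sum>i. complex_of_real (proj_kernel i x x) * (of_real \<rho> * cis \<theta>) ^ i) \<le> 1 * \<bar>sin \<theta>\<bar> powr (- (n / 2))"
        using le by simp
    qed (use t n0 in \<open>auto simp: n_def\<close>)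
    also have "((1 - \<rho>\<^sup>2) powr (- n / 2)) powr (1 - t) * 1 powr t * K \<le> (real j + 2) powr (n / 2 * (1 - t)) * K"
    proof -
      have "(1 - \<rho>\<^sup>2) powr (- n / 2) \<le> (1 / (real j + 2)) powr (- n / 2)"
        using \<rho>(3) n0 by (intro powr_mono2') auto
      also have "\<dots> = (real j + 2) powr (n / 2)"
        by (simp add: powr_divide powr_minus)
      finally have "((1 - \<rho>\<^sup>2) powr (- n / 2)) powr (1 - t) \<le> ((real j + 2) powr (n / 2)) powr (1 - t)"
        using t by (intro powr_mono2) auto
      then show ?thesis using K0 by (simp add: powr_powr mult_right_mono)
    qed
    finally have 1: "proj_kernel j x x * \<rho> ^ j \<le> (real j + 2) powr (n / 2 * (1 - t)) * K" .
    have "1 * proj_kernel j x x \<le> (exp 1 * \<rho> ^ j) * proj_kernel j x x"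
      using \<rho>(4) proj_kernel_diag_nonneg by (intro mult_right_mono) auto
    also have "\<dots> = exp 1 * (proj_kernel j x x * \<rho> ^ j)" by simp
    also have "\<dots> \<le> exp 1 * ((real j + 2) powr (n / 2 * (1 - t)) * K)" using 1 by (intro mult_left_mono) auto
    also have "\<dots> \<le> exp 1 * ((real j + 2) powr (n / 2 * (1 - t)) * (K + 1))" by (intro mult_left_mono) auto
    finally show "proj_kernel j x x \<le> exp 1 * (K + 1) * (real j + 2) powr (real CARD('n) / 2 * (1 - t))"
      by (simp add: n_def algebra_simps)
  qed
qed

subsection \<open>Parseval and Bessel\<close>

lemma continuous_on_eigf: "continuous_on UNIV (eigf c j)"
  unfolding eigf_def[abs_def] by (intro continuous_intros continuous_on_hermite_vec)

lemma measurable_eigf[measurable]: "eigf c j \<in> borel_measurable borel"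
  by (intro borel_measurable_continuous_onI continuous_on_eigf)

lemma integrable_cmult_hermite_vec:
  "integrable lborel (\<lambda>x. c * complex_of_real (hermite_vec \<nu> x * hermite_vec \<mu> x))"
  by (intro integrable_mult_right integrable_of_real integrable_hermite_vec_mult)

lemma parseval_finite:
  assumes "finite F"
  shows "integrable lborel (\<lambda>x. (norm (\<Sum>\<nu>\<in>F. c \<nu> * complex_of_real (hermite_vec \<nu> x)))\<^sup>2)"
    "(LINT x|lborel. (norm (\<Sum>\<nu>\<in>F. c \<nu> * complex_of_real (hermite_vec \<nu> x)))\<^sup>2) = (\<Sum>\<nu>\<in>F. (norm (c \<nu>))\<^sup>2)"
proof -
  have eq: "complex_of_real ((norm (\<Sum>\<nu>\<in>F. c \<nu> * complex_of_real (hermite_vec \<nu> x)))\<^sup>2)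
    = (\<Sum>\<nu>\<in>F. \<Sum>\<mu>\<in>F. (c \<nu> * cnj (c \<mu>)) * complex_of_real (hermite_vec \<nu> x * hermite_vec \<mu> x))" for x
    unfolding complex_norm_square
    by (simp add: sum_product cnj_sum algebra_simps)
  have int: "integrable lborel (\<lambda>x. complex_of_real ((norm (\<Sum>\<nu>\<in>F. c \<nu> * complex_of_real (hermite_vec \<nu> x)))\<^sup>2))"
    unfolding eq by (intro Bochner_Integration.integrable_sum integrable_cmult_hermite_vec)
  then show "integrable lborel (\<lambda>x. (norm (\<Sum>\<nu>\<in>F. c \<nu> * complex_of_real (hermite_vec \<nu> x)))\<^sup>2)"
    by (simp only: complex_of_real_integrable_eq)
  have "(LINT x|lborel. complex_of_real ((norm (\<Sum>\<nu>\<in>F. c \<nu> * complex_of_real (hermite_vec \<nu> x)))\<^sup>2))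
     = (\<Sum>\<nu>\<in>F. \<Sum>\<mu>\<in>F. (c \<nu> * cnj (c \<mu>)) * (if \<nu> = \<mu> then 1 else 0))"
    unfolding eq
    by (subst Bochner_Integration.integral_sum, intro Bochner_Integration.integrable_sum integrable_cmult_hermite_vec,
        intro sum.cong refl, subst Bochner_Integration.integral_sum, intro integrable_cmult_hermite_vec,
        intro sum.cong refl, subst integral_mult_right_zero, subst integral_complex_of_real, subst hermite_vec_orthonormal) simp
  also have "\<dots> = (\<Sum>\<nu>\<in>F. c \<nu> * cnj (c \<nu>))"
    using assms by (simp add: if_distrib[of "\<lambda>z. _ * z"] sum.delta cong: if_cong)
  also have "\<dots> = of_real (\<Sum>\<nu>\<in>F. (norm (c \<nu>))\<^sup>2)" by (simp only: complex_norm_square of_real_sum)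
  finally show "(LINT x|lborel. (norm (\<Sum>\<nu>\<in>F. c \<nu> * complex_of_real (hermite_vec \<nu> x)))\<^sup>2) = (\<Sum>\<nu>\<in>F. (norm (c \<nu>))\<^sup>2)"
    by (simp only: integral_complex_of_real of_real_eq_iff)
qed

lemma parseval_eigf:
  "integrable lborel (\<lambda>x. (norm (eigf c j x))\<^sup>2)"
  "(LINT x|lborel. (norm (eigf c j x))\<^sup>2) = (\<Sum>\<nu>\<in>multi_indices j. (norm (c \<nu>))\<^sup>2)"
  unfolding eigf_def by (intro parseval_finite finite_multi_indices)+

lemma norm_eigf_le:
  "(norm (eigf c j x))\<^sup>2 \<le> (\<Sum>\<nu>\<in>multi_indices j. (norm (c \<nu>))\<^sup>2) * proj_kernel j x x"
proof -
  have "norm (eigf c j x) \<le> (\<Sum>\<nu>\<in>multi_indices j. norm (c \<nu>) * \<bar>hermite_vec \<nu> x\<bar>)"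
    unfolding eigf_def by (rule order_trans[OF norm_sum]) (simp add: norm_mult)
  then have "(norm (eigf c j x))\<^sup>2 \<le> (\<Sum>\<nu>\<in>multi_indices j. norm (c \<nu>) * \<bar>hermite_vec \<nu> x\<bar>)\<^sup>2"
    by (rule power_mono) simp
  also have "\<dots> \<le> (\<Sum>\<nu>\<in>multi_indices j. (norm (c \<nu>))\<^sup>2) * (\<Sum>\<nu>\<in>multi_indices j. \<bar>hermite_vec \<nu> x\<bar>\<^sup>2)"
    by (rule Cauchy_Schwarz_ineq_sum)
  also have "(\<Sum>\<nu>\<in>multi_indices j. \<bar>hermite_vec \<nu> x\<bar>\<^sup>2) = proj_kernel j x x"
    by (simp add: proj_kernel_def power2_eq_square)
  finally show ?thesis .
qed

definition hcoef :: "(real^'n \<Rightarrow> complex) \<Rightarrow> nat^'n \<Rightarrow> complex" where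
  "hcoef h \<nu> = (LINT x|lborel. h x * of_real (hermite_vec \<nu> x))"

lemma integrable_mult_hermite_vec:
  assumes "integrable lborel h"
  shows "integrable lborel (\<lambda>x. h x * complex_of_real (hermite_vec \<nu> x))"
proof -
  obtain B where B: "\<And>x. \<bar>hermite_vec \<nu> x\<bar> \<le> B" using bounded_hermite_vec by blast
  have "integrable lborel (\<lambda>x. of_real B * h x)" using assms by (rule integrable_mult_right)
  then show ?thesis
  proof (rule Bochner_Integration.integrable_bound)
    show "AE x in lborel. norm (h x * complex_of_real (hermite_vec \<nu> x)) \<le> norm (of_real B * h x)"
    proof (rule AE_I2)
      fix x
      have "norm (h x) * \<bar>hermite_vec \<nu> x\<bar> \<le> norm (h x) * \<bar>B\<bar>"
        using B[of x] by (intro mult_left_mono) auto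
      then show "norm (h x * complex_of_real (hermite_vec \<nu> x)) \<le> norm (of_real B * h x)"
        by (simp add: norm_mult mult.commute)
    qed
  qed (use assms in measurable)
qed

lemma bessel:
  assumes h: "integrable lborel h" "integrable lborel (\<lambda>x. (norm (h x))\<^sup>2)" and F: "finite F"
  shows "(\<Sum>\<nu>\<in>F. (norm (hcoef h \<nu>))\<^sup>2) \<le> (LINT x|lborel. (norm (h x))\<^sup>2)"
proof -
  define S where "S x = (\<Sum>\<nu>\<in>F. hcoef h \<nu> * complex_of_real (hermite_vec \<nu> x))" for x
  define Q where "Q = (\<Sum>\<nu>\<in>F. (norm (hcoef h \<nu>))\<^sup>2)"
  have S: "integrable lborel (\<lambda>x. (norm (S x))\<^sup>2)" "(LINT x|lborel. (norm (S x))\<^sup>2) = Q"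
    unfolding S_def Q_def by (intro parseval_finite F)+
  have hS: "h x * cnj (S x) = (\<Sum>\<nu>\<in>F. cnj (hcoef h \<nu>) * (h x * of_real (hermite_vec \<nu> x)))" for x
    by (simp add: S_def sum_distrib_left cnj_sum algebra_simps)
  have ihS: "integrable lborel (\<lambda>x. h x * cnj (S x))"
    unfolding hS by (intro Bochner_Integration.integrable_sum integrable_mult_right integrable_mult_hermite_vec h(1))
  have "(LINT x|lborel. h x * cnj (S x)) = (\<Sum>\<nu>\<in>F. cnj (hcoef h \<nu>) * hcoef h \<nu>)"
    unfolding hS
    by (subst Bochner_Integration.integral_sum)
       (auto simp: hcoef_def intro!: integrable_mult_right integrable_mult_hermite_vec h(1))
  also have "\<dots> = of_real Q"
    unfolding Q_def of_real_sum complex_norm_square by (simp add: mult.commute)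
  finally have hSQ: "(LINT x|lborel. h x * cnj (S x)) = of_real Q" .
  define R where "R x = Re (h x * cnj (S x))" for x
  have R: "integrable lborel R" "integral\<^sup>L lborel R = Q"
    unfolding R_def[abs_def] using integrable_Re[OF ihS] integral_Re[OF ihS] hSQ by simp_all
  have "0 \<le> (LINT x|lborel. (norm (h x - S x))\<^sup>2)" by simp
  also have "(norm (h x - S x))\<^sup>2 = (norm (h x))\<^sup>2 - 2 * R x + (norm (S x))\<^sup>2" for x
    unfolding cmod_power2 R_def by (simp add: power2_eq_square algebra_simps)
  then have "(LINT x|lborel. (norm (h x - S x))\<^sup>2) = (LINT x|lborel. (norm (h x))\<^sup>2) - 2 * Q + Q"
    using h(2) S R by simp
  finally show ?thesis unfolding Q_def[symmetric] by simp
qed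


subsection \<open>A weak-type estimate for eigenfunctions\<close>

text \<open>The squared norm of the j-th spectral component of h. As a sequence in j it is
  nonnegative, which is what coefficient extraction on a circle wants.\<close>

definition henergy :: "(real^'n \<Rightarrow> complex) \<Rightarrow> nat \<Rightarrow> real" where
  "henergy h j = (\<Sum>\<nu>\<in>multi_indices j. (norm (hcoef h \<nu>))\<^sup>2)"

lemma henergy_nonneg: "henergy h j \<ge> 0" by (simp add: henergy_def sum_nonneg)

lemma henergy_summable:
  fixes h :: "real^'n \<Rightarrow> complex"
  assumes h: "integrable lborel h" "integrable lborel (\<lambda>x. (norm (h x))\<^sup>2)"
  shows "summable (henergy h)" "suminf (henergy h) \<le> (LINT x|lborel. (norm (h x))\<^sup>2)"
proof -
  have le: "(\<Sum>i<N. henergy h i) \<le> (LINT x|lborel. (norm (h x))\<^sup>2)" for N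
  proof -
    have "(\<Sum>i<N. henergy h i) = (\<Sum>\<nu>\<in>(\<Union>i<N. multi_indices i). (norm (hcoef h \<nu>))\<^sup>2)"
      unfolding henergy_def by (rule sum.UNION_disjoint[symmetric]) (auto dest: multi_indices_disjoint)
    also have "\<dots> \<le> (LINT x|lborel. (norm (h x))\<^sup>2)" by (rule bessel[OF h]) auto
    finally show ?thesis .
  qed
  show s: "summable (henergy h)" by (rule summableI_nonneg_bounded[OF henergy_nonneg le])
  show "suminf (henergy h) \<le> (LINT x|lborel. (norm (h x))\<^sup>2)" by (rule suminf_le_const[OF s le])
qed

text \<open>The series is the quadratic form of the Mehler kernel at h, and a bounded kernel gives
  at most its supremum times the square of the L1 norm of h.\<close>

lemma henergy_gen_bound:
  fixes h :: "real^'n \<Rightarrow> complex" and r :: complex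
  assumes h: "integrable lborel h" "integrable lborel (\<lambda>x. (norm (h x))\<^sup>2)" and r: "norm r < 1"
  shows "norm (\<Sum>i. of_real (henergy h i) * r ^ i)
     \<le> norm (1 - r\<^sup>2) powr (- real CARD('n) / 2) * (LINT x|lborel. norm (h x))\<^sup>2"
proof -
  define V where "V = (LINT x|lborel. norm (h x))"
  define B where "B = norm (1 - r\<^sup>2) powr (- real CARD('n) / 2)"
  \<comment> \<open>B bounds the limiting kernel at r and enters the result. D is the same
    expression at \<open>norm r\<close>; it bounds all partial sums through their diagonal values
    and serves only as majorant for dominated convergence.\<close>
  define D where "D = (1 - (norm r)\<^sup>2) powr (- real CARD('n) / 2)"
  have B0: "B \<ge> 0" by (simp add: B_def)
  have V0: "V \<ge> 0" by (simp add: V_def)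
  define s where "s N x y = (\<Sum>i<N. of_real (proj_kernel i x y) * r ^ i)" for N and x y :: "real^'n"
  define k where "k x y = (\<Prod>i\<in>UNIV. mehler_kernel r (x $ i) (y $ i))" for x y :: "real^'n"
  define u where "u N y = (LINT x|lborel. s N x y * h x)" for N y
  define w where "w y = (LINT x|lborel. k x y * h x)" for y
  have hm[measurable]: "h \<in> borel_measurable borel" using h(1) by simp
  have cnj_m[measurable]: "cnj \<in> borel_measurable borel"
    by (rule borel_measurable_continuous_onI[OF linear_continuous_on[OF bounded_linear_cnj]])
  have sk: "(\<lambda>N. s N x y) \<longlonglongrightarrow> k x y" for x y
    using proj_kernel_sums[OF r, of x y] by (simp add: s_def k_def sums_def)
  have kB: "norm (k x y) \<le> B" for x y
    unfolding k_def B_def by (rule norm_prod_mehler_kernel[OF r])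
  have sD: "norm (s N x y) \<le> D" for N x y
  proof -
    have sx: "(\<Sum>i<N. proj_kernel i x x * norm r ^ i) \<le> D" for x :: "real^'n"
    proof -
      have "(\<Sum>i<N. proj_kernel i x x * norm r ^ i) \<le> (\<Sum>i. proj_kernel i x x * norm r ^ i)"
        using r by (intro sum_le_suminf diag_sums(1) ballI mult_nonneg_nonneg proj_kernel_diag_nonneg) auto
      also have "\<dots> \<le> D" unfolding D_def using r by (intro diag_sums(2)) auto
      finally show ?thesis .
    qed
    have "norm (s N x y) \<le> (\<Sum>i<N. \<bar>proj_kernel i x y\<bar> * norm r ^ i)"
      unfolding s_def by (rule order_trans[OF norm_sum]) (simp add: norm_mult norm_power)
    also have "\<dots> \<le> (\<Sum>i<N. (proj_kernel i x x + proj_kernel i y y) / 2 * norm r ^ i)"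
      by (intro sum_mono mult_right_mono abs_proj_kernel_le) auto
    also have "\<dots> = ((\<Sum>i<N. proj_kernel i x x * norm r ^ i) + (\<Sum>i<N. proj_kernel i y y * norm r ^ i)) / 2"
      by (simp add: sum_divide_distrib sum.distrib[symmetric] algebra_simps add_divide_distrib)
    also have "\<dots> \<le> D" using sx[of x] sx[of y] by simp
    finally show ?thesis .
  qed
  have D0: "D \<ge> 0" by (simp add: D_def)
  have s_meas[measurable]: "(\<lambda>x. s N x y) \<in> borel_measurable borel" for N y
    unfolding s_def proj_kernel_def by measurable
  have k_meas[measurable]: "(\<lambda>x. k x y) \<in> borel_measurable borel" for y
    by (rule borel_measurable_LIMSEQ_metric[OF s_meas sk])
  have Dh: "integrable lborel (\<lambda>x. D * norm (h x))" using h(1) by simp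
  have uw: "(\<lambda>N. u N y) \<longlonglongrightarrow> w y" for y
    unfolding u_def w_def
  proof (rule integral_dominated_convergence[OF _ _ Dh])
    show "AE x in lborel. (\<lambda>N. s N x y * h x) \<longlonglongrightarrow> k x y * h x"
      by (intro AE_I2 tendsto_intros sk)
    show "AE x in lborel. norm (s N x y * h x) \<le> D * norm (h x)" for N
      by (intro AE_I2) (simp add: norm_mult mult_right_mono sD)
  qed measurable
  have u_eq: "u N y = (\<Sum>i<N. r ^ i * (\<Sum>\<nu>\<in>multi_indices i. hcoef h \<nu> * of_real (hermite_vec \<nu> y)))" for N y
  proof -
    have "s N x y * h x = (\<Sum>i<N. \<Sum>\<nu>\<in>multi_indices i. (r ^ i * of_real (hermite_vec \<nu> y)) * (h x * of_real (hermite_vec \<nu> x)))" for x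
      by (simp add: s_def proj_kernel_def sum_distrib_left sum_distrib_right algebra_simps)
    then have "u N y = (\<Sum>i<N. \<Sum>\<nu>\<in>multi_indices i. (r ^ i * of_real (hermite_vec \<nu> y)) * hcoef h \<nu>)"
      unfolding u_def hcoef_def
      by (simp add: Bochner_Integration.integral_sum integrable_mult_hermite_vec h(1))
    then show ?thesis by (simp add: sum_distrib_left algebra_simps)
  qed
  have u_meas[measurable]: "u N \<in> borel_measurable borel" for N
    unfolding u_eq[abs_def] by measurable
  have w_meas[measurable]: "w \<in> borel_measurable borel"
    by (rule borel_measurable_LIMSEQ_metric[OF u_meas uw])
  have uD: "norm (u N y) \<le> D * V" for N y
  proof -
    have "norm (u N y) \<le> (LINT x|lborel. norm (s N x y * h x))" unfolding u_def by (rule integral_norm_bound)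
    also have "\<dots> \<le> (LINT x|lborel. D * norm (h x))"
      by (rule integral_mono'[OF Dh]) (auto simp: norm_mult mult_right_mono sD D0)
    finally show ?thesis by (simp add: V_def)
  qed
  have wB: "norm (w y) \<le> B * V" for y
  proof -
    have "norm (w y) \<le> (LINT x|lborel. norm (k x y * h x))" unfolding w_def by (rule integral_norm_bound)
    also have "\<dots> \<le> (LINT x|lborel. B * norm (h x))"
      by (rule integral_mono') (use h(1) in \<open>auto simp: norm_mult mult_right_mono kB B0\<close>)
    finally show ?thesis by (simp add: V_def)
  qed
  have part: "(LINT y|lborel. cnj (h y) * u N y) = (\<Sum>i<N. of_real (henergy h i) * r ^ i)" for N
  proof -
    have cint: "integrable lborel (\<lambda>y. cnj (h y) * complex_of_real (hermite_vec \<nu> y))" for \<nu>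
      using integrable_mult_hermite_vec[of "\<lambda>y. cnj (h y)"] h(1) by simp
    have c: "(LINT y|lborel. cnj (h y) * complex_of_real (hermite_vec \<nu> y)) = cnj (hcoef h \<nu>)" for \<nu>
      unfolding hcoef_def by (subst Bochner_Integration.integral_cnj[symmetric]) simp
    have "cnj (h y) * u N y = (\<Sum>i<N. \<Sum>\<nu>\<in>multi_indices i. (r ^ i * hcoef h \<nu>) * (cnj (h y) * of_real (hermite_vec \<nu> y)))" for y
      unfolding u_eq by (simp add: sum_distrib_left algebra_simps)
    then have "(LINT y|lborel. cnj (h y) * u N y) = (\<Sum>i<N. \<Sum>\<nu>\<in>multi_indices i. (r ^ i * hcoef h \<nu>) * cnj (hcoef h \<nu>))"
      by (simp add: Bochner_Integration.integral_sum cint c)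
    also have "\<dots> = (\<Sum>i<N. of_real (henergy h i) * r ^ i)"
      by (simp add: henergy_def sum_distrib_right sum_distrib_left complex_norm_square algebra_simps del: of_real_power)
    finally show ?thesis .
  qed
  have "(\<lambda>N. LINT y|lborel. cnj (h y) * u N y) \<longlonglongrightarrow> (LINT y|lborel. cnj (h y) * w y)"
  proof (rule integral_dominated_convergence[where w = "\<lambda>y. (D * V) * norm (h y)"])
    show "AE y in lborel. (\<lambda>N. cnj (h y) * u N y) \<longlonglongrightarrow> cnj (h y) * w y"
      by (intro AE_I2 tendsto_intros uw)
    show "AE y in lborel. norm (cnj (h y) * u N y) \<le> (D * V) * norm (h y)" for N
      by (intro AE_I2) (simp add: norm_mult mult.commute[of "norm (h _)"] mult_right_mono uD)
  qed (use h(1) in auto)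
  then have "(\<Sum>i. of_real (henergy h i) * r ^ i) = (LINT y|lborel. cnj (h y) * w y)"
    unfolding part by (simp add: sums_def[symmetric] sums_iff)
  also have "norm \<dots> \<le> (LINT y|lborel. norm (cnj (h y) * w y))" by (rule integral_norm_bound)
  also have "\<dots> \<le> (LINT y|lborel. (B * V) * norm (h y))"
    by (rule integral_mono') (use h(1) in \<open>auto simp: norm_mult mult.commute[of "norm (h _)"] mult_right_mono wB B0 V0\<close>)
  also have "\<dots> = B * V\<^sup>2" by (simp add: V_def power2_eq_square)
  finally show ?thesis by (simp add: B_def V_def)
qed

text \<open>For an indicator function times a phase, the L1 norm and the squared L2 norm both equal
  the measure V of the set. Bessel bounds the generating function by V, Mehler by
  \<open>V^2 |sin \<theta>|^(-n/2)\<close>, and the mean with weight t is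
  \<open>V^(1 - t) V^(2t) = V^(1 + t)\<close>.\<close>

lemma henergy_bound:
  fixes t :: real
  assumes t: "0 \<le> t" "t \<le> 1" "t * (real CARD('n) / 2) < 1"
  obtains C where "C > 0" "\<And>(h :: real^'n \<Rightarrow> complex) V j. integrable lborel h \<Longrightarrow> integrable lborel (\<lambda>x. (norm (h x))\<^sup>2) \<Longrightarrow>
     (LINT x|lborel. (norm (h x))\<^sup>2) \<le> V \<Longrightarrow> (LINT x|lborel. norm (h x)) \<le> V \<Longrightarrow> V > 0 \<Longrightarrow> henergy h j \<le> C * V powr (1 + t)"
proof -
  define n where "n = real CARD('n)"
  have n0: "n \<ge> 0" by (simp add: n_def)
  define K where "K = (LINT \<theta>|lborel. indicator {0..2 * pi} \<theta> * \<bar>sin \<theta>\<bar> powr (- (t * (n / 2))))"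
  have K0: "K \<ge> 0" by (simp add: K_def)
  show thesis
  proof (rule that)
    show "exp 1 * (K + 1) > 0" using K0 by simp
    fix h :: "real^'n \<Rightarrow> complex" and V j
    assume h: "integrable lborel h" "integrable lborel (\<lambda>x. (norm (h x))\<^sup>2)"
      and V: "(LINT x|lborel. (norm (h x))\<^sup>2) \<le> V" "(LINT x|lborel. norm (h x)) \<le> V" "V > 0"
    define \<rho> where "\<rho> = rad j"
    note \<rho> = rad[of j, folded \<rho>_def]
    note hs = henergy_summable[OF h]
    have abs_eq: "\<bar>henergy h i\<bar> = henergy h i" for i by (simp add: henergy_nonneg)
    have "henergy h j * \<rho> ^ j \<le> V powr (1 - t) * (V\<^sup>2) powr t * K"
      unfolding K_def
    proof (rule coeff_bound_core[OF \<rho>(1,2)])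
      show "summable (\<lambda>i. \<bar>henergy h i\<bar> * \<rho> ^ i)"
        unfolding abs_eq
        by (rule summable_comparison_test'[OF hs(1), of 0])
           (use \<rho> in \<open>auto simp: henergy_nonneg mult_left_le power_le_one\<close>)
      fix \<theta> :: real
      note c = circle_norm_bounds[OF \<rho>(1,2), of \<theta>]
      have nle: "norm (complex_of_real (henergy h i) * (of_real \<rho> * cis \<theta>) ^ i) \<le> henergy h i" for i
      proof -
        have "norm (of_real \<rho> * cis \<theta>) ^ i \<le> 1" using c(3) by (intro power_le_one) auto
        then show ?thesis using mult_left_le[OF _ henergy_nonneg[of h i]] by (simp add: norm_mult norm_power henergy_nonneg)
      qed
      have "norm (\<Sum>i. complex_of_real (henergy h i) * (of_real \<rho> * cis \<theta>) ^ i) \<le> suminf (henergy h)"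
        by (rule norm_suminf_le[OF nle hs(1)])
      then show "norm (\<Sum>i. complex_of_real (henergy h i) * (of_real \<rho> * cis \<theta>) ^ i) \<le> V"
        using hs(2) V by linarith
      assume "sin \<theta> \<noteq> 0"
      then have "norm (1 - (of_real \<rho> * cis \<theta>)\<^sup>2) powr (- n / 2) \<le> \<bar>sin \<theta>\<bar> powr (- n / 2)"
        using c(1) n0 by (intro powr_mono2') auto
      moreover have "(LINT x|lborel. norm (h x))\<^sup>2 \<le> V\<^sup>2" using V by (intro power_mono) auto
      ultimately have "norm (1 - (of_real \<rho> * cis \<theta>)\<^sup>2) powr (- n / 2) * (LINT x|lborel. norm (h x))\<^sup>2 \<le> \<bar>sin \<theta>\<bar> powr (- n / 2) * V\<^sup>2"
        by (intro mult_mono) auto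
      then show "norm (\<Sum>i. complex_of_real (henergy h i) * (of_real \<rho> * cis \<theta>) ^ i) \<le> V\<^sup>2 * \<bar>sin \<theta>\<bar> powr (- (n / 2))"
        using henergy_gen_bound[OF h c(3)] by (simp add: n_def mult.commute)
    qed (use t n0 V in \<open>auto simp: n_def\<close>)
    also have "V powr (1 - t) * (V\<^sup>2) powr t = V powr (1 + t)"
    proof -
      have "(V\<^sup>2) powr t = V powr (2 * t)" using V by (simp add: powr_powr flip: powr_numeral)
      then show ?thesis by (simp add: add.commute flip: powr_add)
    qed
    finally have 1: "henergy h j * \<rho> ^ j \<le> V powr (1 + t) * K" .
    have "1 * henergy h j \<le> (exp 1 * \<rho> ^ j) * henergy h j"
      using \<rho>(4) henergy_nonneg by (intro mult_right_mono) auto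
    also have "\<dots> = exp 1 * (henergy h j * \<rho> ^ j)" by simp
    also have "\<dots> \<le> exp 1 * (V powr (1 + t) * K)" using 1 by (intro mult_left_mono) auto
    also have "\<dots> \<le> exp 1 * (V powr (1 + t) * (K + 1))" by (intro mult_left_mono) auto
    finally show "henergy h j \<le> exp 1 * (K + 1) * V powr (1 + t)" by (simp add: algebra_simps)
  qed
qed

text \<open>Let h be the phase of the eigenfunction on the set A where its modulus exceeds \<alpha>,
  and V the measure of A. The pairing of the two is at least \<open>\<alpha> V\<close>; since the
  coefficients c are normalised, its square is at most \<open>henergy h j\<close>, hence at most
  \<open>C V^(1 + t)\<close>. Dividing leaves \<open>\<alpha>^2 V^(1 - t) <= C\<close>.\<close>

lemma eigf_weak_type:
  fixes t :: real
  assumes t: "0 \<le> t" "t < 1" "t * (real CARD('n) / 2) < 1"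
  obtains W where "W > 0" "\<And>(c :: nat^'n \<Rightarrow> complex) j \<alpha>. (\<Sum>\<nu>\<in>multi_indices j. (norm (c \<nu>))\<^sup>2) = 1 \<Longrightarrow> \<alpha> > 0 \<Longrightarrow>
     emeasure lborel {x. norm (eigf c j x) > \<alpha>} \<le> ennreal (W * \<alpha> powr (- (2 / (1 - t))))"
proof -
  obtain C where C: "C > 0" "\<And>(h :: real^'n \<Rightarrow> complex) V j. integrable lborel h \<Longrightarrow> integrable lborel (\<lambda>x. (norm (h x))\<^sup>2) \<Longrightarrow>
     (LINT x|lborel. (norm (h x))\<^sup>2) \<le> V \<Longrightarrow> (LINT x|lborel. norm (h x)) \<le> V \<Longrightarrow> V > 0 \<Longrightarrow> henergy h j \<le> C * V powr (1 + t)"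
    using henergy_bound[of t] t by (metis less_imp_le)
  show thesis
  proof (rule that)
    show "C powr (1 / (1 - t)) > 0" using C(1) by simp
    fix c :: "nat^'n \<Rightarrow> complex" and j and \<alpha> :: real
    assume c1: "(\<Sum>\<nu>\<in>multi_indices j. (norm (c \<nu>))\<^sup>2) = 1" and \<alpha>: "\<alpha> > 0"
    define A where "A = {x. norm (eigf c j x) > \<alpha>}"
    have A[measurable]: "A \<in> sets borel" unfolding A_def by measurable
    have sq: "integrable lborel (\<lambda>x. (norm (eigf c j x))\<^sup>2)" by (rule parseval_eigf)
    \<comment> \<open>Chebyshev's inequality. Finite measure makes h integrable and lets V be
      divided out later.\<close>
    have Afin: "emeasure lborel A < \<infinity>"
    proof -
      have "emeasure lborel A = (\<integral>\<^sup>+x. indicator A x \<partial>lborel)" by simp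
      also have "\<dots> \<le> (\<integral>\<^sup>+x. ennreal ((norm (eigf c j x))\<^sup>2 / \<alpha>\<^sup>2) \<partial>lborel)"
      proof (rule nn_integral_mono)
        fix x
        show "indicator A x \<le> ennreal ((norm (eigf c j x))\<^sup>2 / \<alpha>\<^sup>2)"
        proof (cases "x \<in> A")
          case True
          then have "\<alpha>\<^sup>2 \<le> (norm (eigf c j x))\<^sup>2" using \<alpha> by (intro power_mono) (auto simp: A_def)
          then show ?thesis using True \<alpha> by (simp add: one_ennreal_def[symmetric] divide_simps flip: ennreal_1)
        qed simp
      qed
      also have "\<dots> < \<infinity>"
        using integrable_divide_zero[OF sq, of "\<alpha>\<^sup>2"] by (simp add: integrable_iff_bounded)
      finally show ?thesis .
    qed
    define V where "V = measure lborel A"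
    have AV: "emeasure lborel A = ennreal V" using Afin by (simp add: V_def emeasure_eq_ennreal_measure)
    show "emeasure lborel {x. norm (eigf c j x) > \<alpha>} \<le> ennreal (C powr (1 / (1 - t)) * \<alpha> powr (- (2 / (1 - t))))"
    proof (cases "V = 0")
      case True
      then show ?thesis using AV by (simp add: A_def)
    next
      case False
      then have V: "V > 0" using zero_less_measure_iff[of lborel A] by (simp add: V_def)
      define h where "h x = indicator A x *\<^sub>R sgn (eigf c j x)" for x
      have nh: "norm (h x) = indicator A x" for x
        using \<alpha> by (auto simp: h_def A_def indicator_def norm_sgn)
      have iA: "integrable lborel (indicator A :: _ \<Rightarrow> real)"
        using Afin by (simp add: integrable_indicator_iff)
      have sgn_m: "(\<lambda>x. sgn (eigf c j x)) \<in> borel_measurable borel"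
        unfolding sgn_div_norm by measurable
      have hm[measurable]: "h \<in> borel_measurable borel" unfolding h_def using sgn_m by measurable
      have h1: "integrable lborel h"
        by (rule Bochner_Integration.integrable_bound[OF iA]) (auto simp: nh)
      have nh2: "(norm (h x))\<^sup>2 = indicator A x" for x unfolding nh by (simp add: indicator_def)
      have h2: "integrable lborel (\<lambda>x. (norm (h x))\<^sup>2)" unfolding nh2 by (rule iA)
      have IV: "(LINT x|lborel. indicator A x) = V" by (simp add: V_def)
      have en: "henergy h j \<le> C * V powr (1 + t)"
      proof (rule C(2)[OF h1 h2])
        show "(LINT x|lborel. (norm (h x))\<^sup>2) \<le> V" unfolding nh2 IV by simp
        show "(LINT x|lborel. norm (h x)) \<le> V" unfolding nh IV by simp
      qed (rule V)
      have hg: "cnj (h x) * eigf c j x = of_real (indicator A x * norm (eigf c j x))" for x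
      proof -
        have "cnj (eigf c j x) * eigf c j x = of_real (norm (eigf c j x)) * of_real (norm (eigf c j x))"
          using complex_norm_square[of "eigf c j x"] by (simp add: power2_eq_square mult.commute)
        then show ?thesis
          by (simp add: h_def sgn_div_norm scaleR_conv_of_real divide_simps)
      qed
      have cint: "integrable lborel (\<lambda>y. cnj (h y) * complex_of_real (hermite_vec \<nu> y))" for \<nu>
        using integrable_mult_hermite_vec[of "\<lambda>y. cnj (h y)"] h1 by simp
      have cc: "(LINT y|lborel. cnj (h y) * complex_of_real (hermite_vec \<nu> y)) = cnj (hcoef h \<nu>)" for \<nu>
        unfolding hcoef_def by (subst Bochner_Integration.integral_cnj[symmetric]) simp
      have exp: "cnj (h x) * eigf c j x = (\<Sum>\<nu>\<in>multi_indices j. c \<nu> * (cnj (h x) * of_real (hermite_vec \<nu> x)))" for x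
        by (simp add: eigf_def sum_distrib_left algebra_simps)
      have "integrable lborel (\<lambda>x. cnj (h x) * eigf c j x)"
        unfolding exp by (intro Bochner_Integration.integrable_sum integrable_mult_right cint)
      then have ig: "integrable lborel (\<lambda>x. indicator A x * norm (eigf c j x))"
        unfolding hg by (simp only: complex_of_real_integrable_eq)
      have "(LINT x|lborel. cnj (h x) * eigf c j x) = (\<Sum>\<nu>\<in>multi_indices j. c \<nu> * cnj (hcoef h \<nu>))"
        unfolding exp by (simp add: Bochner_Integration.integral_sum cint cc)
      then have eq: "of_real (LINT x|lborel. indicator A x * norm (eigf c j x)) = (\<Sum>\<nu>\<in>multi_indices j. c \<nu> * cnj (hcoef h \<nu>))"
        unfolding hg by (simp only: integral_complex_of_real)
      have "\<alpha> * V = (LINT x|lborel. \<alpha> * indicator A x)" using IV by simp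
      also have "\<dots> \<le> (LINT x|lborel. indicator A x * norm (eigf c j x))"
        by (rule integral_mono[OF integrable_mult_right[OF iA] ig]) (auto simp: indicator_def A_def)
      also have "\<dots> \<le> norm (\<Sum>\<nu>\<in>multi_indices j. c \<nu> * cnj (hcoef h \<nu>))"
        unfolding eq[symmetric] norm_of_real by simp
      also have "\<dots> \<le> (\<Sum>\<nu>\<in>multi_indices j. norm (c \<nu>) * norm (hcoef h \<nu>))"
        by (rule order_trans[OF norm_sum]) (simp add: norm_mult)
      finally have "(\<alpha> * V)\<^sup>2 \<le> (\<Sum>\<nu>\<in>multi_indices j. norm (c \<nu>) * norm (hcoef h \<nu>))\<^sup>2"
        using \<alpha> V by (intro power_mono) auto
      also have "\<dots> \<le> 1 * henergy h j"
        unfolding henergy_def c1[symmetric] by (rule Cauchy_Schwarz_ineq_sum)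
      finally have "\<alpha>\<^sup>2 * V\<^sup>2 \<le> C * V powr (1 + t)" using en by (simp add: power_mult_distrib)
      also have "V\<^sup>2 = V powr (1 - t) * V powr (1 + t)" using V by (simp flip: powr_add powr_numeral)
      finally have "\<alpha>\<^sup>2 * V powr (1 - t) \<le> C" using V by (simp flip: mult.assoc)
      then have "V powr (1 - t) \<le> C * \<alpha> powr (- 2)"
        using \<alpha> by (simp add: powr_minus field_simps)
      then have "(V powr (1 - t)) powr (1 / (1 - t)) \<le> (C * \<alpha> powr (- 2)) powr (1 / (1 - t))"
        using t by (intro powr_mono2) auto
      then have "V \<le> C powr (1 / (1 - t)) * \<alpha> powr (- (2 / (1 - t)))"
        using V t C(1) by (simp add: powr_powr powr_mult)
      then show ?thesis using AV by (simp add: A_def ennreal_leI)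
    qed
  qed
qed


subsection \<open>From weak-type to Lebesgue norms\<close>

text \<open>Below 1 the power q is dominated by the square. The layer above \<open>2^m\<close>
  contributes at most \<open>2^((m + 1) q) W 2^(- m Q)\<close>, which grows geometrically because q
  > Q, so the layer nearest to the supremum L decides.\<close>

lemma nn_integral_powr_of_weak_type:
  fixes u :: "'a \<Rightarrow> real"
  assumes [measurable]: "u \<in> borel_measurable M" and u0: "\<And>x. 0 \<le> u x" and uL: "\<And>x. u x \<le> L" and L: "1 \<le> L"
    and sq: "(\<integral>\<^sup>+x. ennreal ((u x)\<^sup>2) \<partial>M) \<le> 1"
    and weak: "\<And>\<alpha>. \<alpha> > 0 \<Longrightarrow> emeasure M {x\<in>space M. u x > \<alpha>} \<le> ennreal (W * \<alpha> powr (- Q))"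
    and W: "W \<ge> 0" and q: "q \<ge> 2" "q > Q"
  shows "(\<integral>\<^sup>+x. ennreal (u x powr q) \<partial>M)
    \<le> ennreal ((1 + W * 2 powr q * 2 powr (q - Q) / (2 powr (q - Q) - 1)) * L powr (q - Q))"
proof -
  define z where "z = 2 powr (q - Q)"
  have z: "z > 1" using q by (simp add: z_def)
  \<comment> \<open>The least admissible exponent: minimality keeps \<open>2^M0\<close> within a
    factor two of L, so the geometric sum ends at a multiple of
    \<open>L powr (q - Q)\<close>.\<close>
  obtain M0 :: nat where M0: "L \<le> 2 ^ M0" "2 ^ M0 \<le> 2 * L"
  proof -
    have ex: "\<exists>m::nat. L \<le> 2 ^ m" using real_arch_pow[of 2 L] by (auto intro: less_imp_le)
    define m where "m = (LEAST m::nat. L \<le> 2 ^ m)"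
    have m: "L \<le> 2 ^ m" unfolding m_def by (rule LeastI_ex[OF ex])
    have "2 ^ m \<le> 2 * L"
    proof (cases m)
      case 0
      then show ?thesis using L by simp
    next
      case (Suc i)
      have "\<not> L \<le> 2 ^ i" using not_less_Least[of i "\<lambda>m. L \<le> 2 ^ m"] Suc by (simp add: m_def)
      then show ?thesis using Suc by simp
    qed
    then show ?thesis using m that by blast
  qed
  define E where "E m = {x\<in>space M. u x > 2 ^ m}" for m :: nat
  have [measurable]: "E m \<in> sets M" for m unfolding E_def by measurable
  have pt: "u x powr q \<le> (u x)\<^sup>2 + (\<Sum>m<M0. 2 powr ((real m + 1) * q) * indicator (E m) x)" if "x \<in> space M" for x
  proof (cases "u x \<le> 1")
    case True
    have "u x powr q \<le> (u x)\<^sup>2"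
    proof (cases "u x = 0")
      case False
      then have "u x > 0" using u0[of x] by simp
      then show ?thesis using powr_mono'[OF q(1), of "u x"] True by (simp add: powr_numeral)
    qed simp
    then show ?thesis by (simp add: add_increasing2 sum_nonneg)
  next
    case False
    have ex: "\<exists>m::nat. u x \<le> 2 ^ m" using uL[of x] M0(1) by (intro exI[of _ M0]) simp
    define m where "m = (LEAST m::nat. u x \<le> 2 ^ m)"
    have m: "u x \<le> 2 ^ m" unfolding m_def by (rule LeastI_ex[OF ex])
    have mM: "m \<le> M0" unfolding m_def by (rule Least_le) (use uL[of x] M0(1) in simp)
    obtain i where i: "m = Suc i" using m False by (cases m) auto
    have "\<not> u x \<le> 2 ^ i" using not_less_Least[of i "\<lambda>m. u x \<le> 2 ^ m"] i by (simp add: m_def)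
    then have xE: "x \<in> E i" using that by (simp add: E_def)
    have "u x powr q \<le> (2 ^ m) powr q" using m u0 q by (intro powr_mono2) auto
    also have "(2::real) ^ m = 2 powr (real i + 1)" by (simp add: i powr_add powr_realpow)
    also have "(2 powr (real i + 1)) powr q = 2 powr ((real i + 1) * q)" by (rule powr_powr)
    also have "\<dots> = 2 powr ((real i + 1) * q) * indicator (E i) x" using xE by simp
    also have "\<dots> \<le> (\<Sum>m<M0. 2 powr ((real m + 1) * q) * indicator (E m) x)"
      by (rule member_le_sum) (use i mM in auto)
    finally show ?thesis by (simp add: add_increasing)
  qed
  have "(\<integral>\<^sup>+x. ennreal (u x powr q) \<partial>M)
      \<le> (\<integral>\<^sup>+x. ennreal ((u x)\<^sup>2) + (\<Sum>m<M0. ennreal (2 powr ((real m + 1) * q)) * indicator (E m) x) \<partial>M)"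
  proof (rule nn_integral_mono)
    fix x assume "x \<in> space M"
    then have "ennreal (u x powr q) \<le> ennreal ((u x)\<^sup>2 + (\<Sum>m<M0. 2 powr ((real m + 1) * q) * indicator (E m) x))"
      by (intro ennreal_leI pt)
    also have "\<dots> = ennreal ((u x)\<^sup>2) + (\<Sum>m<M0. ennreal (2 powr ((real m + 1) * q)) * indicator (E m) x)"
      by (simp add: sum_nonneg ennreal_plus flip: sum_ennreal)
    finally show "ennreal (u x powr q) \<le> ennreal ((u x)\<^sup>2) + (\<Sum>m<M0. ennreal (2 powr ((real m + 1) * q)) * indicator (E m) x)" .
  qed
  also have "\<dots> = (\<integral>\<^sup>+x. ennreal ((u x)\<^sup>2) \<partial>M) + (\<Sum>m<M0. ennreal (2 powr ((real m + 1) * q)) * emeasure M (E m))"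
  proof -
    have "(\<integral>\<^sup>+x. (\<Sum>m<M0. ennreal (2 powr ((real m + 1) * q)) * indicator (E m) x) \<partial>M)
       = (\<Sum>m<M0. (\<integral>\<^sup>+x. ennreal (2 powr ((real m + 1) * q)) * indicator (E m) x \<partial>M))"
      by (rule nn_integral_sum) measurable
    also have "\<dots> = (\<Sum>m<M0. ennreal (2 powr ((real m + 1) * q)) * emeasure M (E m))"
      by (intro sum.cong refl nn_integral_cmult_indicator) measurable
    finally have "(\<integral>\<^sup>+x. (\<Sum>m<M0. ennreal (2 powr ((real m + 1) * q)) * indicator (E m) x) \<partial>M)
       = (\<Sum>m<M0. ennreal (2 powr ((real m + 1) * q)) * emeasure M (E m))" .
    moreover have "(\<lambda>x. \<Sum>m<M0. ennreal (2 powr ((real m + 1) * q)) * indicator (E m) x) \<in> borel_measurable M"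
      "(\<lambda>x. ennreal ((u x)\<^sup>2)) \<in> borel_measurable M" by measurable
    ultimately show ?thesis by (simp only: nn_integral_add)
  qed
  also have "\<dots> \<le> ennreal 1 + (\<Sum>m<M0. ennreal (W * 2 powr q * z ^ m))"
  proof (intro add_mono sum_mono)
    show "(\<integral>\<^sup>+x. ennreal ((u x)\<^sup>2) \<partial>M) \<le> ennreal 1" using sq by simp
    fix m
    have "ennreal (2 powr ((real m + 1) * q)) * emeasure M (E m) \<le> ennreal (2 powr ((real m + 1) * q)) * ennreal (W * (2 ^ m) powr (- Q))"
      unfolding E_def by (intro mult_left_mono weak) auto
    also have "\<dots> = ennreal (W * 2 powr q * z ^ m)"
    proof -
      have "2 powr ((real m + 1) * q) * (W * (2 ^ m) powr (- Q)) = W * 2 powr q * z ^ m"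
        unfolding z_def by (simp add: powr_powr algebra_simps powr_realpow[symmetric] powr_diff powr_add powr_minus divide_simps)
      moreover have "ennreal (2 powr ((real m + 1) * q)) * ennreal (W * (2 ^ m) powr (- Q))
          = ennreal (2 powr ((real m + 1) * q) * (W * (2 ^ m) powr (- Q)))"
        using W by (simp add: ennreal_mult)
      ultimately show ?thesis by (simp only:)
    qed
    finally show "ennreal (2 powr ((real m + 1) * q)) * emeasure M (E m) \<le> ennreal (W * 2 powr q * z ^ m)" .
  qed
  also have "\<dots> = ennreal (1 + (\<Sum>m<M0. W * 2 powr q * z ^ m))"
    using W z by (subst sum_ennreal) (auto simp: sum_nonneg ennreal_plus)
  also have "1 + (\<Sum>m<M0. W * 2 powr q * z ^ m) \<le> (1 + W * 2 powr q * z / (z - 1)) * L powr (q - Q)"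
  proof -
    have "(\<Sum>m<M0. z ^ m) = (z ^ M0 - 1) / (z - 1)" using z by (simp add: geometric_sum)
    also have "\<dots> \<le> z ^ M0 / (z - 1)" using z by (intro divide_right_mono) auto
    also have "z ^ M0 = (2 ^ M0) powr (q - Q)"
      unfolding z_def by (simp add: powr_powr powr_realpow[symmetric] mult.commute)
    also have "\<dots> \<le> (2 * L) powr (q - Q)" using M0(2) q by (intro powr_mono2) auto
    also have "\<dots> = z * L powr (q - Q)" using L by (simp add: powr_mult z_def)
    finally have "(\<Sum>m<M0. z ^ m) \<le> z * L powr (q - Q) / (z - 1)" using z by (simp add: divide_right_mono)
    then have "W * 2 powr q * (\<Sum>m<M0. z ^ m) \<le> W * 2 powr q * (z * L powr (q - Q) / (z - 1))"
      using W by (intro mult_left_mono) auto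
    moreover have "1 \<le> L powr (q - Q)" using L q by (simp add: ge_one_powr_ge_zero)
    moreover have "(\<Sum>m<M0. W * 2 powr q * z ^ m) = W * 2 powr q * (\<Sum>m<M0. z ^ m)"
      by (simp add: sum_distrib_left)
    moreover have "(1 + W * 2 powr q * z / (z - 1)) * L powr (q - Q) = L powr (q - Q) + W * 2 powr q * (z * L powr (q - Q) / (z - 1))"
      by (simp add: distrib_right)
    ultimately show ?thesis by linarith
  qed
  finally show ?thesis by (simp add: z_def ennreal_leI)
qed

text \<open>D bounds the square of the norm from L2 to Lq on the eigenspace, hence the power q/2. By
  duality D itself then bounds the norm of the projection from the dual exponent to q.\<close>

definition eig_bound :: "'n::finite itself \<Rightarrow> real \<Rightarrow> nat \<Rightarrow> real \<Rightarrow> bool" where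
  "eig_bound _ q j D \<longleftrightarrow> (\<forall>c :: nat^'n \<Rightarrow> complex. (\<Sum>\<nu>\<in>multi_indices j. (norm (c \<nu>))\<^sup>2) = 1 \<longrightarrow>
     (\<integral>\<^sup>+x. ennreal (norm (eigf c j x) powr q) \<partial>lborel) \<le> ennreal (D powr (q / 2)))"

lemma eig_bound_mono:
  assumes "eig_bound TYPE('n::finite) q j D" "0 \<le> D" "D \<le> D'" "q \<ge> 0"
  shows "eig_bound TYPE('n) q j D'"
  using assms unfolding eig_bound_def
  by (meson ennreal_leI order_trans powr_mono2 divide_nonneg_pos zero_less_numeral)

lemma nn_integral_eigf_sq:
  assumes "(\<Sum>\<nu>\<in>multi_indices j. (norm (c \<nu>))\<^sup>2) = 1"
  shows "(\<integral>\<^sup>+x. ennreal ((norm (eigf c j x))\<^sup>2) \<partial>lborel) = 1"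
  using nn_integral_eq_integral[OF parseval_eigf(1), of c j] parseval_eigf(2)[of c j] assms by simp

lemma norm_eigf_bound:
  assumes "(\<Sum>\<nu>\<in>multi_indices j. (norm (c \<nu>))\<^sup>2) = 1" "proj_kernel j x x \<le> P"
  shows "norm (eigf c j x) \<le> sqrt P"
  using norm_eigf_le[of c j x] assms by (simp add: real_le_rsqrt)

text \<open>Interpolation between L2 and the sup norm: all but two of the q powers of the modulus
  are estimated by \<open>sqrt P\<close>.\<close>

lemma eig_bound_sup:
  assumes P: "\<And>x::real^'n::finite. proj_kernel j x x \<le> P" and q: "q \<ge> 2" and P0: "P > 0"
  shows "eig_bound TYPE('n) q j (P powr (1 - 2 / q))"
  unfolding eig_bound_def
proof (intro allI impI)
  fix c :: "nat^'n \<Rightarrow> complex"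
  assume c: "(\<Sum>\<nu>\<in>multi_indices j. (norm (c \<nu>))\<^sup>2) = 1"
  define L where "L = sqrt P"
  have L: "L > 0" using P0 by (simp add: L_def)
  have le: "norm (eigf c j x) powr q \<le> L powr (q - 2) * (norm (eigf c j x))\<^sup>2" for x
  proof (cases "eigf c j x = 0")
    case False
    then have "norm (eigf c j x) powr q = norm (eigf c j x) powr (q - 2) * (norm (eigf c j x))\<^sup>2"
      by (simp add: powr_diff powr_numeral)
    also have "\<dots> \<le> L powr (q - 2) * (norm (eigf c j x))\<^sup>2"
      using norm_eigf_bound[OF c P] q by (intro mult_right_mono powr_mono2) (auto simp: L_def)
    finally show ?thesis .
  qed simp
  have "(\<integral>\<^sup>+x. ennreal (norm (eigf c j x) powr q) \<partial>lborel) \<le> (\<integral>\<^sup>+x. ennreal (L powr (q - 2)) * ennreal ((norm (eigf c j x))\<^sup>2) \<partial>lborel)"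
    by (intro nn_integral_mono) (simp add: le ennreal_leI flip: ennreal_mult)
  also have "\<dots> = ennreal (L powr (q - 2))"
    by (subst nn_integral_cmult) (auto simp: nn_integral_eigf_sq[OF c])
  also have "L powr (q - 2) = P powr ((q - 2) / 2)"
    using P0 by (simp add: L_def powr_half_sqrt[symmetric] powr_powr)
  also have "(q - 2) / 2 = (1 - 2 / q) * (q / 2)" using q by (simp add: field_simps)
  also have "P powr ((1 - 2 / q) * (q / 2)) = (P powr (1 - 2 / q)) powr (q / 2)" by (simp only: powr_powr)
  finally show "(\<integral>\<^sup>+x. ennreal (norm (eigf c j x) powr q) \<partial>lborel) \<le> ennreal ((P powr (1 - 2 / q)) powr (q / 2))" .
qed

text \<open>The case t = 0 of the diagonal bound. It serves the range (ii), where s > 3n/2 leaves a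
  symbol decay of more than n against the growth n/2.\<close>

lemma eig_bound_crude:
  assumes q: "q \<ge> 2"
  obtains C where "C > 0" "\<And>j. eig_bound TYPE('n::finite) q j (C * (real j + 2) powr (real CARD('n) / 2))"
proof -
  obtain C where C: "C > 0" "\<And>j (x::real^'n). proj_kernel j x x \<le> C * (real j + 2) powr (real CARD('n) / 2 * (1 - 0))"
    using proj_kernel_diag_bound[where t = 0 and 'n = 'n] by auto
  show thesis
  proof (rule that)
    \<comment> \<open>Raising the constant to at least one ensures P >= 1, so that
      \<open>P powr (1 - 2 / q)\<close> may be replaced by P.\<close>
    show "max C 1 > 0" by simp
    fix j
    define P where "P = max C 1 * (real j + 2) powr (real CARD('n) / 2)"
    have P1: "P \<ge> 1"
      using mult_mono[of 1 "max C 1" 1 "(real j + 2) powr (real CARD('n) / 2)"] by (simp add: P_def ge_one_powr_ge_zero)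
    have "proj_kernel j x x \<le> P" for x :: "real^'n"
      unfolding P_def by (rule order_trans[OF C(2)]) (simp add: mult_right_mono)
    then have "eig_bound TYPE('n) q j (P powr (1 - 2 / q))" using q P1 by (intro eig_bound_sup) auto
    moreover have "P powr (1 - 2 / q) \<le> P powr 1" using P1 q by (intro powr_mono) auto
    ultimately show "eig_bound TYPE('n) q j (max C 1 * (real j + 2) powr (real CARD('n) / 2))"
      using q P1 eig_bound_mono[of q j "P powr (1 - 2 / q)" P] by (simp add: P_def)
  qed
qed

text \<open>The weak-type exponent is Q = 2/(1 - t), and the supremum L is of order
  \<open>(j + 2)^(n (1 - t)/4)\<close>. The q-th moment is of order \<open>L^(q - Q)\<close>, and
  because Q (1 - t) = 2, taking the power 2/q leaves the exponent n (1 - t)/2 - n/q.\<close>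

lemma eig_bound_weak:
  fixes t :: real
  assumes t: "0 \<le> t" "t < 1" "t * (real CARD('n::finite) / 2) < 1" and q: "q > 2 / (1 - t)"
  obtains C where "C > 0" "\<And>j. eig_bound TYPE('n) q j (C * (real j + 2) powr (real CARD('n) / 2 * (1 - t) - real CARD('n) / q))"
proof -
  define n where "n = real CARD('n)"
  define Q where "Q = 2 / (1 - t)"
  have Q2: "Q \<ge> 2" using t by (simp add: Q_def field_simps)
  have q2: "q \<ge> 2" "q > Q" using q Q2 by (auto simp: Q_def)
  obtain C where C: "C > 0" "\<And>j (x::real^'n). proj_kernel j x x \<le> C * (real j + 2) powr (n / 2 * (1 - t))"
    unfolding n_def using proj_kernel_diag_bound[where t = t and 'n = 'n] t by (metis less_imp_le)
  obtain W where W: "W > 0" "\<And>(c :: nat^'n \<Rightarrow> complex) j \<alpha>. (\<Sum>\<nu>\<in>multi_indices j. (norm (c \<nu>))\<^sup>2) = 1 \<Longrightarrow> \<alpha> > 0 \<Longrightarrow>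
     emeasure lborel {x. norm (eigf c j x) > \<alpha>} \<le> ennreal (W * \<alpha> powr (- Q))"
    unfolding Q_def using eigf_weak_type[OF t] by metis
  define C1 where "C1 = max C 1"
  define A where "A = 1 + W * 2 powr q * 2 powr (q - Q) / (2 powr (q - Q) - 1)"
  have zz: "2 powr (q - Q) > 1" using q2 by simp
  have A1: "A > 0" unfolding A_def using W(1) zz by (intro add_pos_nonneg) auto
  define B where "B = (A * (sqrt C1) powr (q - Q)) powr (2 / q)"
  have C1: "C1 \<ge> 1" by (simp add: C1_def)
  show thesis
  proof (rule that)
    show "B > 0" using A1 C1 by (simp add: B_def)
    fix j
    define L where "L = sqrt (C1 * (real j + 2) powr (n / 2 * (1 - t)))"
    have e0: "n / 2 * (1 - t) \<ge> 0" using t by (simp add: n_def)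
    have "1 * 1 \<le> C1 * (real j + 2) powr (n / 2 * (1 - t))"
      using C1 e0 by (intro mult_mono ge_one_powr_ge_zero) auto
    then have L1: "L \<ge> 1" by (simp add: L_def)
    have pk: "proj_kernel j x x \<le> C1 * (real j + 2) powr (n / 2 * (1 - t))" for x :: "real^'n"
      by (rule order_trans[OF C(2) mult_right_mono]) (auto simp: C1_def)
    show "eig_bound TYPE('n) q j (B * (real j + 2) powr (real CARD('n) / 2 * (1 - t) - real CARD('n) / q))"
      unfolding eig_bound_def
    proof (intro allI impI)
      fix c :: "nat^'n \<Rightarrow> complex"
      assume c: "(\<Sum>\<nu>\<in>multi_indices j. (norm (c \<nu>))\<^sup>2) = 1"
      have "(\<integral>\<^sup>+x. ennreal (norm (eigf c j x) powr q) \<partial>lborel) \<le> ennreal (A * L powr (q - Q))"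
        unfolding A_def
        by (rule nn_integral_powr_of_weak_type)
           (use L1 q2 W nn_integral_eigf_sq[OF c] norm_eigf_bound[OF c pk] c in \<open>auto simp: L_def\<close>)
      also have "A * L powr (q - Q) = (B * (real j + 2) powr (n / 2 * (1 - t) - n / q)) powr (q / 2)"
      proof -
        define e where "e = n / 2 * (1 - t) - n / q"
        have f1: "L powr (q - Q) = (sqrt C1) powr (q - Q) * (real j + 2) powr (n / 4 * (1 - t) * (q - Q))"
          using C1 by (simp add: L_def real_sqrt_mult powr_mult powr_half_sqrt[symmetric] powr_powr)
        have f2: "n / 4 * (1 - t) * (q - Q) = e * (q / 2)"
        proof -
          have "Q * (1 - t) = 2" using nonzero_eq_divide_eq[of "1 - t" Q 2] t Q_def by auto
          moreover have "k * (1 - t) * (q - Q) = k * (1 - t) * q - k * (Q * (1 - t))" for k :: real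
            by algebra
          from this[of "n / 4"] have "n / 4 * (1 - t) * (q - Q) = n / 4 * (1 - t) * q - n / 4 * (Q * (1 - t))" .
          ultimately have "n / 4 * (1 - t) * (q - Q) = n / 4 * (1 - t) * q - n / 2" by simp
          moreover have "e * (q / 2) = n / 4 * (1 - t) * q - n / 2" using q2 by (simp add: e_def field_simps)
          ultimately show ?thesis by simp
        qed
        have f3: "B powr (q / 2) = A * (sqrt C1) powr (q - Q)"
        proof -
          have "2 / q * (q / 2) = 1" using q2 by simp
          then show ?thesis using A1 C1 unfolding B_def powr_powr by simp
        qed
        have "(B * (real j + 2) powr e) powr (q / 2) = B powr (q / 2) * (real j + 2) powr (e * (q / 2))"
          by (simp only: powr_mult powr_powr)
        then show ?thesis unfolding f1 f2 f3 e_def[symmetric] by simp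
      qed
      finally show "(\<integral>\<^sup>+x. ennreal (norm (eigf c j x) powr q) \<partial>lborel)
          \<le> ennreal ((B * (real j + 2) powr (real CARD('n) / 2 * (1 - t) - real CARD('n) / q)) powr (q / 2))"
        by (simp add: n_def)
    qed
  qed
qed

section \<open>Uniform bounds from an oscillatory differential equation\<close>

text \<open>The turning point is \<open>w\<^sup>3\<close>. The Sonin function \<open>f\<^sup>2 + f'\<^sup>2 / (w\<^sup>6 - x\<^sup>2)\<close> increases until
  distance about \<open>1 / w\<close> from the turning point, where \<open>f\<close> is controlled by its fourth moment.\<close>

lemma ode_sup_bound:
  fixes f f' :: "real \<Rightarrow> real"
  assumes w: "w \<ge> 1"
    and f: "\<And>x. (f has_real_derivative f' x) (at x)"
    and f': "\<And>x. (f' has_real_derivative (x\<^sup>2 - w ^ 6) * f x) (at x)"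
    and lim: "(f \<longlongrightarrow> 0) at_top"
    and int: "(\<lambda>x. f x ^ 4) integrable_on {sqrt (w ^ 6 - w\<^sup>2)..w ^ 3}"
    and I: "integral {sqrt (w ^ 6 - w\<^sup>2)..w ^ 3} (\<lambda>x. f x ^ 4) \<le> I"
    and x: "x \<ge> 0"
  shows "f x ^ 4 \<le> 2 * (exp 1 * (720 * exp 1))\<^sup>2 * w * I"
proof -
  \<comment> \<open>At xs the coefficient \<open>w^6 - x^2\<close> has dropped to
    \<open>w^2\<close>. The remaining interval up to the turning point b has length l between 1/(2w)
    and 1/w.\<close>
  define xs where "xs = sqrt (w ^ 6 - w\<^sup>2)"
  define b where "b = w ^ 3"
  define l where "l = b - xs"
  have w0: "w > 0" using w by simp
  have w26: "w\<^sup>2 \<le> w ^ 6" using w by (intro power_increasing) auto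
  have b2: "b\<^sup>2 = w ^ 6" by (simp add: b_def flip: power_mult)
  have xs2: "xs\<^sup>2 = w ^ 6 - w\<^sup>2" using w26 by (simp add: xs_def)
  have xs0: "xs \<ge> 0" using w26 by (simp add: xs_def)
  have b0: "b > 0" using w0 by (simp add: b_def)
  have "xs\<^sup>2 < b\<^sup>2" using xs2 b2 w0 by simp
  then have xsb: "xs < b" using b0 by (simp add: power2_less_imp_less)
  then have l0: "l > 0" by (simp add: l_def)
  have lw: "l * (b + xs) = w\<^sup>2" using b2 xs2 by (simp add: l_def power2_eq_square algebra_simps)
  have l_up: "w * l \<le> 1"
  proof -
    have "l * b \<le> l * (b + xs)" using l0 xs0 by (intro mult_left_mono) auto
    then have "l * w ^ 3 \<le> w\<^sup>2" using lw by (simp add: b_def)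
    then have "w\<^sup>2 * (w * l) \<le> w\<^sup>2 * 1" by (simp add: power3_eq_cube power2_eq_square algebra_simps)
    then show ?thesis using w0 by (simp add: mult_le_cancel_left)
  qed
  have l_lo: "1 / 2 \<le> w * l"
  proof -
    have "l * (b + xs) \<le> l * (2 * b)" using l0 xsb by (intro mult_left_mono) auto
    then have "w\<^sup>2 \<le> 2 * (l * w ^ 3)" using lw by (simp add: b_def)
    then have "w\<^sup>2 * (1 / 2) \<le> w\<^sup>2 * (w * l)" by (simp add: power3_eq_cube power2_eq_square algebra_simps)
    then show ?thesis using w0 by (simp only: mult_le_cancel_left) (simp add: power2_eq_square)
  qed
  \<comment> \<open>The Sonin function at xs. The first half of the proof shows that
    \<open>f^2\<close> is at most \<open>exp 1 * \<sigma>\<close> everywhere on the half-line; the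
    second half bounds \<sigma> by the fourth moment.\<close>
  define \<sigma> where "\<sigma> = (f xs)\<^sup>2 + (f' xs)\<^sup>2 / w\<^sup>2"
  have \<sigma>0: "\<sigma> \<ge> 0" by (simp add: \<sigma>_def)

  have bulk: "(f x)\<^sup>2 \<le> \<sigma>" if x: "0 \<le> x" "x \<le> xs" for x
  proof -
    let ?S = "\<lambda>x. (f x)\<^sup>2 + (f' x)\<^sup>2 / (w ^ 6 - x\<^sup>2)"
    have Qpos: "w ^ 6 - z\<^sup>2 > 0" if "0 \<le> z" "z \<le> xs" for z
    proof -
      have "z\<^sup>2 \<le> xs\<^sup>2" using that by (intro power_mono) auto
      then show ?thesis using xs2 zero_less_power[OF w0, of 2] by linarith
    qed
    have "?S x \<le> ?S xs"
    proof (rule DERIV_nonneg_imp_nondecreasing[OF x(2)])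
      fix z assume z: "x \<le> z" "z \<le> xs"
      define Q where "Q = w ^ 6 - z\<^sup>2"
      have Q: "Q > 0" unfolding Q_def using z x by (intro Qpos) auto
      have "(?S has_real_derivative (2 * f z * f' z + (2 * f' z * ((z\<^sup>2 - w ^ 6) * f z) * Q - (f' z)\<^sup>2 * (- 2 * z)) / (Q * Q))) (at z)"
        unfolding Q_def using Q by (auto intro!: derivative_eq_intros f f' simp: Q_def power2_eq_square)
      also have "2 * f z * f' z + (2 * f' z * ((z\<^sup>2 - w ^ 6) * f z) * Q - (f' z)\<^sup>2 * (- 2 * z)) / (Q * Q) = 2 * z * (f' z)\<^sup>2 / (Q * Q)"
      proof -
        have e: "z\<^sup>2 - w ^ 6 = - Q" by (simp add: Q_def)
        show ?thesis unfolding e using Q by (simp add: field_simps power2_eq_square)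
      qed
      finally have d: "(?S has_real_derivative 2 * z * (f' z)\<^sup>2 / (Q * Q)) (at z)" .
      moreover have "0 \<le> 2 * z * (f' z)\<^sup>2 / (Q * Q)" using z x Q by (intro divide_nonneg_nonneg mult_nonneg_nonneg) auto
      ultimately show "\<exists>D. (?S has_real_derivative D) (at z) \<and> 0 \<le> D" by blast
    qed
    also have "?S xs = \<sigma>" by (simp add: \<sigma>_def xs2)
    finally show ?thesis using Qpos[OF x] by (smt (verit) divide_nonneg_pos zero_le_power2)
  qed

  \<comment> \<open>Near the turning point the denominator of the Sonin function degenerates, so its
    value \<open>w^2\<close> at xs is frozen. Then G' is at most w G in modulus, and over a length
    of at most 1/w the energy G changes by no more than a factor \<open>exp 1\<close>, upwards or
    downwards.\<close>
  define G where "G x = (f' x)\<^sup>2 + w\<^sup>2 * (f x)\<^sup>2" for x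
  have dG: "(G has_real_derivative 2 * f z * f' z * (w\<^sup>2 - (w ^ 6 - z\<^sup>2))) (at z)" for z
    unfolding G_def[abs_def]
    by (auto intro!: derivative_eq_intros f f' simp: algebra_simps power2_eq_square)
  have wz: "w * (z - xs) \<le> 1" if "z \<le> b" for z
    using that w0 by (intro order_trans[OF mult_left_mono l_up]) (auto simp: l_def)
  have Gxs: "G xs = w\<^sup>2 * \<sigma>" using w0 by (simp add: G_def \<sigma>_def field_simps)
  have Gabs: "\<bar>2 * f z * f' z * (w\<^sup>2 - (w ^ 6 - z\<^sup>2))\<bar> \<le> w * G z" if z: "xs \<le> z" "z \<le> b" for z
  proof -
    have "xs\<^sup>2 \<le> z\<^sup>2" "z\<^sup>2 \<le> b\<^sup>2" using z xs0 by (auto intro!: power_mono)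
    then have Q: "\<bar>w\<^sup>2 - (w ^ 6 - z\<^sup>2)\<bar> \<le> w\<^sup>2" using xs2 b2 by auto
    have "\<bar>2 * f z * f' z * (w\<^sup>2 - (w ^ 6 - z\<^sup>2))\<bar> \<le> \<bar>2 * f z * f' z\<bar> * w\<^sup>2"
      unfolding abs_mult[of "2 * f z * f' z"] using Q by (intro mult_left_mono) auto
    also have "\<dots> = w * (2 * \<bar>f' z\<bar> * (w * \<bar>f z\<bar>))" by (simp add: abs_mult power2_eq_square)
    also have "\<dots> \<le> w * G z"
      using sum_squares_bound[of "\<bar>f' z\<bar>" "w * \<bar>f z\<bar>"] w0
      by (intro mult_left_mono) (auto simp: G_def power_mult_distrib)
    finally show ?thesis .
  qed
  have G_up: "G z \<le> exp 1 * (w\<^sup>2 * \<sigma>)" if z: "xs \<le> z" "z \<le> b" for z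
  proof -
    have "G z * exp (- w * z) \<le> G xs * exp (- w * xs)"
    proof (rule DERIV_nonpos_imp_nonincreasing[OF z(1)])
      fix y assume y: "xs \<le> y" "y \<le> z"
      have "((\<lambda>z. G z * exp (- w * z)) has_real_derivative (2 * f y * f' y * (w\<^sup>2 - (w ^ 6 - y\<^sup>2)) - w * G y) * exp (- w * y)) (at y)"
        by (auto intro!: derivative_eq_intros dG simp: algebra_simps)
      moreover have "(2 * f y * f' y * (w\<^sup>2 - (w ^ 6 - y\<^sup>2)) - w * G y) * exp (- w * y) \<le> 0"
        using Gabs[of y] y z by (intro mult_nonpos_nonneg) auto
      ultimately show "\<exists>D. ((\<lambda>z. G z * exp (- w * z)) has_real_derivative D) (at y) \<and> D \<le> 0" by blast
    qed
    then have "G z \<le> exp (w * (z - xs)) * G xs"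
      by (simp add: exp_minus exp_diff right_diff_distrib field_simps)
    also have "exp (w * (z - xs)) \<le> exp 1"
      using wz[OF z(2)] by simp
    then have "exp (w * (z - xs)) * G xs \<le> exp 1 * G xs" by (intro mult_right_mono) (auto simp: G_def)
    finally show ?thesis by (simp add: Gxs)
  qed
  have G_lo: "w\<^sup>2 * \<sigma> \<le> exp 1 * G z" if z: "xs \<le> z" "z \<le> b" for z
  proof -
    have "G xs * exp (w * xs) \<le> G z * exp (w * z)"
    proof (rule DERIV_nonneg_imp_nondecreasing[OF z(1)])
      fix y assume y: "xs \<le> y" "y \<le> z"
      have "((\<lambda>z. G z * exp (w * z)) has_real_derivative (2 * f y * f' y * (w\<^sup>2 - (w ^ 6 - y\<^sup>2)) + w * G y) * exp (w * y)) (at y)"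
        by (auto intro!: derivative_eq_intros dG simp: algebra_simps)
      moreover have "(2 * f y * f' y * (w\<^sup>2 - (w ^ 6 - y\<^sup>2)) + w * G y) * exp (w * y) \<ge> 0"
        using Gabs[of y] y z by (intro mult_nonneg_nonneg) auto
      ultimately show "\<exists>D. ((\<lambda>z. G z * exp (w * z)) has_real_derivative D) (at y) \<and> 0 \<le> D" by blast
    qed
    then have "G xs \<le> exp (w * (z - xs)) * G z"
      by (simp add: exp_minus exp_diff right_diff_distrib field_simps)
    also have "exp (w * (z - xs)) \<le> exp 1"
      using wz[OF z(2)] by simp
    then have "exp (w * (z - xs)) * G z \<le> exp 1 * G z" by (intro mult_right_mono) (auto simp: G_def)
    finally show ?thesis by (simp add: Gxs)
  qed

  have turning: "(f z)\<^sup>2 \<le> exp 1 * \<sigma>" if z: "xs \<le> z" "z \<le> b" for z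
  proof -
    have "w\<^sup>2 * (f z)\<^sup>2 \<le> G z" by (simp add: G_def)
    also have "\<dots> \<le> w\<^sup>2 * (exp 1 * \<sigma>)" using G_up[OF z] by (simp add: algebra_simps)
    finally show ?thesis using w0 by (simp add: mult_le_cancel_left)
  qed

  \<comment> \<open>Beyond the turning point \<open>f f'\<close> is nondecreasing. Were it positive
    at some point, \<open>f^2\<close> would increase from there on, against the decay at infinity;
    hence \<open>f^2\<close> is nonincreasing.\<close>
  have tail: "(f z)\<^sup>2 \<le> exp 1 * \<sigma>" if z: "b \<le> z" for z
  proof -
    have dP: "((\<lambda>x. f x * f' x) has_real_derivative ((f' y)\<^sup>2 + (y\<^sup>2 - w ^ 6) * (f y)\<^sup>2)) (at y)" for y
      by (auto intro!: derivative_eq_intros f f' simp: algebra_simps power2_eq_square)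
    have mono: "f y1 * f' y1 \<le> f y2 * f' y2" if y: "b \<le> y1" "y1 \<le> y2" for y1 y2
    proof (rule DERIV_nonneg_imp_nondecreasing[OF y(2)])
      fix y assume "y1 \<le> y" "y \<le> y2"
      then have "b\<^sup>2 \<le> y\<^sup>2" using y b0 by (intro power_mono) auto
      then have "0 \<le> (f' y)\<^sup>2 + (y\<^sup>2 - w ^ 6) * (f y)\<^sup>2" using b2 by simp
      then show "\<exists>D. ((\<lambda>x. f x * f' x) has_real_derivative D) (at y) \<and> 0 \<le> D" using dP by blast
    qed
    have d2: "((\<lambda>x. (f x)\<^sup>2) has_real_derivative 2 * (f y * f' y)) (at y)" for y
      by (auto intro!: derivative_eq_intros f)
    have neg: "f y * f' y \<le> 0" if y: "b \<le> y" for y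
    proof (rule ccontr)
      assume "\<not> f y * f' y \<le> 0"
      then have c: "f y * f' y > 0" by simp
      have inc: "(f y)\<^sup>2 \<le> (f u)\<^sup>2" if u: "y \<le> u" for u
      proof (rule DERIV_nonneg_imp_nondecreasing[OF u])
        fix v assume "y \<le> v" "v \<le> u"
        then have "0 \<le> 2 * (f v * f' v)" using mono[of y v] y c by linarith
        then show "\<exists>D. ((\<lambda>x. (f x)\<^sup>2) has_real_derivative D) (at v) \<and> 0 \<le> D" using d2 by blast
      qed
      have "((\<lambda>x. (f x)\<^sup>2) \<longlongrightarrow> 0\<^sup>2) at_top" by (intro tendsto_intros lim)
      moreover have "eventually (\<lambda>u. (f y)\<^sup>2 \<le> (f u)\<^sup>2) at_top"
        using eventually_ge_at_top[of y] by eventually_elim (rule inc)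
      ultimately have "(f y)\<^sup>2 \<le> 0\<^sup>2" by (intro tendsto_lowerbound) auto
      then show False using c by simp
    qed
    have "(f z)\<^sup>2 \<le> (f b)\<^sup>2"
    proof (rule DERIV_nonpos_imp_nonincreasing[OF z])
      fix v assume "b \<le> v" "v \<le> z"
      then have "2 * (f v * f' v) \<le> 0" using neg[of v] by linarith
      then show "\<exists>D. ((\<lambda>x. (f x)\<^sup>2) has_real_derivative D) (at v) \<and> D \<le> 0" using d2 by blast
    qed
    also have "\<dots> \<le> exp 1 * \<sigma>" using turning[of b] xsb by simp
    finally show ?thesis .
  qed

  have "(f x)\<^sup>2 \<le> exp 1 * \<sigma>"
  proof -
    have "1 * \<sigma> \<le> exp 1 * \<sigma>" using \<sigma>0 by (intro mult_right_mono) auto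
    then show ?thesis using bulk[of x] turning[of x] tail[of x] x by linarith
  qed
  then have "((f x)\<^sup>2)\<^sup>2 \<le> (exp 1 * \<sigma>)\<^sup>2" by (rule power_mono) simp
  then have fx4: "f x ^ 4 \<le> (exp 1 * \<sigma>)\<^sup>2" by simp

  \<comment> \<open>The cut-off \<open>\<eta>\<close> kills the boundary terms in \<open>\<integral> f'\<^sup>2 \<lesssim> \<integral> f\<^sup>2\<close>.\<close>
  define \<eta> where "\<eta> x = (x - xs) * (b - x)" for x
  \<comment> \<open>A lower bound for the mean of \<open>f^2\<close> over the interval. Here 720 = 4
    * 180: the factors 2, 30 and 3 in the next inequality make 180, and 4 comes from w l >=
    1/2.\<close>
  define \<kappa> where "\<kappa> = \<sigma> / (720 * exp 1)"
  have contf: "continuous_on A f" for A using f by (meson DERIV_isCont continuous_at_imp_continuous_on)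
  have int2: "(\<lambda>x. (f x)\<^sup>2) integrable_on {xs..b}"
    by (intro integrable_continuous_interval continuous_intros contf)
  \<comment> \<open>The derivative of \<open>\<eta>^2 f f'\<close> integrates to zero, and it
    dominates \<open>w^2 \<sigma> / (2 exp 1) \<eta>^2 - 3 l^2 f^2\<close>, since the energy G does
    not fall below \<open>w^2 \<sigma> / exp 1\<close>. So \<open>f^2\<close> cannot be small on
    average. The integral of \<open>\<eta>^2\<close> is \<open>l^5 / 30\<close>.\<close>
  have "w\<^sup>2 * \<sigma> / (2 * exp 1) * (l ^ 5 / 30) - 3 * l\<^sup>2 * integral {xs..b} (\<lambda>x. (f x)\<^sup>2) \<le> 0"
  proof (rule has_integral_le)
    define F where "F x = w\<^sup>2 * \<sigma> / (2 * exp 1) * (l\<^sup>2 * (x - xs) ^ 3 / 3 - l * (x - xs) ^ 4 / 2 + (x - xs) ^ 5 / 5)" for x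
    have F: "F b - F xs = w\<^sup>2 * \<sigma> / (2 * exp 1) * (l ^ 5 / 30)"
      by (simp add: F_def l_def[symmetric] power_numeral_reduce field_simps)
    have "((\<lambda>x. w\<^sup>2 * \<sigma> / (2 * exp 1) * (\<eta> x)\<^sup>2) has_integral F b - F xs) {xs..b}"
    proof (rule fundamental_theorem_of_calculus)
      fix z assume "z \<in> {xs..b}"
      have "(F has_real_derivative w\<^sup>2 * \<sigma> / (2 * exp 1) * (l\<^sup>2 * (z - xs)\<^sup>2 - 2 * l * (z - xs) ^ 3 + (z - xs) ^ 4)) (at z within {xs..b})"
        unfolding F_def by (auto intro!: derivative_eq_intros simp: field_simps)
      moreover have "l\<^sup>2 * (z - xs)\<^sup>2 - 2 * l * (z - xs) ^ 3 + (z - xs) ^ 4 = (\<eta> z)\<^sup>2"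
        unfolding \<eta>_def l_def by algebra
      ultimately show "(F has_vector_derivative w\<^sup>2 * \<sigma> / (2 * exp 1) * (\<eta> z)\<^sup>2) (at z within {xs..b})"
        by (simp only: has_real_derivative_iff_has_vector_derivative)
    qed (use xsb in simp)
    moreover have "((\<lambda>x. 3 * l\<^sup>2 * (f x)\<^sup>2) has_integral 3 * l\<^sup>2 * integral {xs..b} (\<lambda>x. (f x)\<^sup>2)) {xs..b}"
      by (intro has_integral_mult_right integrable_integral int2)
    ultimately show "((\<lambda>x. w\<^sup>2 * \<sigma> / (2 * exp 1) * (\<eta> x)\<^sup>2 - 3 * l\<^sup>2 * (f x)\<^sup>2) has_integral
        w\<^sup>2 * \<sigma> / (2 * exp 1) * (l ^ 5 / 30) - 3 * l\<^sup>2 * integral {xs..b} (\<lambda>x. (f x)\<^sup>2)) {xs..b}"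
      unfolding F by (rule has_integral_diff)
    let ?d = "\<lambda>z. 2 * \<eta> z * (b + xs - 2 * z) * (f z * f' z) + (\<eta> z)\<^sup>2 * ((f' z)\<^sup>2 + (z\<^sup>2 - w ^ 6) * (f z)\<^sup>2)"
    have "(?d has_integral (\<eta> b)\<^sup>2 * (f b * f' b) - (\<eta> xs)\<^sup>2 * (f xs * f' xs)) {xs..b}"
    proof (rule fundamental_theorem_of_calculus)
      fix z
      have "((\<lambda>z. (\<eta> z)\<^sup>2 * (f z * f' z)) has_real_derivative ?d z) (at z within {xs..b})"
        unfolding \<eta>_def by (auto intro!: derivative_eq_intros DERIV_subset[OF f] DERIV_subset[OF f'] simp: algebra_simps power2_eq_square)
      then show "((\<lambda>z. (\<eta> z)\<^sup>2 * (f z * f' z)) has_vector_derivative ?d z) (at z within {xs..b})"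
        by (simp only: has_real_derivative_iff_has_vector_derivative)
    qed (use xsb in simp)
    then show "(?d has_integral 0) {xs..b}" by (simp add: \<eta>_def)
    fix z assume z: "z \<in> {xs..b}"
    define e where "e = \<eta> z"
    define e' where "e' = b + xs - 2 * z"
    have "xs\<^sup>2 \<le> z\<^sup>2" using z xs0 by (intro power_mono) auto
    then have Q: "w ^ 6 - z\<^sup>2 \<le> w\<^sup>2" using xs2 by simp
    have e0: "0 \<le> e" unfolding e_def \<eta>_def using z by (intro mult_nonneg_nonneg) auto
    have el: "e \<le> l\<^sup>2 / 4"
    proof -
      have "l\<^sup>2 - 4 * e = e'\<^sup>2" unfolding e_def \<eta>_def e'_def l_def by algebra
      then show ?thesis using zero_le_power2[of e'] by linarith
    qed
    have e'l: "e'\<^sup>2 \<le> l\<^sup>2"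
    proof -
      have "l\<^sup>2 - e'\<^sup>2 = 4 * e" unfolding e_def \<eta>_def e'_def l_def by algebra
      then show ?thesis using e0 by linarith
    qed
    have e2: "w\<^sup>2 * e\<^sup>2 \<le> l\<^sup>2 / 16"
    proof -
      have "e\<^sup>2 \<le> (l\<^sup>2 / 4)\<^sup>2" using el e0 by (intro power_mono) auto
      then have "w\<^sup>2 * e\<^sup>2 \<le> w\<^sup>2 * (l\<^sup>2 / 4)\<^sup>2" by (intro mult_left_mono) auto
      also have "\<dots> = (w * l)\<^sup>2 * (l\<^sup>2 / 16)" by (simp add: power2_eq_square)
      also have "\<dots> \<le> 1 * (l\<^sup>2 / 16)"
        using l_up l0 w0 by (intro mult_right_mono power_le_one) auto
      finally show ?thesis by simp
    qed
    \<comment> \<open>The cross term is absorbed by half of \<open>\<eta>^2 f'^2\<close>, leaving a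
      multiple of \<open>f^2\<close> in which the derivative of \<eta> is at most l in
      modulus.\<close>
    have young: "- (e\<^sup>2 * (f' z)\<^sup>2 / 2 + 2 * e'\<^sup>2 * (f z)\<^sup>2) \<le> 2 * e * e' * (f z * f' z)"
    proof -
      have "0 \<le> (e * f' z + 2 * e' * f z)\<^sup>2" by simp
      then show ?thesis by (simp add: power2_eq_square algebra_simps)
    qed
    have "w\<^sup>2 * \<sigma> / (2 * exp 1) * e\<^sup>2 \<le> G z / 2 * e\<^sup>2"
      using G_lo[of z] z by (intro mult_right_mono) (auto simp: field_simps)
    then have "w\<^sup>2 * \<sigma> / (2 * exp 1) * e\<^sup>2 - 3 * l\<^sup>2 * (f z)\<^sup>2 \<le> G z / 2 * e\<^sup>2 - 3 * l\<^sup>2 * (f z)\<^sup>2" by simp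
    also have "\<dots> \<le> e\<^sup>2 * (f' z)\<^sup>2 / 2 - (2 * e'\<^sup>2 + w\<^sup>2 * e\<^sup>2) * (f z)\<^sup>2"
    proof -
      have "(2 * e'\<^sup>2 + 3 / 2 * (w\<^sup>2 * e\<^sup>2)) * (f z)\<^sup>2 \<le> (3 * l\<^sup>2) * (f z)\<^sup>2"
        using e2 e'l zero_le_power2[of l] by (intro mult_right_mono) (linarith | simp)+
      then show ?thesis by (simp add: G_def field_simps)
    qed
    also have "\<dots> \<le> 2 * e * e' * (f z * f' z) + e\<^sup>2 * ((f' z)\<^sup>2 + (z\<^sup>2 - w ^ 6) * (f z)\<^sup>2)"
    proof -
      have "e\<^sup>2 * ((w ^ 6 - z\<^sup>2) * (f z)\<^sup>2) \<le> e\<^sup>2 * (w\<^sup>2 * (f z)\<^sup>2)"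
        using Q by (intro mult_left_mono mult_right_mono) auto
      then show ?thesis using young by (simp add: algebra_simps)
    qed
    finally show "w\<^sup>2 * \<sigma> / (2 * exp 1) * (\<eta> z)\<^sup>2 - 3 * l\<^sup>2 * (f z)\<^sup>2 \<le> ?d z"
      by (simp add: e_def e'_def)
  qed
  then have "w\<^sup>2 * \<sigma> * l ^ 3 / (180 * exp 1) \<le> integral {xs..b} (\<lambda>x. (f x)\<^sup>2)"
    using l0 by (simp add: field_simps power_numeral_reduce)
  moreover have "\<kappa> * l \<le> w\<^sup>2 * \<sigma> * l ^ 3 / (180 * exp 1)"
  proof -
    have "(1 / 2)\<^sup>2 \<le> (w * l)\<^sup>2" using l_lo by (intro power_mono) auto
    then have "(1 / 4) * (\<sigma> * l / (180 * exp 1)) \<le> (w * l)\<^sup>2 * (\<sigma> * l / (180 * exp 1))"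
      using \<sigma>0 l0 by (intro mult_right_mono) (auto simp: power2_eq_square)
    then show ?thesis by (simp add: \<kappa>_def power_numeral_reduce power2_eq_square algebra_simps)
  qed
  ultimately have low: "\<kappa> * l \<le> integral {xs..b} (\<lambda>x. (f x)\<^sup>2)" by linarith
  \<comment> \<open>From the mean of \<open>f^2\<close> to that of \<open>f^4\<close> by the tangent
    bound \<open>y <= \<kappa>/2 + y^2/(2 \<kappa>)\<close>: taken at the known lower mean \<kappa>,
    its constant part uses up only half of \<open>\<kappa> l\<close>.\<close>
  have "\<kappa>\<^sup>2 * l \<le> I"
  proof (cases "\<kappa> = 0")
    case True
    have "0 \<le> integral {xs..b} (\<lambda>x. f x ^ 4)" by (intro integral_nonneg int[folded xs_def b_def]) auto
    then show ?thesis using I True by (simp add: xs_def b_def)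
  next
    case False
    then have k: "\<kappa> > 0" using \<sigma>0 by (simp add: \<kappa>_def)
    have "integral {xs..b} (\<lambda>x. (f x)\<^sup>2) \<le> integral {xs..b} (\<lambda>x. \<kappa> / 2 + f x ^ 4 / (2 * \<kappa>))"
    proof (rule integral_le[OF int2])
      show "(\<lambda>x. \<kappa> / 2 + f x ^ 4 / (2 * \<kappa>)) integrable_on {xs..b}"
        using k by (intro integrable_continuous_interval continuous_intros contf) auto
      fix z
      have "2 * \<kappa> * (f z)\<^sup>2 \<le> \<kappa>\<^sup>2 + ((f z)\<^sup>2)\<^sup>2" by (rule sum_squares_bound)
      moreover have e: "f z ^ 4 = ((f z)\<^sup>2)\<^sup>2" by simp
      moreover have "y \<le> \<kappa> / 2 + y\<^sup>2 / (2 * \<kappa>)" if "2 * \<kappa> * y \<le> \<kappa>\<^sup>2 + y\<^sup>2" for y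
        using that k by (simp add: field_simps power2_eq_square)
      ultimately show "(f z)\<^sup>2 \<le> \<kappa> / 2 + f z ^ 4 / (2 * \<kappa>)" by (simp only: e)
    qed
    also have "\<dots> = \<kappa> / 2 * l + integral {xs..b} (\<lambda>x. f x ^ 4) / (2 * \<kappa>)"
      using xsb by (subst integral_add) (auto simp: l_def intro!: integrable_on_divide int[folded xs_def b_def])
    also have "\<dots> \<le> \<kappa> / 2 * l + I / (2 * \<kappa>)"
      using I k by (simp add: xs_def b_def divide_right_mono)
    finally have "\<kappa> * l \<le> \<kappa> / 2 * l + I / (2 * \<kappa>)" using low by linarith
    then show ?thesis using k by (simp add: field_simps power2_eq_square)
  qed
  then have "w * (\<kappa>\<^sup>2 * l) \<le> w * I" using w0 by (intro mult_left_mono) auto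
  moreover have "\<kappa>\<^sup>2 * (1 / 2) \<le> \<kappa>\<^sup>2 * (w * l)" using l_lo by (intro mult_left_mono) auto
  ultimately have k2: "\<kappa>\<^sup>2 \<le> 2 * (w * I)" by (simp add: algebra_simps)
  define X where "X = (exp 1 * (720 * exp 1) :: real)\<^sup>2"
  have "X * \<kappa>\<^sup>2 \<le> X * (2 * (w * I))" using k2 by (intro mult_left_mono) (auto simp: X_def)
  moreover have "X * \<kappa>\<^sup>2 = (exp 1 * \<sigma>)\<^sup>2"
    by (simp add: X_def \<kappa>_def power_mult_distrib power_divide)
  moreover have "2 * X * w * I = X * (2 * (w * I))" by simp
  ultimately show ?thesis using fx4 unfolding X_def[symmetric] by linarith
qed

section \<open>The fourth moment of a Hermite function\<close>

text \<open>By strong induction: once the lower coefficients of the difference vanish, dividing by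
  \<open>x^k\<close> and letting x tend to 0 yields the next one.\<close>

lemma powser_coeffs_unique:
  fixes a b :: "nat \<Rightarrow> real"
  assumes "\<And>x. \<bar>x\<bar> < 1 \<Longrightarrow> (\<lambda>n. a n * x ^ n) sums g x" "\<And>x. \<bar>x\<bar> < 1 \<Longrightarrow> (\<lambda>n. b n * x ^ n) sums g x"
  shows "a k = b k"
proof -
  define d where "d n = a n - b n" for n
  have d: "(\<lambda>n. d n * x ^ n) sums 0" if "\<bar>x\<bar> < 1" for x
    using sums_diff[OF assms[OF that]] by (simp add: d_def algebra_simps)
  have "d k = 0"
  proof (induction k rule: less_induct)
    case (less k)
    have "((\<lambda>_. 0) \<longlongrightarrow> d (0 + k)) (at (0::real))"
    proof (rule powser_limit_0_strong[where s = 1])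
      fix x :: real assume x: "x \<noteq> 0" "norm x < 1"
      have "(\<lambda>n. d (n + k) * x ^ (n + k)) sums (0 - (\<Sum>n<k. d n * x ^ n))"
        using sums_split_initial_segment[OF d[of x], of k] x by simp
      then have "(\<lambda>n. d (n + k) * x ^ (n + k)) sums 0" using less by simp
      then have "(\<lambda>n. x ^ k * (d (n + k) * x ^ n)) sums 0" by (simp add: power_add algebra_simps)
      then show "(\<lambda>n. d (n + k) * x ^ n) sums 0"
        using sums_mult_iff[of "x ^ k" "\<lambda>n. d (n + k) * x ^ n" 0] x by simp
    qed simp
    then show ?case using tendsto_const_iff[of "at (0::real)" 0 "d k"] by (simp add: tendsto_const_iff)
  qed
  then show ?thesis by (simp add: d_def)
qed

text \<open>The Taylor coefficients of \<open>(1 - x)^(-1/2)\<close>, in other words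
  \<open>(2i choose i) / 4^i\<close>.\<close>

definition cbin :: "nat \<Rightarrow> real" where "cbin i = ((- 1 / 2) gchoose i) * (- 1) ^ i"

lemma cbin_sums:
  assumes "\<bar>x\<bar> < 1"
  shows "(\<lambda>i. cbin i * x ^ i) sums ((1 - x) powr (- 1 / 2))"
proof -
  have "((- 1 / 2) gchoose i) * (- x) ^ i = cbin i * x ^ i" for i
    by (simp add: cbin_def power_minus[of x])
  then show ?thesis using gen_binomial_real[of "- x" "- 1 / 2"] assms by simp
qed

lemma cbin_Suc: "cbin (Suc i) = cbin i * ((2 * real i + 1) / (2 * real i + 2))"
proof -
  have "((- 1 / 2 :: real) gchoose Suc i) = ((- 1 / 2) gchoose i) * ((- 1 / 2 - real i) / real (Suc i))"
    using gbinomial_mult_1'[of "- 1 / 2 :: real" i] by (simp add: field_simps)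
  then show ?thesis unfolding cbin_def by (simp only:) (simp add: field_simps)
qed

text \<open>Induction along the ratio in \<open>cbin_Suc\<close>; after squaring, the step is
  \<open>(2i + 1)^2 (i + 2) <= 4 (i + 1)^3\<close>.\<close>

lemma cbin_bounds: "0 < cbin i" "cbin i \<le> 1 / sqrt (real i + 1)"
proof -
  have "0 < cbin i \<and> cbin i \<le> 1 / sqrt (real i + 1)"
  proof (induction i)
    case (Suc i)
    have "((2 * real i + 1) / (2 * real i + 2))\<^sup>2 * (1 / (real i + 1)) \<le> 1 / (real i + 2)"
      by (simp add: divide_simps power2_eq_square) (simp add: algebra_simps)
    then have "sqrt (((2 * real i + 1) / (2 * real i + 2))\<^sup>2 * (1 / (real i + 1))) \<le> sqrt (1 / (real i + 2))"
      by (rule real_sqrt_le_mono)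
    then have A: "(2 * real i + 1) / (2 * real i + 2) * (1 / sqrt (real i + 1)) \<le> 1 / sqrt (real i + 2)"
      by (simp add: real_sqrt_mult real_sqrt_divide)
    have B: "cbin i * ((2 * real i + 1) / (2 * real i + 2)) \<le> 1 / sqrt (real i + 1) * ((2 * real i + 1) / (2 * real i + 2))"
      using Suc by (intro mult_right_mono) auto
    have "cbin (Suc i) \<le> 1 / sqrt (real i + 2)"
      unfolding cbin_Suc by (rule order_trans[OF B]) (subst mult.commute, rule A)
    then have "cbin (Suc i) \<le> 1 / sqrt (real (Suc i) + 1)" by (simp add: add.commute)
    moreover have "0 < cbin (Suc i)" unfolding cbin_Suc using Suc by (intro mult_pos_pos divide_pos_pos) auto
    ultimately show ?case by simp
  qed (simp add: cbin_def)
  then show "0 < cbin i" "cbin i \<le> 1 / sqrt (real i + 1)" by auto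
qed

text \<open>With a and b the square roots of k - i + 1 and i + 1, a term is at most
  \<open>1 / (a^2 b)\<close>, while \<open>sqrt (k + 2) = sqrt (a^2 + b^2) <= a + b\<close>. The
  product is at most \<open>1/(a b) + 1/a^2\<close>, which splits into reciprocals of
  \<open>a^2\<close> and \<open>b^2\<close>, each summing to a harmonic number.\<close>

lemma cbin_convolution_bound:
  "(\<Sum>i\<le>k. (cbin (k - i))\<^sup>2 * cbin i) \<le> 2 * harm (Suc k) / sqrt (real k + 2)"
proof -
  have term_le: "sqrt (real k + 2) * ((cbin (k - i))\<^sup>2 * cbin i)
      \<le> 3 / 2 * (1 / (real (k - i) + 1)) + 1 / 2 * (1 / (real i + 1))" if "i \<le> k" for i
  proof -
    define a where "a = sqrt (real (k - i) + 1)"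
    define b where "b = sqrt (real i + 1)"
    have a: "a > 0" "a\<^sup>2 = real (k - i) + 1" and b: "b > 0" "b\<^sup>2 = real i + 1" by (auto simp: a_def b_def)
    have "sqrt (real k + 2) = sqrt (a\<^sup>2 + b\<^sup>2)" using that by (simp add: a b of_nat_diff)
    also have "\<dots> \<le> a + b" using a b sqrt_sum_squares_le_sum[of a b] by simp
    finally have s: "sqrt (real k + 2) \<le> a + b" .
    have c: "cbin (k - i) \<le> 1 / a" "cbin i \<le> 1 / b" unfolding a_def b_def by (rule cbin_bounds)+
    have "(cbin (k - i))\<^sup>2 * cbin i \<le> (1 / a)\<^sup>2 * (1 / b)"
      using c cbin_bounds(1) by (intro mult_mono power_mono) (auto simp: less_imp_le)
    then have "sqrt (real k + 2) * ((cbin (k - i))\<^sup>2 * cbin i) \<le> (a + b) * ((1 / a)\<^sup>2 * (1 / b))"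
      by (rule mult_mono[OF s]) (use a b cbin_bounds(1)[of i] in auto)
    also have "\<dots> = (1 / a) * (1 / b) + (1 / a)\<^sup>2"
      using a(1) b(1) by (simp add: field_simps power2_eq_square)
    finally have "sqrt (real k + 2) * ((cbin (k - i))\<^sup>2 * cbin i) \<le> (1 / a) * (1 / b) + (1 / a)\<^sup>2" .
    moreover have "(1 / a) * (1 / b) \<le> ((1 / a)\<^sup>2 + (1 / b)\<^sup>2) / 2"
      using sum_squares_bound[of "1 / a" "1 / b"] by simp
    moreover have "y \<le> 3 / 2 * u + 1 / 2 * v" if "y \<le> z + u" "z \<le> (u + v) / 2" for u v y z :: real
      using that by (simp add: field_simps)
    ultimately show ?thesis unfolding power_divide a(2) b(2) power_one by blast
  qed
  have h1: "(\<Sum>i\<le>k. 1 / (real i + 1)) = harm (Suc k)"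
    unfolding harm_altdef by (simp add: lessThan_Suc_atMost inverse_eq_divide add.commute)
  have h2: "(\<Sum>i\<le>k. 1 / (real (k - i) + 1)) = harm (Suc k)"
    using sum.nat_diff_reindex[of "\<lambda>i. 1 / (real i + 1)" "Suc k"] h1
    by (simp add: lessThan_Suc_atMost)
  have "sqrt (real k + 2) * (\<Sum>i\<le>k. (cbin (k - i))\<^sup>2 * cbin i)
     \<le> (\<Sum>i\<le>k. 3 / 2 * (1 / (real (k - i) + 1)) + 1 / 2 * (1 / (real i + 1)))"
    unfolding sum_distrib_left by (intro sum_mono term_le) auto
  also have "\<dots> = 2 * harm (Suc k)"
    unfolding sum.distrib sum_distrib_left[symmetric] h1 h2 by simp
  finally show ?thesis by (simp add: field_simps)
qed

text \<open>Mehler's kernel at x = y and real r, where the exponent collapses to a multiple of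
  \<open>x^2\<close>.\<close>

definition mehler_diag :: "real \<Rightarrow> real \<Rightarrow> real" where
  "mehler_diag r x = (1 - r\<^sup>2) powr (- 1 / 2) / sqrt pi * exp (- ((1 - r) / (1 + r)) * x\<^sup>2)"

lemma mehler_diag_sums:
  assumes r: "\<bar>r\<bar> < 1"
  shows "(\<lambda>k. (hermite_fun k x)\<^sup>2 * r ^ k) sums mehler_diag r x"
proof -
  have r2: "r\<^sup>2 < 1" using r by (simp add: abs_square_less_1)
  have "mehler_kernel (of_real r) x x = of_real (mehler_diag r x)"
  proof -
    have e: "- (x\<^sup>2 + x\<^sup>2) / 2 + (2 * x * x * r - (x\<^sup>2 + x\<^sup>2) * r\<^sup>2) / (1 - r\<^sup>2) = - ((1 - r) / (1 + r)) * x\<^sup>2"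
    proof -
      have f: "1 - r\<^sup>2 = (1 - r) * (1 + r)" by algebra
      have nz: "1 - r \<noteq> 0" "1 + r \<noteq> 0" using r by auto
      have num: "2 * x * x * r - (x\<^sup>2 + x\<^sup>2) * r\<^sup>2 = (1 - r) * (2 * x\<^sup>2 * r)" by algebra
      have "(2 * x * x * r - (x\<^sup>2 + x\<^sup>2) * r\<^sup>2) / (1 - r\<^sup>2) = 2 * x\<^sup>2 * r / (1 + r)"
        unfolding num f using nz by simp
      moreover have "- (x\<^sup>2 + x\<^sup>2) / 2 + 2 * x\<^sup>2 * r / (1 + r) = - ((1 - r) / (1 + r)) * x\<^sup>2"
        using nz by (simp add: field_simps)
      ultimately show ?thesis by simp
    qed
    have p: "(1 - (complex_of_real r)\<^sup>2) powr (- 1 / 2) = of_real ((1 - r\<^sup>2) powr (- 1 / 2))"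
      using powr_of_real[of "1 - r\<^sup>2" "- 1 / 2"] r2 by simp
    have "mehler_kernel (of_real r) x x = of_real (exp (- (x\<^sup>2 + x\<^sup>2) / 2) / sqrt pi * ((1 - r\<^sup>2) powr (- 1 / 2) *
       exp ((2 * x * x * r - (x\<^sup>2 + x\<^sup>2) * r\<^sup>2) / (1 - r\<^sup>2))))"
      unfolding mehler_kernel_def mehler_gen_def p by (simp flip: exp_of_real)
    also have "exp (- (x\<^sup>2 + x\<^sup>2) / 2) / sqrt pi * ((1 - r\<^sup>2) powr (- 1 / 2) *
       exp ((2 * x * x * r - (x\<^sup>2 + x\<^sup>2) * r\<^sup>2) / (1 - r\<^sup>2))) = mehler_diag r x"
      unfolding mehler_diag_def e[symmetric] exp_add by simp
    finally show ?thesis .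
  qed
  then have "(\<lambda>k. complex_of_real ((hermite_fun k x)\<^sup>2 * r ^ k)) sums of_real (mehler_diag r x)"
    using mehler_sums[of "of_real r" x x] r by (simp add: power2_eq_square)
  then show ?thesis by (simp only: sums_of_real_iff)
qed

lemma gauss_integral:
  assumes "a > 0"
  shows "integrable lborel (\<lambda>x::real. exp (- a * x\<^sup>2))" "(LINT x|lborel. exp (- a * x\<^sup>2)) = sqrt (pi / a)"
proof -
  define s where "s = sqrt (1 / (2 * a))"
  have s: "s > 0" "s\<^sup>2 = 1 / (2 * a)" using assms by (auto simp: s_def)
  have n: "normal_density 0 s x = exp (- a * x\<^sup>2) / sqrt (pi / a)" for x
    using s assms by (simp add: normal_density_def)
  have p: "sqrt (pi / a) > 0" using assms by simp
  have e: "exp (- a * x\<^sup>2) = sqrt (pi / a) * normal_density 0 s x" for x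
    unfolding n using p assms by simp
  show "integrable lborel (\<lambda>x::real. exp (- a * x\<^sup>2))"
    unfolding e using s by (intro integrable_mult_right integrable_normal_density) auto
  show "(LINT x|lborel. exp (- a * x\<^sup>2)) = sqrt (pi / a)"
    unfolding e using s by (simp add: integral_normal_density)
qed

lemma mehler_diag_bound: "\<bar>r\<bar> < 1 \<Longrightarrow> 0 \<le> mehler_diag r x \<and> mehler_diag r x \<le> (1 - r\<^sup>2) powr (- 1 / 2) / sqrt pi"
proof
  assume r: "\<bar>r\<bar> < 1"
  show "0 \<le> mehler_diag r x" by (simp add: mehler_diag_def)
  have "exp (- ((1 - r) / (1 + r)) * x\<^sup>2) \<le> 1" using r by simp
  then have "(1 - r\<^sup>2) powr (- 1 / 2) / sqrt pi * exp (- ((1 - r) / (1 + r)) * x\<^sup>2) \<le> (1 - r\<^sup>2) powr (- 1 / 2) / sqrt pi * 1"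
    by (intro mult_left_mono) auto
  then show "mehler_diag r x \<le> (1 - r\<^sup>2) powr (- 1 / 2) / sqrt pi" by (simp add: mehler_diag_def)
qed

text \<open>For negative r the terms alternate, but the partial sums are dominated by those at
  \<open>|r|\<close>, which stay below a constant. A multiple of h is thus a majorant.\<close>

lemma mehler_diag_sums_integral:
  fixes h :: "real \<Rightarrow> real"
  assumes r: "\<bar>r\<bar> < 1" and h: "integrable lborel h" "\<And>x. 0 \<le> h x"
  shows "(\<lambda>k. (LINT x|lborel. (hermite_fun k x)\<^sup>2 * h x) * r ^ k) sums (LINT x|lborel. mehler_diag r x * h x)"
proof -
  define B where "B = (1 - \<bar>r\<bar>\<^sup>2) powr (- 1 / 2) / sqrt pi"
  have [measurable]: "h \<in> borel_measurable borel" using h by simp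
  have bound: "(\<Sum>k<N. (hermite_fun k x)\<^sup>2 * \<bar>r\<bar> ^ k) \<le> B" for N x
  proof -
    have s: "(\<lambda>k. (hermite_fun k x)\<^sup>2 * \<bar>r\<bar> ^ k) sums mehler_diag \<bar>r\<bar> x" using r by (intro mehler_diag_sums) simp
    have "(\<Sum>k<N. (hermite_fun k x)\<^sup>2 * \<bar>r\<bar> ^ k) \<le> mehler_diag \<bar>r\<bar> x"
      using sum_le_suminf[of "\<lambda>k. (hermite_fun k x)\<^sup>2 * \<bar>r\<bar> ^ k" "{..<N}"] s by (simp add: sums_iff)
    also have "\<dots> \<le> B" unfolding B_def using r mehler_diag_bound[of "\<bar>r\<bar>" x] by simp
    finally show ?thesis .
  qed
  have ih: "integrable lborel (\<lambda>x. (hermite_fun k x)\<^sup>2 * h x)" for k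
  proof -
    obtain M where M: "\<And>t. \<bar>hermite_fun k t\<bar> \<le> M" using bounded_hermite_fun by blast
    have "(hermite_fun k t)\<^sup>2 \<le> M\<^sup>2" for t using power_mono[OF M[of t], of 2] by simp
    then have "AE x in lborel. norm ((hermite_fun k x)\<^sup>2 * h x) \<le> norm (M\<^sup>2 * h x)"
      using h(2) by (intro AE_I2) (simp add: abs_mult mult_right_mono)
    then show ?thesis
      by (intro Bochner_Integration.integrable_bound[OF integrable_mult_right[OF h(1), of "M\<^sup>2"]]) auto
  qed
  have "(\<lambda>N. LINT x|lborel. (\<Sum>k<N. (hermite_fun k x)\<^sup>2 * r ^ k) * h x) \<longlonglongrightarrow> (LINT x|lborel. mehler_diag r x * h x)"
  proof (rule integral_dominated_convergence[where w = "\<lambda>x. B * h x"])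
    show "(\<lambda>x. mehler_diag r x * h x) \<in> borel_measurable lborel" unfolding mehler_diag_def by measurable
    show "AE x in lborel. (\<lambda>N. (\<Sum>k<N. (hermite_fun k x)\<^sup>2 * r ^ k) * h x) \<longlonglongrightarrow> mehler_diag r x * h x"
      using mehler_diag_sums[OF r] by (intro AE_I2 tendsto_intros) (simp add: sums_def)
    show "AE x in lborel. norm ((\<Sum>k<N. (hermite_fun k x)\<^sup>2 * r ^ k) * h x) \<le> B * h x" for N
    proof (rule AE_I2)
      fix x
      have "\<bar>\<Sum>k<N. (hermite_fun k x)\<^sup>2 * r ^ k\<bar> \<le> (\<Sum>k<N. (hermite_fun k x)\<^sup>2 * \<bar>r\<bar> ^ k)"
        by (rule order_trans[OF sum_abs]) (simp add: abs_mult power_abs)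
      also have "\<dots> \<le> B" by (rule bound)
      finally show "norm ((\<Sum>k<N. (hermite_fun k x)\<^sup>2 * r ^ k) * h x) \<le> B * h x"
        using h(2) by (simp add: abs_mult mult_right_mono)
    qed
  qed (use h in auto)
  moreover have "(LINT x|lborel. (\<Sum>k<N. (hermite_fun k x)\<^sup>2 * r ^ k) * h x) = (\<Sum>k<N. (LINT x|lborel. (hermite_fun k x)\<^sup>2 * h x) * r ^ k)" for N
  proof -
    have eq: "(\<Sum>k<N. (hermite_fun k x)\<^sup>2 * r ^ k) * h x = (\<Sum>k<N. r ^ k * ((hermite_fun k x)\<^sup>2 * h x))" for x
      unfolding sum_distrib_right by (simp add: mult_ac)
    show ?thesis unfolding eq
      by (subst Bochner_Integration.integral_sum, intro integrable_mult_right ih)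
         (simp only: integral_mult_right_zero, simp only: mult.commute)
  qed
  ultimately show ?thesis by (simp add: sums_def)
qed

text \<open>The rates of the two Gaussians add up to \<open>2 (1 - r u) / ((1 + r) (1 + u))\<close>;
  after integration the factors 1 + r and 1 + u cancel and three inverse square roots
  remain.\<close>

lemma mehler_diag_product_integral:
  assumes r: "\<bar>r\<bar> < 1" and u: "\<bar>u\<bar> < 1"
  shows "integrable lborel (mehler_diag r)"
    "(LINT x|lborel. mehler_diag r x * mehler_diag u x)
      = 1 / sqrt (2 * pi) * (1 - r) powr (- 1 / 2) * ((1 - u) powr (- 1 / 2) * (1 - r * u) powr (- 1 / 2))"
proof -
  have pos: "(1 - r) / (1 + r) > 0" "(1 - u) / (1 + u) > 0" using r u by auto
  show "integrable lborel (mehler_diag r)"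
    unfolding mehler_diag_def[abs_def] by (intro integrable_mult_right gauss_integral pos)
  define a where "a = (1 - r) / (1 + r) + (1 - u) / (1 + u)"
  have a: "a > 0" using pos by (simp add: a_def)
  have "\<bar>r * u\<bar> < 1" using r u abs_mult_less[of r 1 u 1] by (simp add: abs_mult)
  then have ru: "1 - r * u > 0" by linarith
  have d: "1 - r > 0" "1 + r > 0" "1 - u > 0" "1 + u > 0" using r u by auto
  have aeq: "a = 2 * (1 - r * u) / ((1 + r) * (1 + u))"
    using d by (simp add: a_def field_simps)
  have r2: "1 - r\<^sup>2 = (1 - r) * (1 + r)" "1 - u\<^sup>2 = (1 - u) * (1 + u)" by algebra+
  have inv: "z powr (- 1 / 2) = 1 / sqrt z" if "z > 0" for z :: real
    using that by (simp add: powr_minus_divide powr_half_sqrt)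
  have pr: "mehler_diag r x * mehler_diag u x = (1 - r\<^sup>2) powr (- 1 / 2) * (1 - u\<^sup>2) powr (- 1 / 2) / pi * exp (- a * x\<^sup>2)" for x
    by (simp add: mehler_diag_def a_def exp_add[symmetric] algebra_simps flip: exp_add)
  have "(LINT x|lborel. mehler_diag r x * mehler_diag u x) = (1 - r\<^sup>2) powr (- 1 / 2) * (1 - u\<^sup>2) powr (- 1 / 2) / pi * sqrt (pi / a)"
    unfolding pr using gauss_integral(2)[OF a] by simp
  also have "\<dots> = 1 / sqrt (2 * pi) * (1 - r) powr (- 1 / 2) * ((1 - u) powr (- 1 / 2) * (1 - r * u) powr (- 1 / 2))"
  proof -
    have g: "1 / (A * B) * (1 / (C * D)) / p * (P * (B * D) / (T * E)) = 1 / (T * P) * (1 / A) * ((1 / C) * (1 / E))"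
      if "A > 0" "B > 0" "C > 0" "D > 0" "P > 0" "T > 0" "E > 0" "p = P * P" for A B C D P T E p :: real
      using that by (simp add: field_simps)
    have sa: "sqrt (pi / a) = sqrt pi * (sqrt (1 + r) * sqrt (1 + u)) / (sqrt 2 * sqrt (1 - r * u))"
      unfolding aeq by (simp only: real_sqrt_divide real_sqrt_mult divide_divide_eq_right)
    have p1: "(1 - r\<^sup>2) powr (- 1 / 2) = 1 / (sqrt (1 - r) * sqrt (1 + r))"
      "(1 - u\<^sup>2) powr (- 1 / 2) = 1 / (sqrt (1 - u) * sqrt (1 + u))"
      unfolding r2 using inv[OF mult_pos_pos[OF d(1,2)]] inv[OF mult_pos_pos[OF d(3,4)]]
      by (simp_all only: real_sqrt_mult)
    show ?thesis
      unfolding p1 sa inv[OF d(1)] inv[OF d(3)] inv[OF ru] real_sqrt_mult[of 2 pi]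
      by (rule g; use d ru in simp)
  qed
  finally show "(LINT x|lborel. mehler_diag r x * mehler_diag u x)
      = 1 / sqrt (2 * pi) * (1 - r) powr (- 1 / 2) * ((1 - u) powr (- 1 / 2) * (1 - r * u) powr (- 1 / 2))" .
qed

lemma integrable_hermite_fun_sq: "integrable lborel (\<lambda>x. (hermite_fun k x)\<^sup>2)"
  using integrable_hermite_fun_mult[of k k] by (simp add: power2_eq_square)

lemma cbin_summable: "\<bar>x\<bar> < 1 \<Longrightarrow> summable (\<lambda>i. norm (cbin i * x ^ i))"
proof -
  assume x: "\<bar>x\<bar> < 1"
  have "summable (\<lambda>i. cbin i * \<bar>x\<bar> ^ i)" using cbin_sums[of "\<bar>x\<bar>"] x by (auto simp: sums_iff)
  moreover have "norm (cbin i * x ^ i) = cbin i * \<bar>x\<bar> ^ i" for i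
    using cbin_bounds(1)[of i] by (simp add: abs_mult power_abs)
  ultimately show ?thesis by simp
qed

text \<open>The moment is the coefficient of \<open>r^k u^k\<close> in
  \<open>((1 - r) (1 - u) (1 - r u))^(-1/2) / sqrt (2 pi)\<close>: the mixed factor supplies the
  power i of both variables and the other two supply k - i each. The coefficients are extracted
  first in u and then in r, so uniqueness in one variable suffices.\<close>

lemma hermite_fourth_moment:
  "(LINT x|lborel. hermite_fun k x ^ 4) = 1 / sqrt (2 * pi) * (\<Sum>i\<le>k. (cbin (k - i))\<^sup>2 * cbin i)"
proof -
  define M where "M i j = (LINT x|lborel. (hermite_fun i x)\<^sup>2 * (hermite_fun j x)\<^sup>2)" for i j
  define A where "A r l = (LINT x|lborel. mehler_diag r x * (hermite_fun l x)\<^sup>2)" for r l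
  have A1: "(\<lambda>i. M i l * r ^ i) sums A r l" if "\<bar>r\<bar> < 1" for r l
    unfolding M_def A_def by (rule mehler_diag_sums_integral[OF that integrable_hermite_fun_sq]) simp
  have A2: "A r l = 1 / sqrt (2 * pi) * (1 - r) powr (- 1 / 2) * (\<Sum>i\<le>l. cbin (l - i) * cbin i * r ^ i)" if r: "\<bar>r\<bar> < 1" for r l
  proof (rule powser_coeffs_unique)
    fix u :: real assume u: "\<bar>u\<bar> < 1"
    show "(\<lambda>l. A r l * u ^ l) sums (LINT x|lborel. mehler_diag u x * mehler_diag r x)"
      unfolding A_def using mehler_diag_sums_integral[OF u mehler_diag_product_integral(1)[OF r r]] mehler_diag_bound[OF r]
      by (simp add: mult.commute)
    have ru: "\<bar>r * u\<bar> < 1" using r u abs_mult_less[of r 1 u 1] by (simp add: abs_mult)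
    have "(\<lambda>l. \<Sum>i\<le>l. (cbin i * (r * u) ^ i) * (cbin (l - i) * u ^ (l - i))) sums
        ((\<Sum>i. cbin i * (r * u) ^ i) * (\<Sum>i. cbin i * u ^ i))"
      by (rule Cauchy_product_sums[OF cbin_summable[OF ru] cbin_summable[OF u]])
    moreover have "(\<Sum>i. cbin i * (r * u) ^ i) = (1 - r * u) powr (- 1 / 2)" "(\<Sum>i. cbin i * u ^ i) = (1 - u) powr (- 1 / 2)"
      using cbin_sums[OF ru] cbin_sums[OF u] by (simp_all add: sums_iff)
    moreover have "(\<Sum>i\<le>l. (cbin i * (r * u) ^ i) * (cbin (l - i) * u ^ (l - i))) = (\<Sum>i\<le>l. cbin (l - i) * cbin i * r ^ i) * u ^ l" for l
      unfolding sum_distrib_right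
    proof (rule sum.cong[OF refl])
      fix i assume "i \<in> {..l}"
      then have "u ^ l = u ^ i * u ^ (l - i)" by (simp flip: power_add)
      then show "(cbin i * (r * u) ^ i) * (cbin (l - i) * u ^ (l - i)) = cbin (l - i) * cbin i * r ^ i * u ^ l"
        by (simp add: power_mult_distrib)
    qed
    ultimately have "(\<lambda>l. (\<Sum>i\<le>l. cbin (l - i) * cbin i * r ^ i) * u ^ l) sums ((1 - r * u) powr (- 1 / 2) * (1 - u) powr (- 1 / 2))"
      by simp
    from sums_mult[OF this, of "1 / sqrt (2 * pi) * (1 - r) powr (- 1 / 2)"]
    show "(\<lambda>l. 1 / sqrt (2 * pi) * (1 - r) powr (- 1 / 2) * (\<Sum>i\<le>l. cbin (l - i) * cbin i * r ^ i) * u ^ l) sums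
        (LINT x|lborel. mehler_diag u x * mehler_diag r x)"
      using mehler_diag_product_integral(2)[OF r u] by (simp add: mult_ac)
  qed
  have "M k k = 1 / sqrt (2 * pi) * (\<Sum>i\<le>k. cbin (k - i) * cbin i * cbin (k - i))"
  proof -
    \<comment> \<open>The polynomial in r left over from the first extraction, continued by zero so
      that it can enter a Cauchy product.\<close>
    define d where "d i = (if i \<le> k then cbin (k - i) * cbin i else 0)" for i
    have "M k k = 1 / sqrt (2 * pi) * (\<Sum>i\<le>k. d i * cbin (k - i))"
    proof (rule powser_coeffs_unique[where a = "\<lambda>i. M i k" and b = "\<lambda>j. 1 / sqrt (2 * pi) * (\<Sum>i\<le>j. d i * cbin (j - i))"])
      fix r :: real assume r: "\<bar>r\<bar> < 1"
      show "(\<lambda>i. M i k * r ^ i) sums A r k" by (rule A1[OF r])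
      have dsum: "summable (\<lambda>i. norm (d i * r ^ i))"
        by (rule summable_finite[of "{..k}"]) (auto simp: d_def)
      have "(\<lambda>j. \<Sum>i\<le>j. (d i * r ^ i) * (cbin (j - i) * r ^ (j - i))) sums
        ((\<Sum>i. d i * r ^ i) * (\<Sum>i. cbin i * r ^ i))"
        by (rule Cauchy_product_sums[OF dsum cbin_summable[OF r]])
      moreover have "(\<Sum>i. d i * r ^ i) = (\<Sum>i\<le>k. cbin (k - i) * cbin i * r ^ i)"
        by (subst suminf_finite[of "{..k}"]) (auto simp: d_def)
      moreover have "(\<Sum>i. cbin i * r ^ i) = (1 - r) powr (- 1 / 2)"
        using cbin_sums[OF r] by (simp add: sums_iff)
      moreover have "(\<Sum>i\<le>j. (d i * r ^ i) * (cbin (j - i) * r ^ (j - i))) = (\<Sum>i\<le>j. d i * cbin (j - i)) * r ^ j" for j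
        unfolding sum_distrib_right
      proof (rule sum.cong[OF refl])
        fix i assume "i \<in> {..j}"
        then have "r ^ j = r ^ i * r ^ (j - i)" by (simp flip: power_add)
        then show "(d i * r ^ i) * (cbin (j - i) * r ^ (j - i)) = d i * cbin (j - i) * r ^ j" by simp
      qed
      ultimately have "(\<lambda>j. (\<Sum>i\<le>j. d i * cbin (j - i)) * r ^ j) sums ((\<Sum>i\<le>k. cbin (k - i) * cbin i * r ^ i) * (1 - r) powr (- 1 / 2))"
        by simp
      from sums_mult[OF this, of "1 / sqrt (2 * pi)"]
      show "(\<lambda>j. 1 / sqrt (2 * pi) * (\<Sum>i\<le>j. d i * cbin (j - i)) * r ^ j) sums A r k"
        unfolding A2[OF r] by (simp add: mult_ac)
    qed
    then show ?thesis by (simp add: d_def)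
  qed
  moreover have "hermite_fun k x ^ 4 = (hermite_fun k x)\<^sup>2 * (hermite_fun k x)\<^sup>2" for x
    by (simp flip: power_add)
  ultimately show ?thesis by (simp add: M_def power2_eq_square mult_ac)
qed

section \<open>Lebesgue norms of Hermite functions of one variable\<close>

text \<open>Trades the logarithm in the fourth moment for an arbitrarily small power.\<close>

lemma harm_le_powr:
  assumes "\<epsilon> > 0"
  shows "harm (Suc k) \<le> (1 + 1 / \<epsilon>) * (real k + 2) powr \<epsilon>"
proof -
  have "harm (Suc k) - ln (real (Suc k)) \<le> harm (Suc 0) - ln (real (Suc 0))"
    using decseq_harm_diff_ln[THEN decseqD, of 0 k] by simp
  then have "harm (Suc k) \<le> 1 + ln (real k + 1)" by (simp add: harm_expand add.commute)
  also have "ln (real k + 1) \<le> (real k + 1) powr \<epsilon> / \<epsilon>" using assms by (intro ln_powr_bound) auto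
  also have "(real k + 1) powr \<epsilon> \<le> (real k + 2) powr \<epsilon>" using assms by (intro powr_mono2) auto
  finally have "harm (Suc k) \<le> 1 + (real k + 2) powr \<epsilon> / \<epsilon>" using assms by (simp add: divide_right_mono)
  moreover have "1 \<le> (real k + 2) powr \<epsilon>" using assms by (intro ge_one_powr_ge_zero) auto
  ultimately show ?thesis by (simp add: distrib_right)
qed

lemma integrable_hermite_fun_pow4: "integrable lborel (\<lambda>x. hermite_fun k x ^ 4)"
proof -
  obtain M where M: "\<And>t. \<bar>hermite_fun k t\<bar> \<le> M" using bounded_hermite_fun by blast
  have "AE x in lborel. norm (hermite_fun k x ^ 4) \<le> norm (M\<^sup>2 * (hermite_fun k x)\<^sup>2)"
  proof (rule AE_I2)
    fix t
    have "(hermite_fun k t)\<^sup>2 \<le> M\<^sup>2" using power_mono[OF M[of t], of 2] by simp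
    then have "(hermite_fun k t)\<^sup>2 * (hermite_fun k t)\<^sup>2 \<le> M\<^sup>2 * (hermite_fun k t)\<^sup>2" by (intro mult_right_mono) auto
    then show "norm (hermite_fun k t ^ 4) \<le> norm (M\<^sup>2 * (hermite_fun k t)\<^sup>2)" by (simp flip: power_add)
  qed
  then show ?thesis
    by (intro Bochner_Integration.integrable_bound[OF integrable_mult_right[OF integrable_hermite_fun_sq, of "M\<^sup>2" k]]) auto
qed

lemma hermite_fourth_moment_bound:
  assumes "\<epsilon> > 0"
  shows "(LINT x|lborel. hermite_fun k x ^ 4) \<le> 2 * (1 + 1 / \<epsilon>) * (real k + 2) powr (\<epsilon> - 1 / 2)"
proof -
  have "1 \<le> sqrt (2 * pi)" using pi_ge_two by simp
  then have "1 / sqrt (2 * pi) \<le> 1" by simp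
  then have "(LINT x|lborel. hermite_fun k x ^ 4) \<le> 1 * (\<Sum>i\<le>k. (cbin (k - i))\<^sup>2 * cbin i)"
    unfolding hermite_fourth_moment
    by (intro mult_right_mono sum_nonneg) (auto simp: cbin_bounds(1) less_imp_le)
  also have "\<dots> \<le> 2 * harm (Suc k) / sqrt (real k + 2)" using cbin_convolution_bound by simp
  also have "\<dots> \<le> 2 * ((1 + 1 / \<epsilon>) * (real k + 2) powr \<epsilon>) / sqrt (real k + 2)"
    by (intro divide_right_mono mult_left_mono harm_le_powr assms) auto
  also have "\<dots> = 2 * (1 + 1 / \<epsilon>) * (real k + 2) powr (\<epsilon> - 1 / 2)"
    by (simp add: powr_diff powr_half_sqrt)
  finally show ?thesis .
qed

lemma ode_sup_bound_lborel:
  fixes f f' :: "real \<Rightarrow> real"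
  assumes w: "w \<ge> 1"
    and f: "\<And>x. (f has_real_derivative f' x) (at x)"
    and f': "\<And>x. (f' has_real_derivative (x\<^sup>2 - w ^ 6) * f x) (at x)"
    and lim: "(f \<longlongrightarrow> 0) at_top" and int: "integrable lborel (\<lambda>x. f x ^ 4)" and x: "x \<ge> 0"
  shows "f x ^ 4 \<le> 2 * (exp 1 * (720 * exp 1))\<^sup>2 * w * (LINT x|lborel. f x ^ 4)"
proof (rule ode_sup_bound[OF w f f' lim _ _ x])
  let ?A = "{sqrt (w ^ 6 - w\<^sup>2)..w ^ 3}"
  have set: "set_integrable lborel ?A (\<lambda>x. f x ^ 4)"
    unfolding set_integrable_def using int by (intro integrable_mult_indicator) auto
  show "(\<lambda>x. f x ^ 4) integrable_on ?A" by (rule set_borel_integral_eq_integral(1)[OF set])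
  have "integral ?A (\<lambda>x. f x ^ 4) = (LINT x:?A|lborel. f x ^ 4)" by (rule set_borel_integral_eq_integral(2)[OF set, symmetric])
  also have "\<dots> \<le> (LINT x|lborel. f x ^ 4)"
    unfolding set_lebesgue_integral_def
    by (rule integral_mono[OF set[unfolded set_integrable_def] int]) (auto simp: indicator_def)
  finally show "integral ?A (\<lambda>x. f x ^ 4) \<le> (LINT x|lborel. f x ^ 4)" .
qed

lemma hermite_fun_tendsto_bot: "((\<lambda>x. hermite_fun k (- x)) \<longlongrightarrow> 0) at_top"
proof -
  have "(hermite_fun k \<longlongrightarrow> 0) at_bot"
    using poly_gauss_tendsto(2)[of "smult (hc k) (hermp k)"] by (simp add: hermite_fun_eq[abs_def])
  then show ?thesis by (simp add: filterlim_at_bot_mirror)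
qed

text \<open>The Hermite equation has the form required by the bound for the differential equation
  when \<open>w^6\<close> is the eigenvalue 2k + 1. Negative x are reached through the reflected
  function, which solves the same equation and has the same fourth moment.\<close>

lemma hermite_fun_pow4_bound:
  "hermite_fun k x ^ 4 \<le> 2 * (exp 1 * (720 * exp 1))\<^sup>2 * (2 * real k + 1) powr (1 / 6) * (LINT x|lborel. hermite_fun k x ^ 4)"
proof -
  define w where "w = (2 * real k + 1) powr (1 / 6)"
  have w1: "w \<ge> 1" unfolding w_def by (rule ge_one_powr_ge_zero) auto
  have w6: "w ^ 6 = real (2 * k + 1)" by (simp add: w_def powr_power)
  show ?thesis
  proof (cases "x \<ge> 0")
    case True
    have "hermite_fun k x ^ 4 \<le> 2 * (exp 1 * (720 * exp 1))\<^sup>2 * w * (LINT x|lborel. hermite_fun k x ^ 4)"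
      by (rule ode_sup_bound_lborel[where f' = "hermite_fun' k", OF w1 DERIV_hermite_fun _ hermite_fun_tendsto integrable_hermite_fun_pow4 True])
         (unfold w6, rule DERIV_hermite_fun')
    then show ?thesis by (simp add: w_def)
  next
    case False
    have int: "integrable lborel (\<lambda>x. hermite_fun k (0 + (-1) * x) ^ 4)"
      by (rule lborel_integrable_real_affine[OF integrable_hermite_fun_pow4]) simp
    have eq: "(LINT x|lborel. hermite_fun k (- x) ^ 4) = (LINT x|lborel. hermite_fun k x ^ 4)"
      using lborel_integral_real_affine[of "-1" "\<lambda>x. hermite_fun k x ^ 4" 0] by simp
    have "hermite_fun k (- (- x)) ^ 4 \<le> 2 * (exp 1 * (720 * exp 1))\<^sup>2 * w * (LINT x|lborel. hermite_fun k (- x) ^ 4)"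
    proof (rule ode_sup_bound_lborel[where f = "\<lambda>x. hermite_fun k (- x)" and f' = "\<lambda>x. - hermite_fun' k (- x)"])
      fix y
      show "((\<lambda>x. hermite_fun k (- x)) has_real_derivative - hermite_fun' k (- y)) (at y)"
        using DERIV_chain2[OF DERIV_hermite_fun DERIV_minus[OF DERIV_ident], of k y UNIV] by simp
      have "((\<lambda>x. - hermite_fun' k (- x)) has_real_derivative - (((- y)\<^sup>2 - real (2 * k + 1)) * hermite_fun k (- y) * (- 1))) (at y)"
        by (intro DERIV_minus DERIV_chain2[OF DERIV_hermite_fun']) (auto intro!: derivative_eq_intros)
      then show "((\<lambda>x. - hermite_fun' k (- x)) has_real_derivative (y\<^sup>2 - w ^ 6) * hermite_fun k (- y)) (at y)"
        unfolding w6 by simp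
    qed (use w1 False int hermite_fun_tendsto_bot in auto)
    then show ?thesis by (simp add: w_def eq)
  qed
qed

text \<open>The factor of order \<open>k^(1/6)\<close> from the turning point times a fourth moment
  of order \<open>k^(-1/2)\<close> leaves \<open>k^(-1/3)\<close> for the fourth power. The square
  root halves the loss, so the moment is used with 2 \<epsilon>.\<close>

lemma hermite_fun_sup_bound:
  assumes "\<epsilon> > 0"
  obtains C where "C > 0" "\<And>k x. (hermite_fun k x)\<^sup>2 \<le> C * (real k + 2) powr (\<epsilon> - 1 / 6)"
proof -
  define X where "X = 2 * (exp 1 * (720 * exp 1 :: real))\<^sup>2"
  define B where "B = X * 2 * (2 * (1 + 1 / (2 * \<epsilon>)))"
  have X: "X > 0" by (simp add: X_def)
  have B: "B > 0" unfolding B_def using X assms by (intro mult_pos_pos add_pos_pos) auto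
  show thesis
  proof (rule that)
    show "sqrt B > 0" using B by simp
    fix k x
    define N where "N = real k + 2"
    have N: "N \<ge> 1" by (simp add: N_def)
    have w: "(2 * real k + 1) powr (1 / 6) \<le> 2 * N powr (1 / 6)"
    proof -
      have "(2 * real k + 1) powr (1 / 6) \<le> (2 * N) powr (1 / 6)" by (intro powr_mono2) (auto simp: N_def)
      also have "\<dots> = 2 powr (1 / 6) * N powr (1 / 6)" using N by (simp add: powr_mult)
      also have "\<dots> \<le> 2 powr 1 * N powr (1 / 6)" by (intro mult_right_mono powr_mono) auto
      finally show ?thesis by simp
    qed
    have I: "(LINT x|lborel. hermite_fun k x ^ 4) \<le> 2 * (1 + 1 / (2 * \<epsilon>)) * N powr (2 * \<epsilon> - 1 / 2)"
      unfolding N_def using hermite_fourth_moment_bound[of "2 * \<epsilon>" k] assms by simp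
    have "hermite_fun k x ^ 4 \<le> X * (2 * real k + 1) powr (1 / 6) * (LINT x|lborel. hermite_fun k x ^ 4)"
      unfolding X_def by (rule hermite_fun_pow4_bound)
    also have "\<dots> \<le> X * (2 * N powr (1 / 6)) * (2 * (1 + 1 / (2 * \<epsilon>)) * N powr (2 * \<epsilon> - 1 / 2))"
      using X by (intro mult_mono mult_left_mono w I) auto
    also have "\<dots> = B * (N powr (1 / 6) * N powr (2 * \<epsilon> - 1 / 2))" by (simp add: B_def)
    also have "N powr (1 / 6) * N powr (2 * \<epsilon> - 1 / 2) = (N powr (\<epsilon> - 1 / 6))\<^sup>2"
      using N by (simp add: power2_eq_square flip: powr_add)
    finally have "((hermite_fun k x)\<^sup>2)\<^sup>2 \<le> (sqrt B * N powr (\<epsilon> - 1 / 6))\<^sup>2"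
      using B by (simp add: power_mult_distrib)
    then show "(hermite_fun k x)\<^sup>2 \<le> sqrt B * (real k + 2) powr (\<epsilon> - 1 / 6)"
      unfolding N_def by (rule power2_le_imp_le) (use B in simp)
  qed
qed

text \<open>The decay exponent of the squared Lq norm. It is piecewise linear in 1/q, with the
  values 0 at q = 2, 1/4 at q = 4 and 1/6 in the limit of infinite q.\<close>

definition hermite_exponent :: "real \<Rightarrow> real" where
  "hermite_exponent q = (if q \<le> 4 then (1 / 2) * (1 - 2 / q) else 1 / 6 + 1 / (3 * q))"

lemma integrable_hermite_fun_powr:
  assumes q: "q \<ge> 2"
  shows "integrable lborel (\<lambda>x. \<bar>hermite_fun k x\<bar> powr q)"
proof -
  obtain M where M: "\<And>t. \<bar>hermite_fun k t\<bar> \<le> M" using bounded_hermite_fun by blast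
  have le: "\<bar>hermite_fun k x\<bar> powr q \<le> M powr (q - 2) * (hermite_fun k x)\<^sup>2" for x
  proof (cases "hermite_fun k x = 0")
    case False
    then have "\<bar>hermite_fun k x\<bar> powr q = \<bar>hermite_fun k x\<bar> powr (q - 2) * (hermite_fun k x)\<^sup>2"
      by (simp add: powr_diff powr_numeral)
    also have "\<dots> \<le> M powr (q - 2) * (hermite_fun k x)\<^sup>2" using M q by (intro mult_right_mono powr_mono2) auto
    finally show ?thesis .
  qed simp
  show ?thesis
    by (rule Bochner_Integration.integrable_bound[OF integrable_mult_right[OF integrable_hermite_fun_sq, of "M powr (q - 2)" k]])
       (use le in auto)
qed

text \<open>Up to q = 4 the interpolation is between the second and the fourth moment, beyond it
  between the fourth moment and the sup norm; hence the break at 4.\<close>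

lemma hermite_fun_Lq_bound:
  assumes q: "q \<ge> 2" and \<epsilon>: "\<epsilon> > 0"
  obtains C where "C > 0"
    "\<And>k. (LINT x|lborel. \<bar>hermite_fun k x\<bar> powr q) \<le> (C * (real k + 2) powr (\<epsilon> - hermite_exponent q)) powr (q / 2)"
proof -
  define C1 where "C1 = 2 * (1 + 1 / \<epsilon>)"
  have C1: "C1 > 0" unfolding C1_def using \<epsilon> by (intro mult_pos_pos add_pos_pos) auto
  have m4: "(LINT x|lborel. hermite_fun k x ^ 4) \<le> C1 * (real k + 2) powr (\<epsilon> - 1 / 2)" for k
    unfolding C1_def by (rule hermite_fourth_moment_bound[OF \<epsilon>])
  have p4: "\<bar>y\<bar> powr q = \<bar>y\<bar> powr (q - 4) * y ^ 4" if "y \<noteq> 0" for y :: real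
    using that by (simp add: powr_diff powr_numeral)
  have p2: "\<bar>y\<bar> powr q = \<bar>y\<bar> powr (q - 2) * y\<^sup>2" if "y \<noteq> 0" for y :: real
    using that by (simp add: powr_diff powr_numeral)
  show thesis
  proof (cases "q \<le> 4")
    case True
    show thesis
    proof (rule that)
      show "1 + C1 > 0" using C1 by simp
      fix k
      define N where "N = real k + 2"
      have N: "N \<ge> 1" by (simp add: N_def)
      \<comment> \<open>The level that balances the two moments: apart from the loss, both
        \<open>\<alpha>^(q - 2)\<close> and \<open>\<alpha>^(q - 4) N^(-1/2)\<close> equal
        \<open>N^(-(q - 2)/4)\<close>.\<close>
      define \<alpha> where "\<alpha> = N powr (- 1 / 4)"
      have \<alpha>: "\<alpha> > 0" using N by (simp add: \<alpha>_def)
      have pt: "\<bar>y\<bar> powr q \<le> \<alpha> powr (q - 2) * y\<^sup>2 + \<alpha> powr (q - 4) * y ^ 4" for y :: real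
      proof (cases "y = 0")
        case False
        show ?thesis
        proof (cases "\<bar>y\<bar> \<le> \<alpha>")
          case True
          have "\<bar>y\<bar> powr q \<le> \<alpha> powr (q - 2) * y\<^sup>2"
            unfolding p2[OF False] using True q by (intro mult_right_mono powr_mono2) auto
          then show ?thesis by (simp add: add_increasing2)
        next
          case f: False
          have "\<bar>y\<bar> powr q \<le> \<alpha> powr (q - 4) * y ^ 4"
            unfolding p4[OF False] using f \<open>q \<le> 4\<close> \<alpha> by (intro mult_right_mono powr_mono2') auto
          then show ?thesis by (simp add: add_increasing)
        qed
      qed (use q in simp)
      have "(LINT x|lborel. \<bar>hermite_fun k x\<bar> powr q)
          \<le> (LINT x|lborel. \<alpha> powr (q - 2) * (hermite_fun k x)\<^sup>2 + \<alpha> powr (q - 4) * hermite_fun k x ^ 4)"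
        by (intro integral_mono integrable_hermite_fun_powr q Bochner_Integration.integrable_add integrable_mult_right
            integrable_hermite_fun_sq integrable_hermite_fun_pow4 pt)
      also have "\<dots> = \<alpha> powr (q - 2) + \<alpha> powr (q - 4) * (LINT x|lborel. hermite_fun k x ^ 4)"
        using hermite_fun_orthonormal[of k k] integrable_hermite_fun_sq[of k] integrable_hermite_fun_pow4[of k]
        by (simp add: power2_eq_square)
      also have "\<dots> \<le> \<alpha> powr (q - 2) + \<alpha> powr (q - 4) * (C1 * N powr (\<epsilon> - 1 / 2))"
        using m4[of k] by (intro add_left_mono mult_left_mono) (auto simp: N_def)
      also have "\<alpha> powr (q - 2) = N powr (- (q - 2) / 4)"
      proof -
        have "- 1 / 4 * y = - y / 4" for y :: real by simp
        from this[of "q - 2"] have "- 1 / 4 * (q - 2) = - (q - 2) / 4" .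
        then show ?thesis by (simp only: \<alpha>_def powr_powr)
      qed
      also have "\<alpha> powr (q - 4) * (C1 * N powr (\<epsilon> - 1 / 2)) = C1 * N powr (\<epsilon> - (q - 2) / 4)"
      proof -
        have "\<alpha> powr (q - 4) * N powr (\<epsilon> - 1 / 2) = N powr ((- 1 / 4) * (q - 4) + (\<epsilon> - 1 / 2))"
          by (simp only: \<alpha>_def powr_powr powr_add)
        also have "(- 1 / 4) * (q - 4) + (\<epsilon> - 1 / 2) = \<epsilon> - (q - 2) / 4" by (simp add: field_simps)
        finally show ?thesis by simp
      qed
      also have "N powr (- (q - 2) / 4) + C1 * N powr (\<epsilon> - (q - 2) / 4) \<le> (1 + C1) * N powr (\<epsilon> * (q / 2) - (q - 2) / 4)"
      proof -
        have e2: "\<epsilon> \<le> \<epsilon> * (q / 2)" using \<epsilon> q by (simp add: mult_le_cancel_left1)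
        have "N powr (- (q - 2) / 4) \<le> N powr (\<epsilon> * (q / 2) - (q - 2) / 4)"
        proof (rule powr_mono[OF _ N])
          have "- y / 4 \<le> z - y / 4" if "0 \<le> z" for y z :: real using that by simp
          from this[of "\<epsilon> * (q / 2)" "q - 2"] show "- (q - 2) / 4 \<le> \<epsilon> * (q / 2) - (q - 2) / 4"
            using \<epsilon> q by (meson divide_nonneg_pos less_imp_le mult_nonneg_nonneg order_trans zero_le_numeral zero_less_numeral)
        qed
        moreover have "C1 * N powr (\<epsilon> - (q - 2) / 4) \<le> C1 * N powr (\<epsilon> * (q / 2) - (q - 2) / 4)"
          using N e2 C1 by (intro mult_left_mono powr_mono) auto
        ultimately show ?thesis by (simp add: distrib_right)
      qed
      also have "\<dots> \<le> (1 + C1) powr (q / 2) * N powr (\<epsilon> * (q / 2) - (q - 2) / 4)"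
      proof -
        have "(1 + C1) powr 1 \<le> (1 + C1) powr (q / 2)" using C1 q by (intro powr_mono) auto
        then show ?thesis using C1 by (intro mult_right_mono) auto
      qed
      also have "\<dots> = ((1 + C1) * N powr (\<epsilon> - hermite_exponent q)) powr (q / 2)"
      proof -
        have e: "(\<epsilon> - hermite_exponent q) * (q / 2) = \<epsilon> * (q / 2) - (q - 2) / 4"
          using True q by (simp add: hermite_exponent_def field_simps)
        show ?thesis by (simp only: powr_mult powr_powr e)
      qed
      finally show "(LINT x|lborel. \<bar>hermite_fun k x\<bar> powr q) \<le> ((1 + C1) * (real k + 2) powr (\<epsilon> - hermite_exponent q)) powr (q / 2)"
        by (simp add: N_def)
    qed
  next
    case False
    obtain C2 where C2: "C2 > 0" "\<And>k x. (hermite_fun k x)\<^sup>2 \<le> C2 * (real k + 2) powr (\<epsilon> - 1 / 6)"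
      using hermite_fun_sup_bound[OF \<epsilon>] by metis
    define C where "C = max 1 (max C1 C2)"
    have C: "C \<ge> 1" "C1 \<le> C" "C2 \<le> C" by (auto simp: C_def)
    show thesis
    proof (rule that)
      show "C > 0" using C by simp
      fix k
      define N where "N = real k + 2"
      have N: "N \<ge> 1" by (simp add: N_def)
      define s where "s = (C * N powr (\<epsilon> - 1 / 6)) powr ((q - 4) / 2)"
      have pt: "\<bar>hermite_fun k x\<bar> powr q \<le> s * hermite_fun k x ^ 4" for x
      proof (cases "hermite_fun k x = 0")
        case f: False
        have "(hermite_fun k x)\<^sup>2 \<le> C * N powr (\<epsilon> - 1 / 6)"
          unfolding N_def by (rule order_trans[OF C2(2) mult_right_mono]) (use C in auto)
        then have "((hermite_fun k x)\<^sup>2) powr ((q - 4) / 2) \<le> s"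
          unfolding s_def using False by (intro powr_mono2) auto
        moreover have "((hermite_fun k x)\<^sup>2) powr ((q - 4) / 2) = \<bar>hermite_fun k x\<bar> powr (q - 4)"
        proof -
          have "(hermite_fun k x)\<^sup>2 = \<bar>hermite_fun k x\<bar> powr 2" using f by (simp add: powr_numeral)
          moreover have "2 * ((q - 4) / 2) = q - 4" 
            using nonzero_mult_div_cancel_left[of 2 "q - 4"] unfolding times_divide_eq_right by simp
          ultimately show ?thesis by (simp only: powr_powr)
        qed
        ultimately show ?thesis unfolding p4[OF f] by (intro mult_right_mono) auto
      qed (use q in simp)
      have "(LINT x|lborel. \<bar>hermite_fun k x\<bar> powr q) \<le> (LINT x|lborel. s * hermite_fun k x ^ 4)"
        by (intro integral_mono integrable_hermite_fun_powr q integrable_mult_right integrable_hermite_fun_pow4 pt)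
      also have "\<dots> = s * (LINT x|lborel. hermite_fun k x ^ 4)" by simp
      also have "\<dots> \<le> s * (C * N powr (\<epsilon> - 1 / 2))"
      proof (rule mult_left_mono)
        have "(LINT x|lborel. hermite_fun k x ^ 4) \<le> C1 * N powr (\<epsilon> - 1 / 2)" using m4[of k] by (simp add: N_def)
        also have "\<dots> \<le> C * N powr (\<epsilon> - 1 / 2)" using C by (intro mult_right_mono) auto
        finally show "(LINT x|lborel. hermite_fun k x ^ 4) \<le> C * N powr (\<epsilon> - 1 / 2)" .
      qed (simp add: s_def)
      also have "\<dots> = C powr (q / 2 - 1) * N powr (\<epsilon> * (q / 2 - 1) - hermite_exponent q * (q / 2))"
      proof -
        have s: "s = C powr ((q - 4) / 2) * N powr ((\<epsilon> - 1 / 6) * ((q - 4) / 2))"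
          using C by (simp add: s_def powr_mult powr_powr)
        have e1: "(\<epsilon> - 1 / 6) * ((q - 4) / 2) + (\<epsilon> - 1 / 2) = \<epsilon> * (q / 2 - 1) - hermite_exponent q * (q / 2)"
          using False q by (simp add: hermite_exponent_def field_simps)
        have e2: "(q - 4) / 2 + 1 = q / 2 - 1" by (simp add: field_simps)
        have "s * (C * N powr (\<epsilon> - 1 / 2)) = (C powr ((q - 4) / 2) * C powr 1) * (N powr ((\<epsilon> - 1 / 6) * ((q - 4) / 2)) * N powr (\<epsilon> - 1 / 2))"
          using C by (simp add: s)
        also have "\<dots> = C powr ((q - 4) / 2 + 1) * N powr ((\<epsilon> - 1 / 6) * ((q - 4) / 2) + (\<epsilon> - 1 / 2))"
          by (simp only: powr_add)
        finally show ?thesis unfolding e1 e2 .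
      qed
      also have "\<dots> \<le> C powr (q / 2) * N powr (\<epsilon> * (q / 2) - hermite_exponent q * (q / 2))"
        using C N \<epsilon> by (intro mult_mono powr_mono diff_right_mono mult_left_mono) auto
      also have "\<dots> = (C * N powr (\<epsilon> - hermite_exponent q)) powr (q / 2)"
        by (simp only: powr_mult powr_powr left_diff_distrib)
      finally show "(LINT x|lborel. \<bar>hermite_fun k x\<bar> powr q) \<le> (C * (real k + 2) powr (\<epsilon> - hermite_exponent q)) powr (q / 2)"
        by (simp add: N_def)
    qed
  qed
qed

text \<open>In one variable an eigenspace is spanned by a single Hermite function, so a normalised
  coefficient vector is a unimodular constant and drops out of the modulus.\<close>

lemma eig_bound_one:
  assumes card: "CARD('n::finite) = 1" and q: "q \<ge> 2" and \<epsilon>: "\<epsilon> > 0"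
  obtains C where "C > 0" "\<And>j. eig_bound TYPE('n) q j (C * (real j + 2) powr (\<epsilon> - hermite_exponent q))"
proof -
  obtain C where C: "C > 0"
    "\<And>k. (LINT x|lborel. \<bar>hermite_fun k x\<bar> powr q) \<le> (C * (real k + 2) powr (\<epsilon> - hermite_exponent q)) powr (q / 2)"
    using hermite_fun_Lq_bound[OF q \<epsilon>] by metis
  obtain i0 :: 'n where i0: "UNIV = {i0}" using card by (metis card_1_singletonE)
  show thesis
  proof (rule that[OF C(1)])
    fix j
    show "eig_bound TYPE('n) q j (C * (real j + 2) powr (\<epsilon> - hermite_exponent q))"
      unfolding eig_bound_def
    proof (intro allI impI)
      fix c :: "nat^'n \<Rightarrow> complex"
      assume c: "(\<Sum>\<nu>\<in>multi_indices j. (norm (c \<nu>))\<^sup>2) = 1"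
      define \<nu>0 :: "nat^'n" where "\<nu>0 = (\<chi> i. j)"
      have i0': "i = i0" for i using i0 by auto
      have mi: "multi_indices j = {\<nu>0}"
      proof (intro set_eqI iffI)
        fix \<nu> :: "nat^'n" assume "\<nu> \<in> multi_indices j"
        then have "\<nu> $ i0 = j" by (simp add: multi_indices_def i0)
        then have "\<nu> $ i = j" for i by (subst i0'[of i])
        then show "\<nu> \<in> {\<nu>0}" by (simp add: vec_eq_iff \<nu>0_def)
      qed (simp add: multi_indices_def i0 \<nu>0_def)
      have "norm (c \<nu>0) = 1" using c by (simp add: mi abs_square_eq_1)
      then have eq: "norm (eigf c j x) powr q = (\<Prod>i\<in>UNIV. \<bar>hermite_fun j (x $ i)\<bar> powr q)" for x
        by (simp add: eigf_def mi hermite_vec_def i0 norm_mult \<nu>0_def)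
      note ic = integral_prod_components[where 'n = 'n, of "\<lambda>_ x. \<bar>hermite_fun j x\<bar> powr q", OF integrable_hermite_fun_powr[OF q]]
      have "(\<integral>\<^sup>+x. ennreal (norm (eigf c j x) powr q) \<partial>lborel) = ennreal (LINT x|lborel. \<bar>hermite_fun j x\<bar> powr q)"
        unfolding eq using nn_integral_eq_integral[OF ic(1)] ic(2) by (simp add: prod_nonneg card)
      also have "\<dots> \<le> ennreal ((C * (real j + 2) powr (\<epsilon> - hermite_exponent q)) powr (q / 2))"
        by (rule ennreal_leI[OF C(2)])
      finally show "(\<integral>\<^sup>+x. ennreal (norm (eigf c j x) powr q) \<partial>lborel)
         \<le> ennreal ((C * (real j + 2) powr (\<epsilon> - hermite_exponent q)) powr (q / 2))" .
    qed
  qed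
qed

section \<open>Pointwise decay of the symbol\<close>

lemma fourier_lborel:
  assumes "continuous_on UNIV g"
  shows "fourier g t = (LINT \<xi>|lborel. exp (- 2 * of_real pi * \<i> * of_real t * of_real \<xi>) * g \<xi>)"
  unfolding fourier_def
  by (rule integral_completion) (use assms in \<open>auto intro!: borel_measurable_continuous_onI continuous_intros\<close>)

text \<open>Fourier inversion is only needed as a bound, so it suffices to test \<open>g\<close> against Gaussian
  approximations of the point mass, whose Fourier transforms are bounded by one.\<close>

lemma gauss_average_le:
  fixes g :: "real \<Rightarrow> complex"
  assumes g: "continuous_on UNIV g" "integrable lborel g"
    and F: "integrable lborel (fourier g)" and \<sigma>: "\<sigma> > 0"
  shows "norm (LINT z|lborel. std_normal_density z *\<^sub>R g (a + \<sigma> * z)) \<le> (LINT t|lborel. norm (fourier g t))"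
proof -
  let ?n = std_normal_density
  let ?e = "\<lambda>t \<xi>. exp (- 2 * of_real pi * \<i> * of_real t * of_real \<xi>) :: complex"
  have [measurable]: "g \<in> borel_measurable borel" using g(1) by (rule borel_measurable_continuous_onI)
  have char: "(LINT z|lborel. ?n z *\<^sub>R exp (\<i> * of_real (u * z))) = of_real (exp (- u\<^sup>2 / 2))" for u
  proof -
    have "char std_normal_distribution u = (LINT z|lborel. ?n z *\<^sub>R exp (\<i> * of_real (u * z)))"
      unfolding char_def by (subst integral_density) auto
    then show ?thesis by (simp add: char_std_normal_distribution)
  qed
  \<comment> \<open>Fourier inversion for the Gaussian alone: its transform is known as a
    characteristic function, and rescaling by 2 pi gives it back.\<close>
  have inv: "of_real (?n v) = (LINT t|lborel. of_real (exp (- (2 * pi * t)\<^sup>2 / 2)) * exp (\<i> * of_real (2 * pi * t * v)))"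
    for v :: real
  proof -
    have "(LINT t|lborel. ?n t *\<^sub>R exp (\<i> * of_real (v * t)))
       = \<bar>2 * pi\<bar> *\<^sub>R (LINT t|lborel. ?n (0 + 2 * pi * t) *\<^sub>R exp (\<i> * of_real (v * (0 + 2 * pi * t))))"
      by (rule lborel_integral_real_affine) simp
    also have "\<dots> = \<bar>2 * pi\<bar> *\<^sub>R ((1 / sqrt (2 * pi)) *\<^sub>R
        (LINT t|lborel. of_real (exp (- (2 * pi * t)\<^sup>2 / 2)) * exp (\<i> * of_real (2 * pi * t * v))))"
      unfolding integral_scaleR_right[symmetric]
      by (simp add: std_normal_density_def scaleR_conv_of_real algebra_simps)
    finally have "of_real (exp (- v\<^sup>2 / 2)) = (of_real (2 * pi / sqrt (2 * pi)) :: complex) *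
        (LINT t|lborel. of_real (exp (- (2 * pi * t)\<^sup>2 / 2)) * exp (\<i> * of_real (2 * pi * t * v)))"
      unfolding char by (simp add: scaleR_conv_of_real)
    moreover have "2 * pi / sqrt (2 * pi) = sqrt (2 * pi)" by (simp add: real_div_sqrt)
    ultimately have *: "of_real (exp (- v\<^sup>2 / 2)) = (of_real (sqrt (2 * pi)) :: complex) *
        (LINT t|lborel. of_real (exp (- (2 * pi * t)\<^sup>2 / 2)) * exp (\<i> * of_real (2 * pi * t * v)))"
      by (simp only:)
    have "of_real (?n v) = (1 / of_real (sqrt (2 * pi)) :: complex) * of_real (exp (- v\<^sup>2 / 2))"
      by (simp add: std_normal_density_def)
    also have "\<dots> = (LINT t|lborel. of_real (exp (- (2 * pi * t)\<^sup>2 / 2)) * exp (\<i> * of_real (2 * pi * t * v)))"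
      unfolding * by simp
    finally show ?thesis .
  qed
  have gi: "integrable lborel (\<lambda>t. exp (- (2 * pi * \<sigma> * t)\<^sup>2 / 2))"
  proof -
    have "integrable lborel (\<lambda>t. sqrt (2 * pi) * ?n (0 + (2 * pi * \<sigma>) * t))"
      by (intro integrable_mult_right lborel_integrable_real_affine integrable_normal_density) (use \<sigma> in auto)
    then show ?thesis by (simp add: std_normal_density_def)
  qed
  let ?G = "\<lambda>t. exp (- (2 * pi * \<sigma> * t)\<^sup>2 / 2)"
  \<comment> \<open>The approximate point mass of width \<sigma> at a as a superposition of
    exponentials with weights \<open>?G t\<close>, which never exceed one.\<close>
  have kern: "of_real (?n ((\<xi> - a) / \<sigma>) / \<sigma>) = (LINT t|lborel. of_real (?G t) * exp (2 * of_real pi * \<i> * of_real t * of_real (a - \<xi>)))" for \<xi>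
  proof -
    have "of_real (?n ((\<xi> - a) / \<sigma>)) = (complex_of_real (?n ((a - \<xi>) / \<sigma>)))"
      by (simp add: std_normal_density_def power_divide power2_commute)
    also have "\<dots> = \<bar>\<sigma>\<bar> *\<^sub>R (LINT t|lborel. of_real (exp (- (2 * pi * (0 + \<sigma> * t))\<^sup>2 / 2)) * exp (\<i> * of_real (2 * pi * (0 + \<sigma> * t) * ((a - \<xi>) / \<sigma>))))"
      unfolding inv by (rule lborel_integral_real_affine) (use \<sigma> in simp)
    also have "\<dots> = of_real \<sigma> * (LINT t|lborel. of_real (?G t) * exp (2 * of_real pi * \<i> * of_real t * of_real (a - \<xi>)))"
      using \<sigma> by (simp add: scaleR_conv_of_real algebra_simps diff_divide_distrib)
    finally show ?thesis using \<sigma> by simp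
  qed
  \<comment> \<open>For fixed \<sigma> the Gaussian factor makes the double integral absolutely
    convergent, so the order of integration may be exchanged.\<close>
  have pint: "integrable (lborel \<Otimes>\<^sub>M lborel) (\<lambda>(\<xi>, t). of_real (?G t) * exp (2 * of_real pi * \<i> * of_real t * of_real (a - \<xi>)) * g \<xi>)"
  proof (rule Bochner_Integration.integrable_bound)
    show "integrable (lborel \<Otimes>\<^sub>M lborel) (\<lambda>(\<xi>, t). ?G t * norm (g \<xi>))"
      by (rule lborel_pair.Fubini_integrable) (use g(2) gi in \<open>auto simp: abs_mult\<close>)
  qed (auto simp: norm_mult)
  have "(LINT z|lborel. ?n z *\<^sub>R g (a + \<sigma> * z)) = (LINT \<xi>|lborel. of_real (?n ((\<xi> - a) / \<sigma>) / \<sigma>) * g \<xi>)"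
  proof -
    have "(LINT \<xi>|lborel. of_real (?n ((\<xi> - a) / \<sigma>) / \<sigma>) * g \<xi>)
       = \<bar>\<sigma>\<bar> *\<^sub>R (LINT z|lborel. of_real (?n ((a + \<sigma> * z - a) / \<sigma>) / \<sigma>) * g (a + \<sigma> * z))"
      by (rule lborel_integral_real_affine) (use \<sigma> in simp)
    also have "\<dots> = (LINT z|lborel. ?n z *\<^sub>R g (a + \<sigma> * z))"
      unfolding integral_scaleR_right[symmetric] using \<sigma> by (simp add: scaleR_conv_of_real)
    finally show ?thesis by simp
  qed
  also have "\<dots> = (LINT \<xi>|lborel. (LINT t|lborel. of_real (?G t) * exp (2 * of_real pi * \<i> * of_real t * of_real (a - \<xi>)) * g \<xi>))"
    unfolding kern by simp
  also have "\<dots> = (LINT t|lborel. (LINT \<xi>|lborel. of_real (?G t) * exp (2 * of_real pi * \<i> * of_real t * of_real (a - \<xi>)) * g \<xi>))"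
    using lborel_pair.Fubini_integral[OF pint] by simp
  also have "\<dots> = (LINT t|lborel. of_real (?G t) * exp (2 * of_real pi * \<i> * of_real t * of_real a) * fourier g t)"
  proof -
    have "of_real (?G t) * exp (2 * of_real pi * \<i> * of_real t * of_real (a - \<xi>)) * g \<xi>
      = (of_real (?G t) * exp (2 * of_real pi * \<i> * of_real t * of_real a)) * (?e t \<xi> * g \<xi>)" for t \<xi>
    proof -
      have "exp (2 * of_real pi * \<i> * of_real t * of_real (a - \<xi>)) = exp (2 * of_real pi * \<i> * of_real t * of_real a) * ?e t \<xi>"
        by (simp add: algebra_simps flip: exp_add)
      then show ?thesis by (simp only: mult.assoc)
    qed
    then show ?thesis unfolding fourier_lborel[OF g(1)] by (simp only: integral_mult_right_zero)
  qed
  also have "norm \<dots> \<le> (LINT t|lborel. norm (fourier g t))"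
  proof (rule order_trans[OF integral_norm_bound])
    show "(LINT t|lborel. norm (of_real (?G t) * exp (2 * of_real pi * \<i> * of_real t * of_real a) * fourier g t)) \<le> (LINT t|lborel. norm (fourier g t))"
    proof (rule integral_mono')
      show "integrable lborel (\<lambda>t. norm (fourier g t))" using F by simp
      show "norm (of_real (?G t) * exp (2 * of_real pi * \<i> * of_real t * of_real a) * fourier g t) \<le> norm (fourier g t)" for t
      proof -
        have "?G t \<le> 1" by simp
        then show ?thesis by (simp add: norm_mult mult_left_le_one_le)
      qed
    qed simp
  qed
  finally show ?thesis .
qed

text \<open>The averages over widths 1/(k + 1) tend to the value at a by continuity and boundedness,
  while their bound does not depend on the width.\<close>

lemma sup_le_fourier:
  fixes g :: "real \<Rightarrow> complex"
  assumes g: "continuous_on UNIV g" "integrable lborel g" "\<And>x. norm (g x) \<le> B"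
    and F: "integrable lborel (fourier g)"
  shows "norm (g a) \<le> (LINT t|lborel. norm (fourier g t))"
proof -
  let ?n = std_normal_density
  have [measurable]: "g \<in> borel_measurable borel" using g(1) by (rule borel_measurable_continuous_onI)
  have "(\<lambda>k. LINT z|lborel. ?n z *\<^sub>R g (a + (1 / real (Suc k)) * z)) \<longlonglongrightarrow> (LINT z|lborel. ?n z *\<^sub>R g a)"
  proof (rule integral_dominated_convergence[where w = "\<lambda>z. ?n z * B"])
    show "integrable lborel (\<lambda>z. ?n z * B)" by (intro integrable_mult_left integrable_normal_density) simp
    show "AE z in lborel. (\<lambda>k. ?n z *\<^sub>R g (a + (1 / real (Suc k)) * z)) \<longlonglongrightarrow> ?n z *\<^sub>R g a"
    proof (rule AE_I2)
      fix z
      have "(\<lambda>k. a + (1 / real (Suc k)) * z) \<longlonglongrightarrow> a + 0 * z"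
        by (intro tendsto_intros LIMSEQ_inverse_real_of_nat[unfolded inverse_eq_divide])
      moreover have "isCont g a" using g(1) by (simp add: continuous_on_eq_continuous_at)
      ultimately show "(\<lambda>k. ?n z *\<^sub>R g (a + (1 / real (Suc k)) * z)) \<longlonglongrightarrow> ?n z *\<^sub>R g a"
        by (intro tendsto_scaleR tendsto_const isCont_tendsto_compose[of a g]) simp_all
    qed
  qed (auto intro!: mult_left_mono g(3))
  moreover have "(LINT z|lborel. ?n z *\<^sub>R g a) = g a"
    by (subst integral_scaleR_left) (auto intro!: integrable_normal_density)
  ultimately have "(\<lambda>k. norm (LINT z|lborel. ?n z *\<^sub>R g (a + (1 / real (Suc k)) * z))) \<longlonglongrightarrow> norm (g a)"
    by (simp add: tendsto_norm)
  then show ?thesis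
    by (rule LIMSEQ_le_const2) (intro exI[of _ 0] allI impI gauss_average_le[OF g(1,2) F], simp)
qed


section \<open>From the Hoermander norm to pointwise bounds for the symbol\<close>

lemma nn_integral_bracket_finite:
  assumes "s \<ge> 1"
  shows "(\<integral>\<^sup>+t. ennreal ((japanese_bracket t powr (- s))\<^sup>2) \<partial>lborel) < \<infinity>"
proof -
  have "set_integrable lborel (einterval (-\<infinity>) \<infinity>) (\<lambda>x. inverse (1 + x\<^sup>2) :: real)"
    by (rule integrable_inverse_1_plus_square)
  then have "integrable lborel (\<lambda>x. inverse (1 + x\<^sup>2) :: real)" by (simp add: set_integrable_def)
  then have fin: "(\<integral>\<^sup>+t. ennreal (inverse (1 + t\<^sup>2)) \<partial>lborel) < \<infinity>"
    by (simp add: integrable_iff_bounded)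
  have "(japanese_bracket t powr (- s))\<^sup>2 \<le> inverse (1 + t\<^sup>2)" for t
  proof -
    have b: "1 + t\<^sup>2 \<ge> 1" by simp
    have "(japanese_bracket t powr (- s))\<^sup>2 = (1 + t\<^sup>2) powr (- s)"
      by (simp add: japanese_bracket_def powr_half_sqrt[symmetric] powr_powr power2_eq_square flip: powr_add)
    also have "\<dots> \<le> (1 + t\<^sup>2) powr (- 1)" using assms b by (intro powr_mono) auto
    also have "\<dots> = inverse (1 + t\<^sup>2)" using b by (simp add: powr_minus)
    finally show ?thesis .
  qed
  then have "(\<integral>\<^sup>+t. ennreal ((japanese_bracket t powr (- s))\<^sup>2) \<partial>lborel) \<le> (\<integral>\<^sup>+t. ennreal (inverse (1 + t\<^sup>2)) \<partial>lborel)"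
    by (intro nn_integral_mono ennreal_leI)
  then show ?thesis using fin by (rule le_less_trans)
qed

text \<open>The supremum of a cut-off piece is at most the L1 norm of its Fourier transform.
  Cauchy-Schwarz with the weights \<open>japanese_bracket t powr (- s)\<close> and
  \<open>japanese_bracket t powr s\<close> bounds this by the Hoermander integral, and the scaling
  factor in the norm becomes the decay in k.\<close>

lemma symbol_cutoff_bound:
  fixes m :: "real^'n \<Rightarrow> real \<Rightarrow> complex"
  assumes psi: "test_function \<psi>" "supp \<psi> \<subseteq> {1 / 2..4}"
    and cont: "continuous_on UNIV (\<lambda>(x, \<xi>). m x \<xi>)"
    and s: "s \<ge> 1" and H: "hoermander_norm \<psi> s m < \<infinity>"
  shows "\<exists>C\<ge>0. \<forall>x k \<xi>. k > 0 \<longrightarrow>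
    norm (m x \<xi> * \<psi> (2 powr (- k) * \<bar>\<xi>\<bar>)) \<le> C * 2 powr (- k * (s - real CARD('n) / 2))"
proof -
  define J where "J = (\<integral>\<^sup>+t. ennreal ((japanese_bracket t powr (- s))\<^sup>2) \<partial>lborel)"
  have J: "J < \<infinity>" unfolding J_def by (rule nn_integral_bracket_finite[OF s])
  define h where "h = enn2real (hoermander_norm \<psi> s m)"
  have h: "hoermander_norm \<psi> s m = ennreal h" using H by (simp add: h_def)
  have h0: "h \<ge> 0" by (simp add: h_def)
  have cpsi: "continuous_on UNIV \<psi>"
    using psi(1) unfolding test_function_def smooth_def by (metis Ck.simps(1))
  have psi0: "\<psi> t = 0" if "t > 4" for t
  proof (rule ccontr)
    assume "\<psi> t \<noteq> 0"
    then have "t \<in> supp \<psi>" unfolding supp_def by (intro closure_subset[THEN subsetD]) simp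
    then show False using psi(2) that by auto
  qed
  show ?thesis
  proof (intro exI[of _ "sqrt (enn2real J) * h"] conjI allI impI)
    show "sqrt (enn2real J) * h \<ge> 0" using h0 by simp
    fix x :: "real^'n" and k \<xi>0 :: real assume k: "k > 0"
    define g where "g \<xi> = m x \<xi> * \<psi> (2 powr (- k) * \<bar>\<xi>\<bar>)" for \<xi>
    \<comment> \<open>The cut-off vanishes beyond \<open>4 * 2 powr k\<close>; 5 puts the interval
      safely beyond its support.\<close>
    define R where "R = 5 * 2 powr k"
    have cg: "continuous_on UNIV g"
    proof -
      have "continuous_on UNIV (\<lambda>\<xi>. m x \<xi>)"
        using continuous_on_compose2[OF cont continuous_on_Pair[OF continuous_on_const[of UNIV x] continuous_on_id]]
        by simp
      moreover have "continuous_on UNIV (\<lambda>\<xi>. \<psi> (2 powr (- k) * \<bar>\<xi>\<bar>))"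
        by (rule continuous_on_compose2[OF cpsi]) (auto intro!: continuous_intros)
      ultimately show ?thesis unfolding g_def by (rule continuous_on_mult)
    qed
    have gz: "g \<xi> = 0" if "\<xi> \<notin> {- R..R}" for \<xi>
    proof -
      have "\<bar>\<xi>\<bar> > R" using that by (auto simp: abs_if)
      then have "2 powr (- k) * \<bar>\<xi>\<bar> > 2 powr (- k) * R" by simp
      moreover have "2 powr (- k) * R = 5" by (simp add: R_def powr_minus)
      ultimately show ?thesis using psi0 by (simp add: g_def)
    qed
    have "g = (\<lambda>\<xi>. indicator {- R..R} \<xi> *\<^sub>R g \<xi>)" using gz by (auto simp: fun_eq_iff indicator_def)
    moreover have "integrable lborel (\<lambda>\<xi>. indicator {- R..R} \<xi> *\<^sub>R g \<xi>)"
      by (rule borel_integrable_compact) (auto intro: continuous_on_subset[OF cg])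
    ultimately have ig: "integrable lborel g" by simp
    have "bounded (g ` {- R..R})"
      by (intro compact_imp_bounded compact_continuous_image continuous_on_subset[OF cg]) auto
    then obtain B where B: "\<And>\<xi>. \<xi> \<in> {- R..R} \<Longrightarrow> norm (g \<xi>) \<le> B"
      unfolding bounded_iff by blast
    have Bg: "norm (g \<xi>) \<le> max B 0" for \<xi> using B[of \<xi>] gz[of \<xi>] by (cases "\<xi> \<in> {- R..R}") auto
    have [measurable]: "g \<in> borel_measurable borel" using cg by (rule borel_measurable_continuous_onI)
    have mF[measurable]: "fourier g \<in> borel_measurable borel"
      unfolding fourier_lborel[OF cg, abs_def] by measurable
    define I where "I = (\<integral>\<^sup>+t. ennreal (japanese_bracket t powr (2 * s) * (norm (fourier g t))\<^sup>2) \<partial>lborel)"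
    have [measurable]: "japanese_bracket \<in> borel_measurable borel"
      unfolding japanese_bracket_def[abs_def] by measurable
    have Ieq: "I = (\<integral>\<^sup>+t. ennreal (japanese_bracket t powr (2 * s) * (norm (fourier g t))\<^sup>2) \<partial>lebesgue)"
      unfolding I_def by (subst nn_integral_completion) auto
    have "ennreal (2 powr (k * (s - real CARD('n) / 2))) * epowr I (1 / 2) \<le> hoermander_norm \<psi> s m"
      unfolding hoermander_norm_def Ieq g_def[abs_def]
      by (rule SUP_upper2[of x], simp, rule SUP_upper2[of k]) (use k in auto)
    then have le: "ennreal (2 powr (k * (s - real CARD('n) / 2))) * epowr I (1 / 2) \<le> ennreal h" using h by simp
    \<comment> \<open>Finiteness must come before the passage to real numbers, because
      \<open>enn2real\<close> sends infinity to 0.\<close>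
    have If: "I < \<infinity>"
    proof (rule ccontr)
      assume "\<not> I < \<infinity>"
      then have "I = \<infinity>" by (simp add: less_top[symmetric])
      then have "ennreal (2 powr (k * (s - real CARD('n) / 2))) * epowr I (1 / 2) = \<infinity>"
        by (simp add: epowr_def ennreal_mult_top)
      then show False using le by (metis ennreal_less_top infinity_ennreal_def leD)
    qed
    have hI: "sqrt (enn2real I) \<le> h * 2 powr (- k * (s - real CARD('n) / 2))"
    proof -
      have "ennreal (2 powr (k * (s - real CARD('n) / 2)) * sqrt (enn2real I)) \<le> ennreal h"
      proof -
        have "epowr I (1 / 2) = ennreal (sqrt (enn2real I))"
          using If by (auto simp: epowr_def powr_half_sqrt)
        then show ?thesis using le by (simp add: ennreal_mult)
      qed
      then have le2: "2 powr (k * (s - real CARD('n) / 2)) * sqrt (enn2real I) \<le> h" using h0 by (simp add: ennreal_le_iff)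
      define w where "w = 2 powr (k * (s - real CARD('n) / 2))"
      have e: "2 powr (- k * (s - real CARD('n) / 2)) = 1 / w"
        unfolding w_def mult_minus_left by (rule powr_minus_divide)
      have w: "w > 0" by (simp add: w_def)
      show ?thesis
        unfolding e using le2[folded w_def] w by (simp add: field_simps)
    qed
    have cs: "(\<integral>\<^sup>+t. ennreal (norm (fourier g t)) \<partial>lborel)\<^sup>2 \<le> J * I"
    proof -
      have eq: "ennreal (norm (fourier g t)) = ennreal (japanese_bracket t powr (- s)) * ennreal (japanese_bracket t powr s * norm (fourier g t))" for t
      proof -
        have "japanese_bracket t > 0" unfolding japanese_bracket_def by (simp add: add_pos_nonneg)
        then have "japanese_bracket t powr (- s) * japanese_bracket t powr s = 1" by (simp flip: powr_add)
        then show ?thesis by (simp flip: ennreal_mult mult.assoc)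
      qed
      have "(\<integral>\<^sup>+t. ennreal (japanese_bracket t powr (- s)) * ennreal (japanese_bracket t powr s * norm (fourier g t)) \<partial>lborel)\<^sup>2
        \<le> (\<integral>\<^sup>+t. (ennreal (japanese_bracket t powr (- s)))\<^sup>2 \<partial>lborel) * (\<integral>\<^sup>+t. (ennreal (japanese_bracket t powr s * norm (fourier g t)))\<^sup>2 \<partial>lborel)"
        by (rule Cauchy_Schwarz_nn_integral) auto
      also have "(\<integral>\<^sup>+t. (ennreal (japanese_bracket t powr (- s)))\<^sup>2 \<partial>lborel) = J"
        unfolding J_def by (simp add: ennreal_power)
      also have "(\<integral>\<^sup>+t. (ennreal (japanese_bracket t powr s * norm (fourier g t)))\<^sup>2 \<partial>lborel) = I"
      proof -
        have "(japanese_bracket t powr s * norm (fourier g t))\<^sup>2 = japanese_bracket t powr (2 * s) * (norm (fourier g t))\<^sup>2" for t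
          by (simp add: power_mult_distrib power2_eq_square flip: powr_add)
        then show ?thesis unfolding I_def by (simp add: ennreal_power)
      qed
      finally show ?thesis unfolding eq .
    qed
    have JI: "J * I = ennreal (enn2real J * enn2real I)"
      using J If by (simp add: ennreal_mult)
    have fin: "(\<integral>\<^sup>+t. ennreal (norm (fourier g t)) \<partial>lborel) < \<infinity>"
    proof (rule ccontr)
      assume "\<not> (\<integral>\<^sup>+t. ennreal (norm (fourier g t)) \<partial>lborel) < \<infinity>"
      then have "(\<integral>\<^sup>+t. ennreal (norm (fourier g t)) \<partial>lborel) = \<top>" by (simp add: less_top[symmetric])
      then show False using cs unfolding JI by (simp add: power2_eq_square top_unique)
    qed
    then have iF: "integrable lborel (fourier g)" by (simp add: integrable_iff_bounded)
    have "ennreal ((LINT t|lborel. norm (fourier g t))\<^sup>2) \<le> ennreal (enn2real J * enn2real I)"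
      using cs unfolding JI by (subst (asm) nn_integral_eq_integral) (use iF in \<open>auto simp: ennreal_power\<close>)
    then have "(LINT t|lborel. norm (fourier g t))\<^sup>2 \<le> enn2real J * enn2real I"
      by (simp add: ennreal_le_iff)
    then have "(LINT t|lborel. norm (fourier g t)) \<le> sqrt (enn2real J) * sqrt (enn2real I)"
      by (simp add: real_le_rsqrt flip: real_sqrt_mult)
    then have "norm (g \<xi>0) \<le> sqrt (enn2real J) * sqrt (enn2real I)"
      using sup_le_fourier[OF cg ig Bg iF, of \<xi>0] by linarith
    also have "\<dots> \<le> sqrt (enn2real J) * (h * 2 powr (- k * (s - real CARD('n) / 2)))"
      by (rule mult_left_mono[OF hI]) simp
    finally show "norm (m x \<xi>0 * \<psi> (2 powr (- k) * \<bar>\<xi>0\<bar>)) \<le> sqrt (enn2real J) * h * 2 powr (- k * (s - real CARD('n) / 2))"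
      by (simp add: g_def mult.assoc)
  qed
qed

lemma symbol_bound:
  fixes m :: "real^'n \<Rightarrow> real \<Rightarrow> complex"
  assumes psi: "test_function \<psi>" "supp \<psi> \<subseteq> {1 / 2..4}" "\<And>t. t \<in> {1..2} \<Longrightarrow> \<psi> t = 1"
    and cont: "continuous_on UNIV (\<lambda>(x, \<xi>). m x \<xi>)"
    and s: "s \<ge> 1" and H: "hoermander_norm \<psi> s m < \<infinity>"
  obtains C where "C \<ge> 0" "\<And>x \<xi>. \<xi> \<ge> 1 \<Longrightarrow> norm (m x \<xi>) \<le> C * \<xi> powr (- (s - real CARD('n) / 2))"
proof -
  obtain C where C: "C \<ge> 0" "\<And>x k \<xi>. k > 0 \<Longrightarrow>
    norm (m x \<xi> * \<psi> (2 powr (- k) * \<bar>\<xi>\<bar>)) \<le> C * 2 powr (- k * (s - real CARD('n) / 2))"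
    using symbol_cutoff_bound[OF psi(1,2) cont s H] by metis
  show thesis
  proof (rule that[OF C(1)])
    fix x :: "real^'n" and \<xi> :: real assume \<xi>: "\<xi> \<ge> 1"
    show "norm (m x \<xi>) \<le> C * \<xi> powr (- (s - real CARD('n) / 2))"
    \<comment> \<open>At the scale k = log2 \<xi> the argument of the cut-off is 1. For \<xi> = 1
      this would be k = 0, which the norm excludes, so there the estimate is passed to the limit
      from the right.\<close>
    proof (cases "\<xi> = 1")
      case False
      then have k: "log 2 \<xi> > 0" using \<xi> by simp
      have "2 powr (- log 2 \<xi>) * \<bar>\<xi>\<bar> = 1" using \<xi> by (simp add: powr_minus)
      then have "norm (m x \<xi>) \<le> C * 2 powr (- log 2 \<xi> * (s - real CARD('n) / 2))"
        using C(2)[OF k, of x \<xi>] psi(3)[of 1] by simp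
      also have "2 powr (- log 2 \<xi> * (s - real CARD('n) / 2)) = (2 powr log 2 \<xi>) powr (- (s - real CARD('n) / 2))"
        by (simp only: powr_powr mult_minus_left mult_minus_right)
      also have "2 powr log 2 \<xi> = \<xi>" using \<xi> by simp
      finally show ?thesis .
    next
      case True
      have cpsi: "continuous_on UNIV \<psi>"
        using psi(1) unfolding test_function_def smooth_def by (metis Ck.simps(1))
      have lim: "((\<lambda>k. norm (m x \<xi> * \<psi> (2 powr (- k) * \<bar>\<xi>\<bar>))) \<longlongrightarrow> norm (m x \<xi> * \<psi> (2 powr (- 0) * \<bar>\<xi>\<bar>))) (at_right 0)"
        by (intro tendsto_intros isCont_tendsto_compose[where g = \<psi>]) (use cpsi in \<open>auto simp: continuous_on_eq_continuous_at\<close>)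
      have lim2: "((\<lambda>k. C * 2 powr (- k * (s - real CARD('n) / 2))) \<longlongrightarrow> C * 2 powr (- 0 * (s - real CARD('n) / 2))) (at_right 0)"
        by (intro tendsto_intros) auto
      have "norm (m x \<xi> * \<psi> (2 powr (- 0) * \<bar>\<xi>\<bar>)) \<le> C * 2 powr (- 0 * (s - real CARD('n) / 2))"
      proof (rule tendsto_le[OF _ lim2 lim])
        show "eventually (\<lambda>k. norm (m x \<xi> * \<psi> (2 powr (- k) * \<bar>\<xi>\<bar>)) \<le> C * 2 powr (- k * (s - real CARD('n) / 2))) (at_right 0)"
          by (rule eventually_mono[OF eventually_at_right_less[of 0]]) (rule C(2))
      qed simp
      then show ?thesis using True psi(3)[of 1] by simp
    qed
  qed
qed

section \<open>Hoelder-type inequalities\<close>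

lemma nn_integral_Hoelder:
  fixes f g :: "'a \<Rightarrow> complex"
  assumes [measurable]: "f \<in> borel_measurable M" "g \<in> borel_measurable M"
    and pq: "p > 1" "q > 1" "1 / p + 1 / q = 1" and AB: "A > 0" "B > 0"
    and f: "(\<integral>\<^sup>+x. ennreal (norm (f x) powr p) \<partial>M) \<le> ennreal (A powr p)"
    and g: "(\<integral>\<^sup>+x. ennreal (norm (g x) powr q) \<partial>M) \<le> ennreal (B powr q)"
  shows "(\<integral>\<^sup>+x. ennreal (norm (f x) * norm (g x)) \<partial>M) \<le> ennreal (A * B)"
proof -
  define a where "a = A * B / (p * A powr p)"
  define b where "b = A * B / (q * B powr q)"
  have ab: "a \<ge> 0" "b \<ge> 0" using pq AB by (auto simp: a_def b_def)
  have pt: "norm (f x) * norm (g x) \<le> a * norm (f x) powr p + b * norm (g x) powr q" for x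
  proof -
    have "(norm (f x) / A) * (norm (g x) / B) \<le> (norm (f x) / A) powr p / p + (norm (g x) / B) powr q / q"
      using pq AB by (intro Youngs_inequality) auto
    then have "(A * B) * ((norm (f x) / A) * (norm (g x) / B)) \<le> (A * B) * ((norm (f x) / A) powr p / p + (norm (g x) / B) powr q / q)"
      using AB by (intro mult_left_mono) auto
    then show ?thesis using AB by (simp add: a_def b_def powr_divide algebra_simps)
  qed
  have "(\<integral>\<^sup>+x. ennreal (norm (f x) * norm (g x)) \<partial>M)
      \<le> (\<integral>\<^sup>+x. ennreal a * ennreal (norm (f x) powr p) + ennreal b * ennreal (norm (g x) powr q) \<partial>M)"
    using ab by (intro nn_integral_mono) (simp add: pt ennreal_leI flip: ennreal_mult ennreal_plus)
  also have "\<dots> = ennreal a * (\<integral>\<^sup>+x. ennreal (norm (f x) powr p) \<partial>M) + ennreal b * (\<integral>\<^sup>+x. ennreal (norm (g x) powr q) \<partial>M)"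
    by (simp add: nn_integral_add nn_integral_cmult)
  also have "\<dots> \<le> ennreal a * ennreal (A powr p) + ennreal b * ennreal (B powr q)"
    by (intro add_mono mult_left_mono f g) auto
  also have "\<dots> = ennreal (a * A powr p + b * B powr q)" using ab by (simp add: ennreal_mult ennreal_plus)
  also have "a * A powr p + b * B powr q = A * B * (1 / p + 1 / q)"
    using AB pq by (simp add: a_def b_def field_simps)
  finally show ?thesis by (simp add: pq)
qed

text \<open>Jensen's inequality for the weights w, from Young's inequality at the optimal level t
  with \<open>t^q = Z / W\<close>. It takes the place of Minkowski's inequality for infinite series:
  the right side can be integrated term by term, and convergence comes along.\<close>

lemma weighted_sum_powr_le:
  fixes w v :: "nat \<Rightarrow> real"
  assumes w: "\<And>j. 0 \<le> w j" "summable w" "suminf w > 0" and v: "\<And>j. 0 \<le> v j"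
    and q: "q > 1" and s: "summable (\<lambda>j. w j * v j powr q)"
  shows "summable (\<lambda>j. w j * v j)"
    and "(\<Sum>j. w j * v j) powr q \<le> suminf w powr (q - 1) * (\<Sum>j. w j * v j powr q)"
proof -
  define p where "p = q / (q - 1)"
  have p: "p > 1" "1 / q + 1 / p = 1" using q by (auto simp: p_def field_simps)
  have young: "v j * t powr (q - 1) \<le> v j powr q / q + t powr q / p" if "t \<ge> 0" for j t
  proof -
    have "v j * t powr (q - 1) \<le> v j powr q / q + (t powr (q - 1)) powr p / p"
      using q p v[of j] by (intro Youngs_inequality) auto
    also have "(t powr (q - 1)) powr p = t powr q" using q by (simp add: powr_powr p_def)
    finally show ?thesis .
  qed
  show sv: "summable (\<lambda>j. w j * v j)"
  proof (rule summable_comparison_test')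
    show "summable (\<lambda>j. (w j * v j powr q) / q + w j / p)" by (intro summable_add summable_divide s w)
    fix j
    have "w j * v j \<le> w j * (v j powr q / q + 1 / p)" using young[of 1 j] w by (intro mult_left_mono) auto
    then show "norm (w j * v j) \<le> (w j * v j powr q) / q + w j / p"
      using w(1)[of j] v[of j] by (simp add: distrib_left)
  qed
  define Z where "Z = (\<Sum>j. w j * v j powr q)"
  define W where "W = suminf w"
  have Z0: "Z \<ge> 0" unfolding Z_def by (intro suminf_nonneg s mult_nonneg_nonneg w) auto
  have W0: "W > 0" using w by (simp add: W_def)
  have S0: "(\<Sum>j. w j * v j) \<ge> 0" by (intro suminf_nonneg sv mult_nonneg_nonneg w v)
  show "(\<Sum>j. w j * v j) powr q \<le> suminf w powr (q - 1) * (\<Sum>j. w j * v j powr q)"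
  proof (cases "Z = 0")
    case True
    have "w j * v j powr q = 0" for j
      using True suminf_eq_zero_iff[OF s] w unfolding Z_def by simp
    then have "(\<lambda>j. w j * v j) = (\<lambda>_. 0)" by auto
    then have "(\<Sum>j. w j * v j) = 0" by simp
    then show ?thesis using Z0 q by (simp add: Z_def[symmetric])
  next
    case False
    then have Zp: "Z > 0" using Z0 by simp
    define t where "t = (Z / W) powr (1 / q)"
    have t: "t > 0" using Zp W0 by (simp add: t_def)
    have tq: "t powr q = Z / W" using Zp W0 q by (simp add: t_def powr_powr)
    have "(\<Sum>j. w j * v j * t powr (q - 1)) \<le> (\<Sum>j. (w j * v j powr q) / q + w j * (t powr q / p))"
    proof (rule suminf_le)
      fix j
      have "w j * (v j * t powr (q - 1)) \<le> w j * (v j powr q / q + t powr q / p)"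
        using young[of t j] t w by (intro mult_left_mono) auto
      then show "w j * v j * t powr (q - 1) \<le> (w j * v j powr q) / q + w j * (t powr q / p)"
        by (simp add: distrib_left mult.assoc)
    qed (intro summable_mult2 sv, intro summable_add summable_divide summable_mult2 s w)
    also have "(\<Sum>j. (w j * v j powr q) / q + w j * (t powr q / p)) = Z / q + W * (t powr q / p)"
      unfolding Z_def W_def suminf_divide[OF s, symmetric] suminf_mult2[OF w(2)]
      by (rule suminf_add[symmetric]) (intro summable_divide s, intro summable_mult2 w)
    also have "\<dots> = Z * (1 / q + 1 / p)" unfolding tq using W0 by (simp add: field_simps)
    also have "\<dots> = Z" using p by simp
    also have "(\<Sum>j. w j * v j * t powr (q - 1)) = (\<Sum>j. w j * v j) * t powr (q - 1)"
      by (rule suminf_mult2[OF sv, symmetric])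
    finally have "(\<Sum>j. w j * v j) * t powr (q - 1) \<le> Z" .
    then have "((\<Sum>j. w j * v j) * t powr (q - 1)) powr q \<le> Z powr q"
      using S0 q by (intro powr_mono2) auto
    then have "(\<Sum>j. w j * v j) powr q * (t powr q) powr (q - 1) \<le> Z powr q"
      by (simp add: powr_mult powr_powr mult.commute)
    then have "(\<Sum>j. w j * v j) powr q * (Z powr (q - 1) / W powr (q - 1)) \<le> Z powr q"
      unfolding tq by (simp add: powr_divide)
    also have "Z powr q = Z * Z powr (q - 1)" using Zp by (simp add: powr_diff)
    finally have "(\<Sum>j. w j * v j) powr q \<le> W powr (q - 1) * Z"
      using Zp W0 by (simp add: field_simps)
    then show ?thesis by (simp add: Z_def W_def)
  qed
qed

section \<open>The spectral projections as integral operators\<close>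

text \<open>The counterpart of \<open>hcoef\<close> for the completed measure, since elements of
  \<open>Lp\<close> are only Lebesgue measurable.\<close>

definition lcoef :: "(real^'n \<Rightarrow> complex) \<Rightarrow> nat^'n \<Rightarrow> complex" where
  "lcoef f \<nu> = (LINT x|lebesgue. f x * of_real (hermite_vec \<nu> x))"

lemma measurable_lebesgueI: "g \<in> borel_measurable borel \<Longrightarrow> g \<in> borel_measurable lebesgue"
  by (rule measurable_completion) simp

lemma nn_integral_lebesgue_eq:
  "g \<in> borel_measurable borel \<Longrightarrow> (\<integral>\<^sup>+x. g x \<partial>lebesgue) = (\<integral>\<^sup>+x. g x \<partial>lborel)"
  by (rule nn_integral_completion)

lemma integrable_lebesgue_hermite_vec_mult:
  "integrable lebesgue (\<lambda>x. complex_of_real (hermite_vec \<nu> x * hermite_vec \<mu> x))"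
  by (subst integrable_completion) (auto intro!: integrable_of_real integrable_hermite_vec_mult simp del: of_real_mult)

lemma lebesgue_hermite_vec_orthonormal:
  "(LINT x|lebesgue. complex_of_real (hermite_vec \<nu> x * hermite_vec \<mu> x)) = (if \<nu> = \<mu> then 1 else 0)"
  by (subst integral_completion) (auto simp: hermite_vec_orthonormal simp del: of_real_mult)

lemma eigf_mult_hermite_vec:
  assumes "\<mu> \<in> multi_indices j"
  shows "integrable lebesgue (\<lambda>x. eigf c j x * complex_of_real (hermite_vec \<mu> x))"
    "(LINT x|lebesgue. eigf c j x * complex_of_real (hermite_vec \<mu> x)) = c \<mu>"
proof -
  have eq: "eigf c j x * complex_of_real (hermite_vec \<mu> x)
     = (\<Sum>\<nu>\<in>multi_indices j. c \<nu> * complex_of_real (hermite_vec \<nu> x * hermite_vec \<mu> x))" for x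
    by (simp add: eigf_def sum_distrib_right mult.assoc)
  show "integrable lebesgue (\<lambda>x. eigf c j x * complex_of_real (hermite_vec \<mu> x))"
    unfolding eq by (intro Bochner_Integration.integrable_sum integrable_mult_right integrable_lebesgue_hermite_vec_mult)
  have "(LINT x|lebesgue. eigf c j x * complex_of_real (hermite_vec \<mu> x)) = (\<Sum>\<nu>\<in>multi_indices j. c \<nu> * (if \<nu> = \<mu> then 1 else 0))"
    unfolding eq
    by (subst Bochner_Integration.integral_sum, intro integrable_mult_right integrable_lebesgue_hermite_vec_mult)
       (simp only: integral_mult_right_zero lebesgue_hermite_vec_orthonormal)
  also have "\<dots> = c \<mu>" using assms by (simp add: if_distrib[of "\<lambda>z. _ * z"] sum.delta cong: if_cong)
  finally show "(LINT x|lebesgue. eigf c j x * complex_of_real (hermite_vec \<mu> x)) = c \<mu>" .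
qed

text \<open>By orthonormality the pairing of the remainder with \<open>eigf d j\<close> is the sum
  of \<open>cnj (d \<mu>) * (lcoef f \<mu> - c \<mu>)\<close>. Testing with single coordinates d
  forces the coefficients, which gives the uniqueness behind the definite description.\<close>

lemma hermite_proj_eq:
  fixes f :: "real^'n \<Rightarrow> complex"
  assumes f: "\<And>\<nu>. integrable lebesgue (\<lambda>x. f x * complex_of_real (hermite_vec \<nu> x))"
  shows "hermite_proj j f = eigf (lcoef f) j"
proof -
  have span: "g \<in> hermite_span j \<longleftrightarrow> (\<exists>c. g = eigf c j)" for g :: "real^'n \<Rightarrow> complex"
    by (simp add: hermite_span_def hermite_funs_eq eigf_def[abs_def])
  have inner1: "L2_inner (\<lambda>x. f x - eigf c j x) (eigf d j) = (\<Sum>\<mu>\<in>multi_indices j. cnj (d \<mu>) * (lcoef f \<mu> - c \<mu>))" for c d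
  proof -
    have eq: "(f x - eigf c j x) * cnj (eigf d j x)
       = (\<Sum>\<mu>\<in>multi_indices j. cnj (d \<mu>) * (f x * of_real (hermite_vec \<mu> x) - eigf c j x * of_real (hermite_vec \<mu> x)))" for x
      by (simp add: eigf_def[of d] cnj_sum sum_distrib_left algebra_simps)
    show ?thesis
      unfolding L2_inner_def eq
      by (subst Bochner_Integration.integral_sum)
         (auto intro!: integrable_mult_right Bochner_Integration.integrable_diff f eigf_mult_hermite_vec sum.cong
               simp: Bochner_Integration.integral_diff[OF f eigf_mult_hermite_vec(1)] eigf_mult_hermite_vec(2) lcoef_def)
  qed
  show ?thesis
    unfolding hermite_proj_def orth_proj_def
  proof (rule the_equality)
    show "eigf (lcoef f) j \<in> hermite_span j \<and> (\<forall>h\<in>hermite_span j. L2_inner (\<lambda>x. f x - eigf (lcoef f) j x) h = 0)"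
      using inner1[of "lcoef f"] by (auto simp: span)
    fix g assume g: "g \<in> hermite_span j \<and> (\<forall>h\<in>hermite_span j. L2_inner (\<lambda>x. f x - g x) h = 0)"
    then obtain c where c: "g = eigf c j" by (auto simp: span)
    have "c \<mu> = lcoef f \<mu>" if \<mu>: "\<mu> \<in> multi_indices j" for \<mu>
    proof -
      have "L2_inner (\<lambda>x. f x - g x) (eigf (\<lambda>\<nu>. if \<nu> = \<mu> then 1 else 0) j) = 0"
      proof -
        have "eigf (\<lambda>\<nu>. if \<nu> = \<mu> then 1 else 0) j \<in> hermite_span j" unfolding span by (rule exI) (rule refl)
        then show ?thesis using g by blast
      qed
      then have "(\<Sum>\<nu>\<in>multi_indices j. (if \<nu> = \<mu> then lcoef f \<nu> - c \<nu> else 0)) = 0"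
        unfolding c inner1 by (simp add: if_distrib[of cnj] if_distrib[of "\<lambda>z. z * _"] cong: if_cong)
      then show ?thesis using \<mu> by (simp add: sum.delta)
    qed
    then show "g = eigf (lcoef f) j" unfolding c eigf_def by (intro ext sum.cong) auto
  qed
qed

section \<open>Linearity of the coefficients, and integrability of test functions\<close>

lemma lcoef_add:
  assumes "integrable lebesgue (\<lambda>x. f x * complex_of_real (hermite_vec \<nu> x))"
    "integrable lebesgue (\<lambda>x. g x * complex_of_real (hermite_vec \<nu> x))"
  shows "lcoef (\<lambda>y. f y + g y) \<nu> = lcoef f \<nu> + lcoef g \<nu>"
  unfolding lcoef_def distrib_right by (rule Bochner_Integration.integral_add[OF assms])

lemma lcoef_mult: "lcoef (\<lambda>y. c * f y) \<nu> = c * lcoef f \<nu>"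
  unfolding lcoef_def by (simp add: mult.assoc)

lemma eigf_add: "eigf (\<lambda>\<nu>. c \<nu> + d \<nu>) j x = eigf c j x + eigf d j x"
  by (simp add: eigf_def distrib_right sum.distrib)

lemma eigf_mult: "eigf (\<lambda>\<nu>. a * c \<nu>) j x = a * eigf c j x"
  by (simp add: eigf_def sum_distrib_left mult.assoc)

lemma test_function_continuous: "test_function f \<Longrightarrow> continuous_on UNIV f"
  unfolding test_function_def smooth_def by (metis Ck.simps(1))

lemma test_function_bounded:
  assumes "test_function f"
  obtains B K where "B > 0" "compact K" "\<And>x. norm (f x) \<le> B * indicator K x"
proof -
  define K where "K = supp f"
  have K: "compact K" using assms by (simp add: test_function_def K_def)
  have "compact (f ` K)"
    by (intro compact_continuous_image K continuous_on_subset[OF test_function_continuous[OF assms]]) auto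
  then have "bounded (f ` K)" by (rule compact_imp_bounded)
  then obtain B where B: "\<And>x. x \<in> K \<Longrightarrow> norm (f x) \<le> B"
    unfolding bounded_iff by blast
  show thesis
  proof (rule that[of "max B 1"])
    show "norm (f x) \<le> max B 1 * indicator K x" for x
    proof (cases "x \<in> K")
      case True then show ?thesis using B[OF True] by simp
    next
      case False
      then have "x \<notin> {x. f x \<noteq> 0}" unfolding K_def supp_def using closure_subset[of "{x. f x \<noteq> 0}"] by blast
      then show ?thesis by simp
    qed
  qed (use K in auto)
qed

lemma test_function_Lp:
  assumes f: "test_function f" and p: "1 \<le> p"
  shows "f \<in> Lp (ennreal p)"
proof -
  obtain B K where BK: "B > 0" "compact K" "\<And>x. norm (f x) \<le> B * indicator K x"
    using test_function_bounded[OF f] by blast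
  have [measurable]: "f \<in> borel_measurable borel"
    by (rule borel_measurable_continuous_onI[OF test_function_continuous[OF f]])
  have [measurable]: "K \<in> sets borel" using BK(2) by (intro borel_closed compact_imp_closed)
  have "(\<integral>\<^sup>+x. ennreal (norm (f x) powr p) \<partial>lebesgue) = (\<integral>\<^sup>+x. ennreal (norm (f x) powr p) \<partial>lborel)"
    by (rule nn_integral_lebesgue_eq) measurable
  also have "\<dots> \<le> (\<integral>\<^sup>+x. ennreal (B powr p) * indicator K x \<partial>lborel)"
  proof (rule nn_integral_mono)
    fix x
    have "norm (f x) powr p \<le> (B * indicator K x) powr p" using BK(3) p by (intro powr_mono2) auto
    then show "ennreal (norm (f x) powr p) \<le> ennreal (B powr p) * indicator K x"
      using p by (cases "x \<in> K") (auto intro: ennreal_leI)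
  qed
  also have "\<dots> = ennreal (B powr p) * emeasure lborel K" by (rule nn_integral_cmult_indicator) measurable
  also have "\<dots> < \<infinity>"
    using emeasure_bounded_finite[OF compact_imp_bounded[OF BK(2)]] by (simp add: ennreal_mult_less_top)
  finally have "(\<integral>\<^sup>+x. ennreal (norm (f x) powr p) \<partial>lebesgue) \<noteq> \<infinity>" by simp
  then show ?thesis
    using p by (auto simp: Lp_def Lp_norm_def epowr_def intro: measurable_lebesgueI)
qed

section \<open>Boundedness of the pseudo-multiplier\<close>

text \<open>The extension itself: the same series, with coefficients that make sense on all of Lp
  and not just for test functions.\<close>

definition pm_op :: "(real^'n \<Rightarrow> real \<Rightarrow> complex) \<Rightarrow> (real^'n \<Rightarrow> complex) \<Rightarrow> real^'n \<Rightarrow> complex" where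
  "pm_op m f x = (\<Sum>j. m x (real (2 * j + CARD('n))) * eigf (lcoef f) j x)"

lemma pseudo_multiplier_term_eq:
  fixes f :: "real^'n \<Rightarrow> complex"
  assumes "\<And>\<nu>. integrable lebesgue (\<lambda>x. f x * complex_of_real (hermite_vec \<nu> x))"
  shows "pseudo_multiplier_term m f x j = m x (real (2 * j + CARD('n))) * eigf (lcoef f) j x"
  by (simp add: pseudo_multiplier_term_def hermite_proj_eq[OF assms])

lemma pm_op_measurable:
  fixes m :: "real^'n \<Rightarrow> real \<Rightarrow> complex"
  assumes "\<And>\<xi>. continuous_on UNIV (\<lambda>x. m x \<xi>)"
  shows "pm_op m f \<in> borel_measurable borel"
proof -
  have [measurable]: "(\<lambda>x. m x \<xi>) \<in> borel_measurable borel" for \<xi>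
    by (rule borel_measurable_continuous_onI[OF assms])
  show ?thesis unfolding pm_op_def[abs_def] by measurable
qed

text \<open>Additivity and homogeneity hold for each term, and almost everywhere summability carries
  them over to the sum. On test functions the operator agrees with the pseudo-multiplier term by
  term.\<close>

lemma extends_by_pm_op:
  fixes m :: "real^'n \<Rightarrow> real \<Rightarrow> complex"
  assumes m: "\<And>\<xi>. continuous_on UNIV (\<lambda>x. m x \<xi>)"
    and int: "\<And>(f :: real^'n \<Rightarrow> complex) \<nu>. f \<in> Lp P \<Longrightarrow> integrable lebesgue (\<lambda>x. f x * complex_of_real (hermite_vec \<nu> x))"
    and summ: "\<And>f. f \<in> Lp P \<Longrightarrow> AE x in lebesgue. summable (\<lambda>j. m x (real (2 * j + CARD('n))) * eigf (lcoef f) j x)"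
    and bound: "C \<ge> 0" "\<And>f. f \<in> Lp P \<Longrightarrow> Lp_norm Q (pm_op m f) \<le> ennreal C * Lp_norm P f"
    and test: "\<And>f :: real^'n \<Rightarrow> complex. test_function f \<Longrightarrow> f \<in> Lp P"
  shows "(\<forall>f. test_function f \<longrightarrow> (AE x in lebesgue. summable (pseudo_multiplier_term m f x))) \<and>
     extends_to_bounded_operator P Q (pseudo_multiplier m)"
proof
  have term_eq: "pseudo_multiplier_term m f x = (\<lambda>j. m x (real (2 * j + CARD('n))) * eigf (lcoef f) j x)"
    if "test_function f" for f :: "real^'n \<Rightarrow> complex" and x
    using pseudo_multiplier_term_eq[OF int[OF test[OF that]]] by (simp add: fun_eq_iff)
  show "\<forall>f. test_function f \<longrightarrow> (AE x in lebesgue. summable (pseudo_multiplier_term m f x))"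
    using summ[OF test] by (simp add: term_eq)
  show "extends_to_bounded_operator P Q (pseudo_multiplier m)"
    unfolding extends_to_bounded_operator_def
  proof (intro exI[of _ "pm_op m"] conjI ballI allI impI)
    fix f :: "real^'n \<Rightarrow> complex" assume f: "f \<in> Lp P"
    have "ennreal C * Lp_norm P f < \<infinity>" using f by (simp add: Lp_def ennreal_mult_less_top)
    then have "Lp_norm Q (pm_op m f) < \<infinity>" using bound(2)[OF f] by (rule le_less_trans[rotated])
    then show "pm_op m f \<in> Lp Q"
      by (simp add: Lp_def measurable_lebesgueI[OF pm_op_measurable[OF m]])
  next
    fix f g :: "real^'n \<Rightarrow> complex" assume f: "f \<in> Lp P" and g: "g \<in> Lp P"
    have "lcoef (\<lambda>y. f y + g y) = (\<lambda>\<nu>. lcoef f \<nu> + lcoef g \<nu>)"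
      by (intro ext lcoef_add int f g)
    then have eq: "eigf (lcoef (\<lambda>y. f y + g y)) j x = eigf (lcoef f) j x + eigf (lcoef g) j x" for j x
      by (simp only: eigf_add)
    show "AE x in lebesgue. pm_op m (\<lambda>y. f y + g y) x = pm_op m f x + pm_op m g x"
      using summ[OF f] summ[OF g]
    proof eventually_elim
      case (elim x)
      show ?case unfolding pm_op_def eq distrib_left by (rule suminf_add[OF elim, symmetric])
    qed
  next
    fix c and f :: "real^'n \<Rightarrow> complex" assume f: "f \<in> Lp P"
    have "lcoef (\<lambda>y. c * f y) = (\<lambda>\<nu>. c * lcoef f \<nu>)" by (intro ext lcoef_mult)
    then have eq: "eigf (lcoef (\<lambda>y. c * f y)) j x = c * eigf (lcoef f) j x" for j x
      by (simp only: eigf_mult)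
    show "AE x in lebesgue. pm_op m (\<lambda>y. c * f y) x = c * pm_op m f x"
      using summ[OF f]
    proof eventually_elim
      case (elim x)
      show ?case unfolding pm_op_def eq mult.left_commute[of _ c] by (rule suminf_mult[OF elim])
    qed
  next
    show "\<exists>C\<ge>0. \<forall>f\<in>Lp P. Lp_norm Q (pm_op m f) \<le> ennreal C * Lp_norm P f" using bound by blast
  next
    fix f :: "real^'n \<Rightarrow> complex" assume "test_function f"
    then show "AE x in lebesgue. pm_op m f x = pseudo_multiplier m f x"
      by (simp add: pm_op_def pseudo_multiplier_def term_eq)
  qed
qed

lemma mem_multi_indices: "\<nu> \<in> multi_indices (\<Sum>i\<in>UNIV. \<nu> $ i)"
  by (simp add: multi_indices_def)

lemma eig_bound_sqrt:
  assumes "eig_bound TYPE('n::finite) q j D" "D > 0"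
    and "(\<Sum>\<nu>\<in>multi_indices j. (norm (c \<nu> :: complex))\<^sup>2) = 1"
  shows "(\<integral>\<^sup>+x. ennreal (norm (eigf (c :: nat^'n \<Rightarrow> complex) j x) powr q) \<partial>lebesgue) \<le> ennreal (sqrt D powr q)"
proof -
  have "(\<integral>\<^sup>+x. ennreal (norm (eigf c j x) powr q) \<partial>lebesgue) = (\<integral>\<^sup>+x. ennreal (norm (eigf c j x) powr q) \<partial>lborel)"
    by (rule nn_integral_lebesgue_eq) measurable
  also have "\<dots> \<le> ennreal (D powr (q / 2))" using assms by (simp add: eig_bound_def)
  also have "D powr (q / 2) = sqrt D powr q" using assms(2) by (simp add: powr_half_sqrt[symmetric] powr_powr)
  finally show ?thesis .
qed

section \<open>Duality on a single eigenspace\<close>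

context
  fixes p q A :: real and f :: "real^'n \<Rightarrow> complex"
  assumes pq: "p > 1" "q > 1" "1 / p + 1 / q = 1" and A: "A > 0"
    and f: "f \<in> borel_measurable lebesgue" "(\<integral>\<^sup>+x. ennreal (norm (f x) powr p) \<partial>lebesgue) \<le> ennreal (A powr p)"
begin

lemma pairing_bound:
  assumes e: "eig_bound TYPE('n) q j D" "D > 0" and c: "(\<Sum>\<nu>\<in>multi_indices j. (norm (c \<nu>))\<^sup>2) = 1"
  shows "(\<integral>\<^sup>+x. ennreal (norm (f x) * norm (eigf c j x)) \<partial>lebesgue) \<le> ennreal (A * sqrt D)"
  by (rule nn_integral_Hoelder[OF f(1) measurable_lebesgueI[OF measurable_eigf] pq A _ f(2) eig_bound_sqrt[OF e c]]) (use e in simp)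

text \<open>A Hermite function is the eigenfunction whose normalised coefficient vector is
  concentrated at \<nu>, so the pairing bound applies to it.\<close>

lemma integrable_Lp_hermite_vec:
  assumes e: "\<And>j. eig_bound TYPE('n) q j (D j)" "\<And>j. D j > 0"
  shows "integrable lebesgue (\<lambda>x. f x * complex_of_real (hermite_vec \<nu> x))"
proof -
  define j where "j = (\<Sum>i\<in>UNIV. \<nu> $ i)"
  have \<nu>: "\<nu> \<in> multi_indices j" unfolding j_def by (rule mem_multi_indices)
  define c where "c \<mu> = (if \<mu> = \<nu> then 1 else 0 :: complex)" for \<mu>
  have c2: "(norm (c \<mu>))\<^sup>2 = (if \<mu> = \<nu> then 1 else 0)" for \<mu> by (simp add: c_def)
  have c1: "(\<Sum>\<mu>\<in>multi_indices j. (norm (c \<mu>))\<^sup>2) = 1"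
    unfolding c2 using \<nu> by (simp add: sum.delta)
  have ce: "eigf c j x = of_real (hermite_vec \<nu> x)" for x
    unfolding eigf_def c_def using \<nu> by (simp add: if_distrib[of "\<lambda>z. z * _"] sum.delta cong: if_cong)
  have "(\<integral>\<^sup>+x. ennreal (norm (f x * complex_of_real (hermite_vec \<nu> x))) \<partial>lebesgue) \<le> ennreal (A * sqrt (D j))"
    using pairing_bound[OF e c1] unfolding ce by (simp add: norm_mult)
  also have "\<dots> < \<infinity>" by simp
  finally have "(\<integral>\<^sup>+x. ennreal (norm (f x * complex_of_real (hermite_vec \<nu> x))) \<partial>lebesgue) < \<infinity>" .
  moreover have "(\<lambda>x. complex_of_real (hermite_vec \<nu> x)) \<in> borel_measurable lebesgue"
    by (rule measurable_lebesgueI) measurable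
  ultimately show ?thesis using f(1) by (simp add: integrable_iff_bounded)
qed

text \<open>Duality turns the bound from \<open>L\<^sup>2\<close> to \<open>L\<^sup>q\<close> on the eigenspace into one from \<open>L\<^sup>p\<close> to
  \<open>L\<^sup>2\<close>, so that the constant is squared.\<close>

lemma projection_bound:
  assumes e: "\<And>j. eig_bound TYPE('n) q j (D j)" "\<And>j. D j > 0"
  shows "(\<integral>\<^sup>+x. ennreal (norm (eigf (lcoef f) j x) powr q) \<partial>lborel) \<le> ennreal ((D j * A) powr q)"
proof -
  define c where "c = lcoef f"
  define S where "S = sqrt (\<Sum>\<nu>\<in>multi_indices j. (norm (c \<nu>))\<^sup>2)"
  have S2: "S\<^sup>2 = (\<Sum>\<nu>\<in>multi_indices j. (norm (c \<nu>))\<^sup>2)" by (simp add: S_def sum_nonneg)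
  have S0: "S \<ge> 0" by (simp add: S_def sum_nonneg)
  show ?thesis
  proof (cases "S = 0")
    case True
    then have "\<forall>\<nu>\<in>multi_indices j. (norm (c \<nu>))\<^sup>2 = 0"
      using S2 by (subst sum_nonneg_eq_0_iff[symmetric]) auto
    then have "eigf c j x = 0" for x by (simp add: eigf_def)
    then show ?thesis by (simp add: c_def)
  next
    case False
    then have S: "S > 0" using S0 by simp
    \<comment> \<open>The extremal direction: pairing f with \<open>eigf d j\<close> returns S
      itself, so the pairing bound controls S by \<open>A * sqrt (D j)\<close>. Rescaling
      contributes the second factor \<open>sqrt (D j)\<close>.\<close>
    define d where "d \<nu> = c \<nu> / of_real S" for \<nu>
    have nd: "(norm (d \<nu>))\<^sup>2 = (norm (c \<nu>))\<^sup>2 / S\<^sup>2" for \<nu>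
      using S by (simp add: d_def norm_divide power_divide)
    have d1: "(\<Sum>\<nu>\<in>multi_indices j. (norm (d \<nu>))\<^sup>2) = 1"
      unfolding nd sum_divide_distrib[symmetric] S2[symmetric] using S by simp
    have "c = (\<lambda>\<nu>. of_real S * d \<nu>)" using S by (auto simp: d_def)
    then have cd: "eigf c j x = of_real S * eigf d j x" for x by (simp only: eigf_mult)
    have int: "integrable lebesgue (\<lambda>x. f x * complex_of_real (hermite_vec \<nu> x))" for \<nu>
      by (rule integrable_Lp_hermite_vec[OF e])
    have fd: "f x * cnj (eigf d j x) = (\<Sum>\<nu>\<in>multi_indices j. cnj (d \<nu>) * (f x * of_real (hermite_vec \<nu> x)))" for x
      by (simp add: eigf_def cnj_sum sum_distrib_left algebra_simps)
    have "(LINT x|lebesgue. f x * cnj (eigf d j x)) = (\<Sum>\<nu>\<in>multi_indices j. cnj (d \<nu>) * c \<nu>)"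
      unfolding fd c_def lcoef_def
      by (subst Bochner_Integration.integral_sum, intro integrable_mult_right int) simp
    also have "\<dots> = (\<Sum>\<nu>\<in>multi_indices j. of_real ((norm (c \<nu>))\<^sup>2)) / of_real S"
      unfolding sum_divide_distrib complex_norm_square by (simp add: d_def mult.commute)
    also have "\<dots> = of_real (S\<^sup>2 / S)" unfolding S2 by simp
    also have "S\<^sup>2 / S = S" using S by (simp add: power2_eq_square)
    finally have "S = norm (LINT x|lebesgue. f x * cnj (eigf d j x))" using S0 by simp
    then have "ennreal S \<le> (\<integral>\<^sup>+x. ennreal (norm (f x * cnj (eigf d j x))) \<partial>lebesgue)"
      using integral_norm_bound_ennreal[of lebesgue "\<lambda>x. f x * cnj (eigf d j x)"]
      unfolding fd by (simp add: int)
    also have "\<dots> \<le> ennreal (A * sqrt (D j))"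
      using pairing_bound[OF e d1] by (simp add: norm_mult)
    finally have SA: "S \<le> A * sqrt (D j)" using A e(2)[of j] by (simp add: ennreal_le_iff)
    have "(\<integral>\<^sup>+x. ennreal (norm (eigf c j x) powr q) \<partial>lborel) = (\<integral>\<^sup>+x. ennreal (S powr q) * ennreal (norm (eigf d j x) powr q) \<partial>lborel)"
      unfolding cd using S by (simp add: norm_mult powr_mult ennreal_mult)
    also have "\<dots> = ennreal (S powr q) * (\<integral>\<^sup>+x. ennreal (norm (eigf d j x) powr q) \<partial>lborel)"
      by (rule nn_integral_cmult) measurable
    also have "\<dots> = ennreal (S powr q) * (\<integral>\<^sup>+x. ennreal (norm (eigf d j x) powr q) \<partial>lebesgue)"
      by (subst nn_integral_lebesgue_eq) auto
    also have "\<dots> \<le> ennreal (S powr q) * ennreal (sqrt (D j) powr q)"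
      by (intro mult_left_mono eig_bound_sqrt e d1) auto
    also have "\<dots> = ennreal ((S * sqrt (D j)) powr q)" by (simp add: powr_mult ennreal_mult)
    also have "\<dots> \<le> ennreal ((D j * A) powr q)"
    proof (intro ennreal_leI powr_mono2)
      have "S * sqrt (D j) \<le> (A * sqrt (D j)) * sqrt (D j)" using SA e(2)[of j] by (intro mult_right_mono) auto
      also have "\<dots> = D j * A" using e(2)[of j] by simp
      finally show "S * sqrt (D j) \<le> D j * A" .
    qed (use pq S0 e(2)[of j] in \<open>auto simp: less_imp_le\<close>)
    finally show ?thesis by (simp add: c_def)
  qed
qed

end

section \<open>Summation over the eigenspaces\<close>

lemma epowr_le:
  assumes "I \<le> ennreal (B powr q)" "B \<ge> 0" "q > 0"
  shows "epowr I (1 / q) \<le> ennreal B"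
proof -
  have fin: "I < \<infinity>" using assms(1) by (rule le_less_trans) simp
  then have "enn2real I \<le> B powr q"
    using assms(1) by (metis enn2real_ennreal enn2real_mono ennreal_less_top powr_ge_zero)
  then have "enn2real I powr (1 / q) \<le> (B powr q) powr (1 / q)" using assms by (intro powr_mono2) auto
  also have "\<dots> = B" using assms by (cases "B = 0") (auto simp: powr_powr)
  finally show ?thesis using fin by (auto simp: epowr_def intro: ennreal_leI)
qed

text \<open>Weights dominating the \<open>j\<close>-th term of the series, \<open>N\<close> being the dimension.\<close>

definition pm_weight :: "nat \<Rightarrow> real \<Rightarrow> real \<Rightarrow> real \<Rightarrow> nat \<Rightarrow> real" where
  "pm_weight N K \<kappa> e j = K * real (2 * j + N) powr (- \<kappa>) * (real j + 2) powr e"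

text \<open>As 2j + N >= (j + 2)/2, the weights are dominated by a multiple of
  \<open>(j + 2)^(e - \<kappa>)\<close>, whose exponent is below -1.\<close>

lemma pm_weight:
  assumes K: "K > 0" and \<kappa>: "\<kappa> \<ge> 0" and N: "N \<ge> 1" and e: "\<kappa> - e > 1"
  shows "pm_weight N K \<kappa> e j > 0" "summable (pm_weight N K \<kappa> e)" "suminf (pm_weight N K \<kappa> e) > 0"
proof -
  show pos: "pm_weight N K \<kappa> e j > 0" for j using K N by (simp add: pm_weight_def)
  have s: "summable (\<lambda>j. real (j + 2) powr (e - \<kappa>))"
    using summable_real_powr_iff[of "e - \<kappa>"] e summable_iff_shift[of "\<lambda>j. real j powr (e - \<kappa>)" 2] by simp
  show summ: "summable (pm_weight N K \<kappa> e)"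
  proof (rule summable_comparison_test')
    show "summable (\<lambda>j. K * 2 powr \<kappa> * real (j + 2) powr (e - \<kappa>))" by (intro summable_mult s)
    fix j
    have "real (2 * j + N) powr (- \<kappa>) \<le> ((real j + 2) / 2) powr (- \<kappa>)"
      using \<kappa> N by (intro powr_mono2') auto
    also have "\<dots> = 2 powr \<kappa> * (real j + 2) powr (- \<kappa>)" by (simp add: powr_divide powr_minus field_simps)
    finally have "pm_weight N K \<kappa> e j \<le> K * (2 powr \<kappa> * (real j + 2) powr (- \<kappa>)) * (real j + 2) powr e"
      unfolding pm_weight_def using K by (intro mult_right_mono mult_left_mono) auto
    also have "\<dots> = K * 2 powr \<kappa> * real (j + 2) powr (e - \<kappa>)"
      by (simp add: add.commute mult.assoc flip: powr_add)
    finally show "norm (pm_weight N K \<kappa> e j) \<le> K * 2 powr \<kappa> * real (j + 2) powr (e - \<kappa>)"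
      using pos[of j] by simp
  qed
  show "suminf (pm_weight N K \<kappa> e) > 0" by (rule suminf_pos[OF summ]) (rule pos)
qed

text \<open>The j-th term is at most \<open>A w_j v_j\<close>, where v is scaled so that its q-th
  moment is at most one. Jensen bounds the q-th power of the series pointwise by
  \<open>A^q W^(q - 1) Z\<close>, and Z has integral at most W. That Z is finite almost everywhere
  also gives convergence of the series.\<close>

lemma pm_op_Lq_bound:
  fixes m :: "real^'n \<Rightarrow> real \<Rightarrow> complex" and f :: "real^'n \<Rightarrow> complex"
  assumes m: "\<And>\<xi>. continuous_on UNIV (\<lambda>x. m x \<xi>)" "\<And>x \<xi>. \<xi> \<ge> 1 \<Longrightarrow> norm (m x \<xi>) \<le> K * \<xi> powr (- \<kappa>)"
    and K: "K > 0" "\<kappa> \<ge> 0" and C: "C > 0" and eb: "\<And>j. eig_bound TYPE('n) q j (C * (real j + 2) powr e)"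
    and e: "\<kappa> - e > 1" and pq: "p > 1" "q > 1" "1 / p + 1 / q = 1" and A: "A > 0"
    and f: "f \<in> borel_measurable lebesgue" "(\<integral>\<^sup>+x. ennreal (norm (f x) powr p) \<partial>lebesgue) \<le> ennreal (A powr p)"
  shows "AE x in lebesgue. summable (\<lambda>j. m x (real (2 * j + CARD('n))) * eigf (lcoef f) j x)"
    and "(\<integral>\<^sup>+x. ennreal (norm (pm_op m f x) powr q) \<partial>lebesgue)
      \<le> ennreal ((suminf (pm_weight CARD('n) (K * C) \<kappa> e) * A) powr q)"
proof -
  define w where "w = pm_weight CARD('n) (K * C) \<kappa> e"
  define W where "W = suminf w"
  define D where "D j = C * (real j + 2) powr e" for j
  have D0: "D j > 0" for j using C by (simp add: D_def)
  have KC: "K * C > 0" using K C by simp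
  have n1: "CARD('n) \<ge> 1" by (simp add: Suc_le_eq)
  note w = pm_weight[OF KC K(2) n1 e, folded w_def]
  have w0: "0 \<le> w j" for j using w(1)[of j] by simp
  define v where "v x j = norm (eigf (lcoef f) j x) / (D j * A)" for x j
  have v0: "0 \<le> v x j" for x j using D0[of j] A by (simp add: v_def)
  have [measurable]: "(\<lambda>x. v x j) \<in> borel_measurable borel" for j unfolding v_def by measurable
  have vint: "(\<integral>\<^sup>+x. ennreal (v x j powr q) \<partial>lborel) \<le> 1" for j
  proof -
    have DA: "D j * A > 0" using D0 A by simp
    have "(\<integral>\<^sup>+x. ennreal (v x j powr q) \<partial>lborel) = (\<integral>\<^sup>+x. ennreal (norm (eigf (lcoef f) j x) powr q) / ennreal ((D j * A) powr q) \<partial>lborel)"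
    proof (rule nn_integral_cong)
      fix x
      have b: "(D j * A) powr q > 0" using DA by (simp only: powr_gt_zero)
      show "ennreal (v x j powr q) = ennreal (norm (eigf (lcoef f) j x) powr q) / ennreal ((D j * A) powr q)"
        unfolding v_def powr_divide by (rule divide_ennreal[OF _ b, symmetric]) simp
    qed
    also have "\<dots> = (\<integral>\<^sup>+x. ennreal (norm (eigf (lcoef f) j x) powr q) \<partial>lborel) / ennreal ((D j * A) powr q)"
      by (rule nn_integral_divide) measurable
    also have "\<dots> \<le> ennreal ((D j * A) powr q) / ennreal ((D j * A) powr q)"
      using projection_bound[OF pq A f eb, folded D_def, of j] D0 by (intro divide_right_mono_ennreal) auto
    also have "\<dots> = 1" using DA D0[of j] A by (subst divide_ennreal) auto
    finally show ?thesis .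
  qed
  define Z where "Z x = (\<Sum>j. ennreal (w j * v x j powr q))" for x
  have Zm[measurable]: "Z \<in> borel_measurable borel" unfolding Z_def[abs_def] by measurable
  have Zint: "(\<integral>\<^sup>+x. Z x \<partial>lborel) \<le> ennreal W"
  proof -
    have "(\<integral>\<^sup>+x. Z x \<partial>lborel) = (\<Sum>j. \<integral>\<^sup>+x. ennreal (w j * v x j powr q) \<partial>lborel)"
      unfolding Z_def by (rule nn_integral_suminf) measurable
    also have "\<dots> \<le> (\<Sum>j. ennreal (w j))"
    proof (rule suminf_le)
      fix j
      have "(\<integral>\<^sup>+x. ennreal (w j * v x j powr q) \<partial>lborel) = ennreal (w j) * (\<integral>\<^sup>+x. ennreal (v x j powr q) \<partial>lborel)"
        using w0[of j] by (simp add: ennreal_mult nn_integral_cmult)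
      also have "\<dots> \<le> ennreal (w j) * 1" by (intro mult_left_mono vint) auto
      finally show "(\<integral>\<^sup>+x. ennreal (w j * v x j powr q) \<partial>lborel) \<le> ennreal (w j)" by simp
    qed auto
    also have "\<dots> = ennreal W" unfolding W_def by (rule suminf_ennreal2[OF w0 w(2)])
    finally show ?thesis .
  qed
  have term_le: "norm (m x (real (2 * j + CARD('n))) * eigf (lcoef f) j x) \<le> A * (w j * v x j)" for x j
  proof -
    have "norm (m x (real (2 * j + CARD('n)))) \<le> K * real (2 * j + CARD('n)) powr (- \<kappa>)"
      using n1 by (intro m) linarith
    then have "norm (m x (real (2 * j + CARD('n))) * eigf (lcoef f) j x)
        \<le> (K * real (2 * j + CARD('n)) powr (- \<kappa>)) * norm (eigf (lcoef f) j x)"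
      unfolding norm_mult by (intro mult_right_mono) auto
    also have "norm (eigf (lcoef f) j x) = D j * A * v x j" using D0[of j] A by (simp add: v_def)
    also have "K * real (2 * j + CARD('n)) powr (- \<kappa>) * (D j * A * v x j) = A * (w j * v x j)"
      by (simp add: w_def pm_weight_def D_def)
    finally show ?thesis .
  qed
  have good: "summable (\<lambda>j. m x (real (2 * j + CARD('n))) * eigf (lcoef f) j x) \<and>
      ennreal (norm (pm_op m f x) powr q) \<le> ennreal (A powr q * W powr (q - 1)) * Z x"
    if Z: "Z x \<noteq> \<infinity>" for x
  proof -
    have s: "summable (\<lambda>j. w j * v x j powr q)"
      using Z w0 unfolding Z_def by (intro summable_suminf_not_top) auto
    have Zx: "Z x = ennreal (\<Sum>j. w j * v x j powr q)"
      unfolding Z_def using w0 by (intro suminf_ennreal2[OF _ s]) auto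
    note ws = weighted_sum_powr_le[OF w0 w(2) w(3) v0 pq(2) s]
    have sA: "summable (\<lambda>j. A * (w j * v x j))" by (intro summable_mult ws(1))
    have sn: "summable (\<lambda>j. norm (m x (real (2 * j + CARD('n))) * eigf (lcoef f) j x))"
      by (rule summable_comparison_test'[OF sA, of 0]) (use term_le in simp)
    have "norm (pm_op m f x) \<le> (\<Sum>j. norm (m x (real (2 * j + CARD('n))) * eigf (lcoef f) j x))"
      unfolding pm_op_def by (rule summable_norm[OF sn])
    also have "\<dots> \<le> (\<Sum>j. A * (w j * v x j))" by (rule suminf_le[OF term_le sn sA])
    also have "\<dots> = A * (\<Sum>j. w j * v x j)" by (rule suminf_mult[OF ws(1)])
    finally have "norm (pm_op m f x) powr q \<le> (A * (\<Sum>j. w j * v x j)) powr q"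
      using pq by (intro powr_mono2) auto
    also have "\<dots> = A powr q * (\<Sum>j. w j * v x j) powr q" by (rule powr_mult)
    also have "\<dots> \<le> A powr q * (W powr (q - 1) * (\<Sum>j. w j * v x j powr q))"
      using ws(2) by (intro mult_left_mono) (auto simp: W_def)
    finally have "ennreal (norm (pm_op m f x) powr q) \<le> ennreal (A powr q * W powr (q - 1)) * Z x"
      unfolding Zx by (simp add: ennreal_leI mult.assoc flip: ennreal_mult')
    then show ?thesis using summable_norm_cancel[OF sn] by blast
  qed
  have Zfin: "AE x in lborel. Z x \<noteq> \<infinity>"
    by (rule nn_integral_PInf_AE) (use Zint in \<open>auto simp: top_unique\<close>)
  have AE: "AE x in lebesgue. summable (\<lambda>j. m x (real (2 * j + CARD('n))) * eigf (lcoef f) j x) \<and>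
      ennreal (norm (pm_op m f x) powr q) \<le> ennreal (A powr q * W powr (q - 1)) * Z x"
    by (rule AE_completion[OF eventually_mono[OF Zfin good]])
  then show "AE x in lebesgue. summable (\<lambda>j. m x (real (2 * j + CARD('n))) * eigf (lcoef f) j x)"
    by (rule eventually_mono) blast
  have "(\<integral>\<^sup>+x. ennreal (norm (pm_op m f x) powr q) \<partial>lebesgue) \<le> (\<integral>\<^sup>+x. ennreal (A powr q * W powr (q - 1)) * Z x \<partial>lebesgue)"
    by (rule nn_integral_mono_AE, rule eventually_mono[OF AE]) blast
  also have "\<dots> = (\<integral>\<^sup>+x. ennreal (A powr q * W powr (q - 1)) * Z x \<partial>lborel)"
    by (rule nn_integral_lebesgue_eq) measurable
  also have "\<dots> = ennreal (A powr q * W powr (q - 1)) * (\<integral>\<^sup>+x. Z x \<partial>lborel)"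
    by (rule nn_integral_cmult) measurable
  also have "\<dots> \<le> ennreal (A powr q * W powr (q - 1)) * ennreal W" by (intro mult_left_mono Zint) auto
  also have "\<dots> = ennreal (A powr q * W powr (q - 1) * W)" using w(3) by (simp add: ennreal_mult W_def)
  also have "A powr q * W powr (q - 1) * W = (W * A) powr q"
    using w(3) by (simp add: W_def powr_mult powr_diff)
  finally show "(\<integral>\<^sup>+x. ennreal (norm (pm_op m f x) powr q) \<partial>lebesgue)
      \<le> ennreal ((suminf (pm_weight CARD('n) (K * C) \<kappa> e) * A) powr q)" by (simp add: W_def w_def)
qed

lemma pseudo_multiplier_bounded:
  fixes m :: "real^'n \<Rightarrow> real \<Rightarrow> complex"
  assumes m: "\<And>\<xi>. continuous_on UNIV (\<lambda>x. m x \<xi>)" "\<And>x \<xi>. \<xi> \<ge> 1 \<Longrightarrow> norm (m x \<xi>) \<le> K * \<xi> powr (- \<kappa>)"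
    and K: "K > 0" "\<kappa> \<ge> 0" and C: "C > 0" and eb: "\<And>j. eig_bound TYPE('n) q j (C * (real j + 2) powr e)"
    and e: "\<kappa> - e > 1" and pq: "p > 1" "q > 1" "1 / p + 1 / q = 1"
  shows "(\<forall>f. test_function f \<longrightarrow> (AE x in lebesgue. summable (pseudo_multiplier_term m f x))) \<and>
     extends_to_bounded_operator (ennreal p) (ennreal q) (pseudo_multiplier m)"
proof (rule extends_by_pm_op[OF m(1)])
  define W where "W = suminf (pm_weight CARD('n) (K * C) \<kappa> e)"
  have KC: "K * C > 0" using K C by simp
  have n1: "CARD('n) \<ge> 1" by (simp add: Suc_le_eq)
  have W: "W > 0" unfolding W_def by (rule pm_weight(3)[OF KC K(2) n1 e])
  have D0: "C * (real j + 2) powr e > 0" for j using C by simp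
  have LpD: "f \<in> borel_measurable lebesgue \<and> (\<exists>r\<ge>0. (\<integral>\<^sup>+x. ennreal (norm (f x) powr p) \<partial>lebesgue) = ennreal r)"
    if "f \<in> Lp (ennreal p)" for f :: "real^'n \<Rightarrow> complex"
  proof -
    have "f \<in> borel_measurable lebesgue" "(\<integral>\<^sup>+x. ennreal (norm (f x) powr p) \<partial>lebesgue) \<noteq> \<infinity>"
      using that pq by (auto simp: Lp_def Lp_norm_def epowr_def)
    then show ?thesis by (metis ennreal_cases infinity_ennreal_def)
  qed
  have LpA: "\<exists>A>0. (\<integral>\<^sup>+x. ennreal (norm (f x) powr p) \<partial>lebesgue) \<le> ennreal (A powr p)"
    if f: "f \<in> Lp (ennreal p)" for f :: "real^'n \<Rightarrow> complex"
  proof -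
    obtain r where r: "r \<ge> 0" "(\<integral>\<^sup>+x. ennreal (norm (f x) powr p) \<partial>lebesgue) = ennreal r" using LpD[OF f] by blast
    \<comment> \<open>For convergence any positive bound A serves; the maximum with 1 avoids A =
      0.\<close>
    have "(max r 1 powr (1 / p)) powr p = max r 1" using pq by (simp add: powr_powr)
    then show ?thesis using r by (intro exI[of _ "max r 1 powr (1 / p)"]) (auto intro: ennreal_leI)
  qed
  show "integrable lebesgue (\<lambda>x. f x * complex_of_real (hermite_vec \<nu> x))" if "f \<in> Lp (ennreal p)" for f :: "real^'n \<Rightarrow> complex" and \<nu>
    using LpA[OF that] LpD[OF that] integrable_Lp_hermite_vec[OF pq _ _ _ eb D0] by blast
  show "AE x in lebesgue. summable (\<lambda>j. m x (real (2 * j + CARD('n))) * eigf (lcoef f) j x)" if "f \<in> Lp (ennreal p)" for f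
    using LpA[OF that] LpD[OF that] pm_op_Lq_bound(1)[OF m K C eb e pq] by blast
  show "W \<ge> 0" using W by simp
  show "f \<in> Lp (ennreal p)" if "test_function f" for f :: "real^'n \<Rightarrow> complex"
    using test_function_Lp[OF that] pq by simp
  show "Lp_norm (ennreal q) (pm_op m f) \<le> ennreal W * Lp_norm (ennreal p) f" if f: "f \<in> Lp (ennreal p)" for f
  proof -
    obtain r where r: "r \<ge> 0" "(\<integral>\<^sup>+x. ennreal (norm (f x) powr p) \<partial>lebesgue) = ennreal r" using LpD[OF f] by blast
    have fm: "f \<in> borel_measurable lebesgue" using LpD[OF f] by blast
    have nq: "Lp_norm (ennreal q) (pm_op m f) = epowr (\<integral>\<^sup>+x. ennreal (norm (pm_op m f x) powr q) \<partial>lebesgue) (1 / q)"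
      using pq by (simp add: Lp_norm_def)
    have np: "Lp_norm (ennreal p) f = ennreal (r powr (1 / p))"
      using pq r by (simp add: Lp_norm_def epowr_def)
    show ?thesis
    \<comment> \<open>The estimate divides by A, so r = 0 is separate: f then vanishes almost
      everywhere and all its coefficients are zero.\<close>
    proof (cases "r = 0")
      case True
      have "(\<lambda>x. ennreal (norm (f x) powr p)) \<in> borel_measurable lebesgue" using fm by measurable
      then have "AE x in lebesgue. ennreal (norm (f x) powr p) = 0"
        using r True by (simp add: nn_integral_0_iff_AE)
      then have "AE x in lebesgue. f x = 0" by (auto elim!: eventually_mono)
      then have "lcoef f \<nu> = 0" for \<nu>
        unfolding lcoef_def by (intro integral_eq_zero_AE) (auto elim!: eventually_mono)
      then have "pm_op m f x = 0" for x by (simp add: pm_op_def eigf_def)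
      then show ?thesis using pq unfolding nq by (simp add: epowr_def)
    next
      case False
      define A where "A = r powr (1 / p)"
      have A: "A > 0" using r False by (simp add: A_def)
      have "A powr p = r" using r False pq by (simp add: A_def powr_powr)
      then have "(\<integral>\<^sup>+x. ennreal (norm (f x) powr p) \<partial>lebesgue) \<le> ennreal (A powr p)" using r by simp
      then have "(\<integral>\<^sup>+x. ennreal (norm (pm_op m f x) powr q) \<partial>lebesgue) \<le> ennreal ((W * A) powr q)"
        using pm_op_Lq_bound(2)[OF m K C eb e pq A fm] by (simp only: W_def)
      then have "epowr (\<integral>\<^sup>+x. ennreal (norm (pm_op m f x) powr q) \<partial>lebesgue) (1 / q) \<le> ennreal (W * A)"
        using W A pq by (intro epowr_le) auto
      then show ?thesis unfolding nq np using W A by (simp add: A_def ennreal_mult)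
    qed
  qed
qed

text \<open>For p = 1 the dual exponent is infinite, and the kernel itself replaces duality: it is
  at most the mean of two diagonal values. The estimate holds at every x, so the series converges
  everywhere.\<close>

lemma pseudo_multiplier_bounded_L1:
  fixes m :: "real^'n \<Rightarrow> real \<Rightarrow> complex"
  assumes m: "\<And>\<xi>. continuous_on UNIV (\<lambda>x. m x \<xi>)" "\<And>x \<xi>. \<xi> \<ge> 1 \<Longrightarrow> norm (m x \<xi>) \<le> K * \<xi> powr (- \<kappa>)"
    and K: "K > 0" "\<kappa> \<ge> 0" and C: "C > 0" and pk: "\<And>j (x::real^'n). proj_kernel j x x \<le> C * (real j + 2) powr e"
    and e: "\<kappa> - e > 1"
  shows "(\<forall>f. test_function f \<longrightarrow> (AE x in lebesgue. summable (pseudo_multiplier_term m f x))) \<and>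
     extends_to_bounded_operator (ennreal 1) \<infinity> (pseudo_multiplier m)"
proof (rule extends_by_pm_op[OF m(1)])
  define w where "w = pm_weight CARD('n) (K * C) \<kappa> e"
  define W where "W = suminf w"
  have KC: "K * C > 0" using K C by simp
  have n1: "CARD('n) \<ge> 1" by (simp add: Suc_le_eq)
  note w = pm_weight[OF KC K(2) n1 e, folded w_def]
  have L1: "integrable lebesgue f" if "f \<in> Lp (ennreal 1)" for f :: "real^'n \<Rightarrow> complex"
  proof -
    have "f \<in> borel_measurable lebesgue" "(\<integral>\<^sup>+x. ennreal (norm (f x)) \<partial>lebesgue) \<noteq> \<infinity>"
      using that by (auto simp: Lp_def Lp_norm_def epowr_def)
    then show ?thesis by (simp add: integrable_iff_bounded top.not_eq_extremum)
  qed
  show int: "integrable lebesgue (\<lambda>x. f x * complex_of_real (hermite_vec \<nu> x))"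
    if "f \<in> Lp (ennreal 1)" for f :: "real^'n \<Rightarrow> complex" and \<nu>
  proof -
    obtain B where B: "\<And>x. \<bar>hermite_vec \<nu> x\<bar> \<le> B" using bounded_hermite_vec by blast
    have [measurable]: "(\<lambda>x. complex_of_real (hermite_vec \<nu> x)) \<in> borel_measurable lebesgue"
      by (rule measurable_lebesgueI) measurable
    have "integrable lebesgue (\<lambda>x. of_real B * f x)" using L1[OF that] by (rule integrable_mult_right)
    then show ?thesis
    proof (rule Bochner_Integration.integrable_bound)
      show "AE x in lebesgue. norm (f x * complex_of_real (hermite_vec \<nu> x)) \<le> norm (of_real B * f x)"
      proof (rule AE_I2)
        fix x
        have "norm (f x) * \<bar>hermite_vec \<nu> x\<bar> \<le> norm (f x) * \<bar>B\<bar>"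
          using B[of x] by (intro mult_left_mono) auto
        then show "norm (f x * complex_of_real (hermite_vec \<nu> x)) \<le> norm (of_real B * f x)"
          by (simp add: norm_mult mult.commute)
      qed
    qed (use L1[OF that] in measurable)
  qed
  have term_le: "norm (m x (real (2 * j + CARD('n))) * eigf (lcoef f) j x) \<le> w j * (LINT y|lebesgue. norm (f y))"
    if f: "f \<in> Lp (ennreal 1)" for f :: "real^'n \<Rightarrow> complex" and x j
  proof -
    define P where "P = C * (real j + 2) powr e"
    have fi: "integrable lebesgue (\<lambda>y. norm (f y))" using L1[OF f] by simp
    have eq: "f y * of_real (proj_kernel j y x) = (\<Sum>\<nu>\<in>multi_indices j. (f y * of_real (hermite_vec \<nu> y)) * of_real (hermite_vec \<nu> x))" for y
      by (simp add: proj_kernel_def sum_distrib_left mult.assoc)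
    have "eigf (lcoef f) j x = (LINT y|lebesgue. f y * of_real (proj_kernel j y x))"
      unfolding eq eigf_def lcoef_def
      by (subst Bochner_Integration.integral_sum) (auto intro!: integrable_mult_left int f)
    then have "norm (eigf (lcoef f) j x) \<le> (LINT y|lebesgue. norm (f y * of_real (proj_kernel j y x)))"
      by (simp only: integral_norm_bound)
    also have "\<dots> \<le> (LINT y|lebesgue. P * norm (f y))"
    proof (rule integral_mono')
      show "integrable lebesgue (\<lambda>y. P * norm (f y))" using fi by simp
      show "0 \<le> P * norm (f y)" for y using C by (simp add: P_def)
      fix y
      have "\<bar>proj_kernel j y x\<bar> \<le> P" using abs_proj_kernel_le[of j y x] pk[of j x] pk[of j y] by (simp add: P_def)
      then have "norm (f y) * \<bar>proj_kernel j y x\<bar> \<le> norm (f y) * P" by (intro mult_left_mono) auto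
      then show "norm (f y * of_real (proj_kernel j y x)) \<le> P * norm (f y)" by (simp add: norm_mult mult.commute)
    qed
    also have "\<dots> = P * (LINT y|lebesgue. norm (f y))" by simp
    finally have ef: "norm (eigf (lcoef f) j x) \<le> P * (LINT y|lebesgue. norm (f y))" .
    have "norm (m x (real (2 * j + CARD('n)))) \<le> K * real (2 * j + CARD('n)) powr (- \<kappa>)"
      using n1 by (intro m) linarith
    then have "norm (m x (real (2 * j + CARD('n))) * eigf (lcoef f) j x)
        \<le> (K * real (2 * j + CARD('n)) powr (- \<kappa>)) * (P * (LINT y|lebesgue. norm (f y)))"
      unfolding norm_mult using ef K by (intro mult_mono) auto
    also have "\<dots> = w j * (LINT y|lebesgue. norm (f y))" by (simp add: w_def pm_weight_def P_def)
    finally show ?thesis .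
  qed
  have sn: "summable (\<lambda>j. norm (m x (real (2 * j + CARD('n))) * eigf (lcoef f) j x))"
    if "f \<in> Lp (ennreal 1)" for f :: "real^'n \<Rightarrow> complex" and x
    by (rule summable_comparison_test'[OF summable_mult2[OF w(2), of "LINT y|lebesgue. norm (f y)"], of 0])
       (use term_le[OF that] in simp)
  show "AE x in lebesgue. summable (\<lambda>j. m x (real (2 * j + CARD('n))) * eigf (lcoef f) j x)" if "f \<in> Lp (ennreal 1)" for f
    by (rule AE_I2) (rule summable_norm_cancel[OF sn[OF that]])
  show "W \<ge> 0" using w(3) by (simp add: W_def)
  show "f \<in> Lp (ennreal 1)" if "test_function f" for f :: "real^'n \<Rightarrow> complex"
    using test_function_Lp[OF that, of 1] by simp
  show "Lp_norm \<infinity> (pm_op m f) \<le> ennreal W * Lp_norm (ennreal 1) f" if f: "f \<in> Lp (ennreal 1)" for f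
  proof -
    have fi: "integrable lebesgue (\<lambda>y. norm (f y))" using L1[OF f] by simp
    have "(\<integral>\<^sup>+y. ennreal (norm (f y)) \<partial>lebesgue) = ennreal (LINT y|lebesgue. norm (f y))"
      by (rule nn_integral_eq_integral[OF fi]) simp
    then have n1: "Lp_norm (ennreal 1) f = ennreal (LINT y|lebesgue. norm (f y))"
      by (simp add: Lp_norm_def epowr_def)
    have "norm (pm_op m f x) \<le> W * (LINT y|lebesgue. norm (f y))" for x
    proof -
      have "norm (pm_op m f x) \<le> (\<Sum>j. norm (m x (real (2 * j + CARD('n))) * eigf (lcoef f) j x))"
        unfolding pm_op_def by (rule summable_norm[OF sn[OF f]])
      also have "\<dots> \<le> (\<Sum>j. w j * (LINT y|lebesgue. norm (f y)))"
        by (rule suminf_le[OF term_le[OF f] sn[OF f] summable_mult2[OF w(2)]])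
      also have "\<dots> = W * (LINT y|lebesgue. norm (f y))" unfolding W_def by (rule suminf_mult2[OF w(2), symmetric])
      finally show ?thesis .
    qed
    then have "esssup lebesgue (\<lambda>x. ennreal (norm (pm_op m f x))) \<le> ennreal (W * (LINT y|lebesgue. norm (f y)))"
      using measurable_lebesgueI[OF pm_op_measurable[OF m(1), where f = f]]
      by (intro esssup_I AE_I2 ennreal_leI) measurable
    then show ?thesis unfolding n1 using w(3) by (simp add: Lp_norm_def ennreal_mult W_def)
  qed
qed


text \<open>The exponent p' lives in the extended reals, where 1/0 is infinite and 1 divided by
  infinity is 0. The first convention excludes p' = 0, the second ties an infinite p' to p =
  1.\<close>

lemma conjugate_exponent_cases:
  assumes "1 / ennreal p + 1 / p' = 1" "p \<ge> 1"
  shows "p = 1 \<Longrightarrow> p' = \<infinity>" "p > 1 \<Longrightarrow> p' = ennreal (p / (p - 1))"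
proof -
  have e: "1 / ennreal p = ennreal (1 / p)"
    using divide_ennreal[of 1 p] assms(2) by simp
  have conj: "r > 0 \<and> 1 / p + 1 / r = 1" if r: "p' = ennreal r" "r \<ge> 0" for r
  proof -
    have "r \<noteq> 0"
    proof
      assume "r = 0"
      then have "1 / p' = \<top>" using r by (simp add: ennreal_divide_eq_top_iff)
      then show False using assms(1) by simp
    qed
    then have r0: "r > 0" using r by simp
    then have "1 / p' = ennreal (1 / r)" using divide_ennreal[of 1 r] r by simp
    then have "ennreal (1 / p + 1 / r) = ennreal 1"
      using assms e r0 by (simp add: ennreal_plus)
    moreover have "1 / p + 1 / r \<ge> 0" using assms(2) r0 by simp
    ultimately show ?thesis using r0 by (simp only: ennreal_inj)
  qed
  show "p' = \<infinity>" if p1: "p = 1"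
  proof (cases p')
    case (real r)
    then have "r > 0" "1 / r = 0" using conj[of r] p1 by auto
    then show ?thesis by simp
  qed simp
  show "p' = ennreal (p / (p - 1))" if p1: "p > 1"
  proof (cases p')
    case (real r)
    then have "r > 0" "1 / p + 1 / r = 1" using conj[of r] by auto
    then have "r = p / (p - 1)" using p1 by (simp add: field_simps)
    then show ?thesis using real by simp
  next
    case top
    then have "ennreal (1 / p) = ennreal 1" using assms(1) e by (simp add: ennreal_divide_top)
    then have "1 / p = 1" using p1 by (subst (asm) ennreal_inj) auto
    then show ?thesis using p1 by simp
  qed
qed

theorem theorem2p13:
  fixes m :: "real ^ 'n \<Rightarrow> real \<Rightarrow> complex"
    and \<psi> :: "real \<Rightarrow> complex"
    and s p :: real and p' :: ennreal
    and n :: nat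
  assumes n: "n = CARD('n)"
    and psi: "test_function \<psi>" "supp \<psi> \<subseteq> {1 / 2..4}" "\<And>t. t \<in> {1..2} \<Longrightarrow> \<psi> t = 1"
    and cont: "continuous_on UNIV (\<lambda>(x, \<xi>). m x \<xi>)"
    and s: "s > 0"
    and hoermander: "hoermander_norm \<psi> s m < \<infinity>"
    and conjugate: "1 / ennreal p + 1 / p' = 1"
    and cases:
      "(n \<ge> 2 \<and> 1 \<le> p \<and> p \<le> 2 * real n / (real n + 2) \<and> s > (real n + 1) / 2 + delta n p) \<or>
       (n \<ge> 2 \<and> 2 * real n / (real n + 2) < p \<and> p \<le> 2 \<and> s > 3 * real n / 2) \<or>
       (n = 1 \<and> 4 / 3 < p \<and> p \<le> 2 \<and> s > 2 - 1 / p) \<or>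
       (n = 1 \<and> p = 4 / 3 \<and> s > 3 / 2) \<or>
       (n = 1 \<and> 1 < p \<and> p < 4 / 3 \<and> s > 1 + 1 / (3 * p))"
  shows "(\<forall>f. test_function f \<longrightarrow> (AE x in lebesgue. summable (pseudo_multiplier_term m f x))) \<and>
         extends_to_bounded_operator (ennreal p) p' (pseudo_multiplier m)"
proof -
  define \<kappa> where "\<kappa> = s - real n / 2"
  \<comment> \<open>The reciprocal of p', so that q is 1/c and p = 1 corresponds to c = 0.\<close>
  define c where "c = 1 - 1 / p"
  have mcont: "continuous_on UNIV (\<lambda>x. m x \<xi>)" for \<xi>
    using continuous_on_compose2[OF cont continuous_on_Pair[OF continuous_on_id continuous_on_const[of UNIV \<xi>]]]
    by simp
  \<comment> \<open>What remains for each range of p is a growth exponent e of the projections that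
    leaves \<open>\<kappa> - e > 1\<close>.\<close>
  have reduce: ?thesis
    if s1: "s \<ge> 1" and \<kappa>0: "\<kappa> \<ge> 0" and p1: "p \<ge> 1"
      and inf: "p = 1 \<Longrightarrow> \<exists>C>0. \<exists>e. \<kappa> - e > 1 \<and> (\<forall>j (x::real^'n). proj_kernel j x x \<le> C * (real j + 2) powr e)"
      and fin: "p > 1 \<Longrightarrow> \<exists>C>0. \<exists>e. \<kappa> - e > 1 \<and> (\<forall>j. eig_bound TYPE('n) (1 / c) j (C * (real j + 2) powr e))"
  proof -
    obtain K0 where K0: "K0 \<ge> 0" "\<And>x \<xi>. \<xi> \<ge> 1 \<Longrightarrow> norm (m x \<xi>) \<le> K0 * \<xi> powr (- \<kappa>)"
      using symbol_bound[OF psi cont s1 hoermander] unfolding \<kappa>_def n by metis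
    have K: "K0 + 1 > 0" using K0 by simp
    have mb: "norm (m x \<xi>) \<le> (K0 + 1) * \<xi> powr (- \<kappa>)" if "\<xi> \<ge> 1" for x \<xi>
      by (rule order_trans[OF K0(2)[OF that]]) (simp add: mult_right_mono)
    show ?thesis
    proof (cases "p = 1")
      case True
      obtain C e where "C > 0" "\<kappa> - e > 1" "\<And>j (x::real^'n). proj_kernel j x x \<le> C * (real j + 2) powr e"
        using inf[OF True] by blast
      then show ?thesis
        unfolding conjugate_exponent_cases(1)[OF conjugate p1 True] True
        by (intro pseudo_multiplier_bounded_L1[OF mcont mb K \<kappa>0])
    next
      case False
      then have p: "p > 1" using p1 by simp
      obtain C e where "C > 0" "\<kappa> - e > 1" "\<And>j. eig_bound TYPE('n) (1 / c) j (C * (real j + 2) powr e)"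
        using fin[OF p] by blast
      moreover have "1 / c > 1" "1 / p + 1 / (1 / c) = 1" using p by (auto simp: c_def field_simps)
      moreover have "p' = ennreal (1 / c)"
      proof -
        have "p / (p - 1) = 1 / c" using p by (simp add: c_def field_simps)
        then show ?thesis using conjugate_exponent_cases(2)[OF conjugate p1 p] by simp
      qed
      ultimately show ?thesis
        using pseudo_multiplier_bounded[OF mcont mb K \<kappa>0] p by blast
    qed
  qed
  consider (i) "n \<ge> 2" "1 \<le> p" "p \<le> 2 * real n / (real n + 2)" "s > (real n + 1) / 2 + delta n p"
    | (ii) "n \<ge> 2" "2 * real n / (real n + 2) < p" "p \<le> 2" "s > 3 * real n / 2"
    | (iii) "n = 1" "p > 1" "p \<le> 2" "p \<ge> 4 / 3" "s > 2 - 1 / p"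
    | (v) "n = 1" "1 < p" "p < 4 / 3" "s > 1 + 1 / (3 * p)"
    using cases
  proof (elim disjE conjE)
    assume "n = 1" "4 / 3 < p" "p \<le> 2" "s > 2 - 1 / p"
    then show ?thesis by (intro iii) auto
  next
    assume p: "n = 1" "p = 4 / 3" "s > 3 / 2"
    \<comment> \<open>The condition s > 3/2 at p = 4/3 exceeds the threshold 5/4 of the adjacent
      range, so this case is merged with it.\<close>
    have e: "2 - 1 / p = 5 / 4" unfolding p(2) by simp
    have "s > 2 - 1 / p" unfolding e using p(3) by simp
    then show ?thesis by (rule iii[rotated 4]) (use p in simp_all)
  qed blast+
  then show ?thesis
  proof cases
    case i
    have n2: "real n \<ge> 2" using i(1) by simp
    have pinv: "1 / p \<ge> 1 / 2 + 1 / real n"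
    proof -
      have "p * (real n + 2) \<le> 2 * real n" using i(3) n2 by (simp add: le_divide_eq)
      then show ?thesis using i(2) n2 by (simp add: field_simps)
    qed
    have p1: "1 / p \<le> 1" using i(2) by simp
    have "1 / real n \<ge> 0" by simp
    then have p2: "1 / p - 1 / 2 \<ge> 0" using pinv by linarith
    have "delta n p = real n * (1 / p - 1 / 2) - 1 / 2"
      unfolding delta_def abs_of_nonneg[OF p2] ..
    also have "\<dots> = real n / p - (real n + 1) / 2" by (simp add: field_simps)
    finally have sn: "s > real n / p" using i(4) by simp
    \<comment> \<open>This is s - n/p, the margin left by the strict condition on s.\<close>
    define d where "d = \<kappa> - (real n / 2 - real n * c)"
    have d: "d > 0" using sn by (simp add: d_def \<kappa>_def c_def algebra_simps)
    \<comment> \<open>\<beta> stands for t n/2. Integrability on the circle wants \<beta> < 1, and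
      \<open>\<kappa> - e > 1\<close> amounts to d + \<beta> > 1; the value 1 - d/2, cut at 0,
      satisfies both.\<close>
    define \<beta> where "\<beta> = max 0 (1 - d / 2)"
    have \<beta>: "0 \<le> \<beta>" "\<beta> < 1" "d + \<beta> > 1" using d by (auto simp: \<beta>_def max_def)
    define t where "t = 2 * \<beta> / real n"
    have t: "0 \<le> t" "t < 1" "t * (real CARD('n) / 2) < 1"
      using \<beta> n2 by (auto simp: t_def n[symmetric] divide_less_eq)
    have tn: "real n / 2 * (1 - t) = real n / 2 - \<beta>" using n2 by (simp add: t_def field_simps)
    have c2: "2 * c \<le> 1 - 2 / real n" using pinv by (simp add: c_def)
    have nc: "real n * c \<le> real n / 2 - 1"
    proof -
      have "real n * c = real n / 2 * (2 * c)" by simp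
      also have "\<dots> \<le> real n / 2 * (1 - 2 / real n)" using c2 by (intro mult_left_mono) auto
      also have "\<dots> = real n / 2 - 1" using n2 by (simp add: field_simps)
      finally show ?thesis .
    qed
    have \<kappa>1: "\<kappa> \<ge> 1" using d nc by (simp add: d_def)
    show ?thesis
    proof (rule reduce)
      show "s \<ge> 1" using \<kappa>1 by (simp add: \<kappa>_def)
      show "\<kappa> \<ge> 0" using \<kappa>1 by simp
      show "p \<ge> 1" by (rule i(2))
    next
      assume "p = 1"
      then have c0: "c = 0" by (simp add: c_def)
      obtain C where "C > 0" "\<And>j (x::real^'n). proj_kernel j x x \<le> C * (real j + 2) powr (real CARD('n) / 2 * (1 - t))"
        using proj_kernel_diag_bound[where t = t and 'n = 'n] t by (metis less_imp_le)
      moreover have "\<kappa> - real CARD('n) / 2 * (1 - t) > 1"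
        using \<beta>(3) c0 unfolding n[symmetric] tn by (simp add: d_def)
      ultimately show "\<exists>C>0. \<exists>e. \<kappa> - e > 1 \<and> (\<forall>j (x::real^'n). proj_kernel j x x \<le> C * (real j + 2) powr e)"
        by blast
    next
      assume p: "p > 1"
      then have c0: "c > 0" by (simp add: c_def)
      \<comment> \<open>q must exceed the weak-type exponent. The bound on p means 2 c <= 1 - 2/n,
        while \<beta> < 1 means t < 2/n.\<close>
      have q: "1 / c > 2 / (1 - t)"
      proof -
        have "t < 2 / real n" unfolding t_def using \<beta> n2 by (simp add: divide_strict_right_mono)
        then have "2 * c < 1 - t" using c2 by linarith
        then show ?thesis using c0 t by (simp add: field_simps)
      qed
      obtain C where "C > 0" "\<And>j. eig_bound TYPE('n) (1 / c) j (C * (real j + 2) powr (real CARD('n) / 2 * (1 - t) - real CARD('n) / (1 / c)))"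
        using eig_bound_weak[OF t q] by metis
      moreover have "\<kappa> - (real CARD('n) / 2 * (1 - t) - real CARD('n) / (1 / c)) > 1"
        using \<beta>(3) unfolding n[symmetric] tn by (simp add: d_def)
      ultimately show "\<exists>C>0. \<exists>e. \<kappa> - e > 1 \<and> (\<forall>j. eig_bound TYPE('n) (1 / c) j (C * (real j + 2) powr e))"
        by blast
    qed
  next
    case ii
    have n2: "real n \<ge> 2" using ii(1) by simp
    have "1 \<le> 2 * real n / (real n + 2)" using n2 by (simp add: le_divide_eq)
    then have p: "p > 1" using ii(2) by linarith
    have \<kappa>: "\<kappa> > real n" using ii(4) by (simp add: \<kappa>_def)
    have q: "1 / c \<ge> 2" using p ii(3) by (simp add: c_def field_simps)
    obtain C where "C > 0" "\<And>j. eig_bound TYPE('n) (1 / c) j (C * (real j + 2) powr (real CARD('n) / 2))"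
      using eig_bound_crude[OF q] by metis
    moreover have "\<kappa> - real CARD('n) / 2 > 1" using \<kappa> n2 by (simp add: n[symmetric])
    ultimately have "\<exists>C>0. \<exists>e. \<kappa> - e > 1 \<and> (\<forall>j. eig_bound TYPE('n) (1 / c) j (C * (real j + 2) powr e))"
      by blast
    then show ?thesis using \<kappa> n2 p by (intro reduce) (auto simp: \<kappa>_def)
  next
    case iii
    \<comment> \<open>Here the exponent is 1/2 - c, so d is s - (2 - 1/p); half of this margin is
      spent as the loss \<epsilon>.\<close>
    define d where "d = \<kappa> + hermite_exponent (1 / c) - 1"
    have c: "c > 0" "c \<le> 1 / 2" "c \<ge> 1 / 4" using iii by (auto simp: c_def field_simps)
    have "hermite_exponent (1 / c) = 1 / 2 - c" using c by (simp add: hermite_exponent_def field_simps)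
    then have d: "d > 0" using iii by (simp add: d_def \<kappa>_def c_def)
    have q: "1 / c \<ge> 2" using c by (simp add: field_simps)
    have card: "CARD('n) = 1" using iii n by simp
    obtain C where "C > 0" "\<And>j. eig_bound TYPE('n) (1 / c) j (C * (real j + 2) powr (d / 2 - hermite_exponent (1 / c)))"
      using eig_bound_one[OF card q, of "d / 2"] d by auto
    moreover have "\<kappa> - (d / 2 - hermite_exponent (1 / c)) > 1" using d d_def by linarith
    ultimately have "\<exists>C>0. \<exists>e. \<kappa> - e > 1 \<and> (\<forall>j. eig_bound TYPE('n) (1 / c) j (C * (real j + 2) powr e))"
      by blast
    moreover have "s \<ge> 1" using iii c by (simp add: c_def)
    ultimately show ?thesis using iii by (intro reduce) (auto simp: \<kappa>_def)
  next
    case v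
    \<comment> \<open>Now q exceeds 4 and the exponent is 1/6 + c/3, so d is s - 1 - 1/(3p).\<close>
    define d where "d = \<kappa> + hermite_exponent (1 / c) - 1"
    have c: "c > 0" "c < 1 / 4" using v by (auto simp: c_def field_simps)
    have h: "hermite_exponent (1 / c) = 1 / 6 + c / 3" using c by (simp add: hermite_exponent_def field_simps)
    have "c / 3 = 1 / 3 - 1 / (3 * p)" using v by (simp add: c_def field_simps)
    moreover have "real n = 1" using v by simp
    ultimately have d: "d > 0" using v(4) h d_def \<kappa>_def by linarith
    have q: "1 / c \<ge> 2" using c by (simp add: field_simps)
    have card: "CARD('n) = 1" using v n by simp
    obtain C where "C > 0" "\<And>j. eig_bound TYPE('n) (1 / c) j (C * (real j + 2) powr (d / 2 - hermite_exponent (1 / c)))"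
      using eig_bound_one[OF card q, of "d / 2"] d by auto
    moreover have "\<kappa> - (d / 2 - hermite_exponent (1 / c)) > 1" using d d_def by linarith
    ultimately have "\<exists>C>0. \<exists>e. \<kappa> - e > 1 \<and> (\<forall>j. eig_bound TYPE('n) (1 / c) j (C * (real j + 2) powr e))"
      by blast
    moreover have "s \<ge> 1"
    proof -
      have "1 / (3 * p) \<ge> 0" using v by simp
      then show ?thesis using v by linarith
    qed
    ultimately show ?thesis using v by (intro reduce) (auto simp: \<kappa>_def)
  qed
qed

end
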